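(* Let $f:\mathbb{N}_0\to(0,\infty)$ be an attachment function such that $f(0)<1$ and, for some $\gamma\in(0,\tfrac12)$, $f(k)\le \gamma k+1$ for all $k\in\mathbb{N}_0$. Let $\mathcal{G}_n$ be the preferential attachment graph on $n$ vertices with attachment function $f$, let $W_n$ be the number of isolated vertices of $\mathcal{G}_n$, and put $\mu_n=\mathbb{E}[W_n]$, $\sigma_n^2=\operatorname{Var}(W_n)$, $\widetilde W_n=(W_n-\mu_n)/\sigma_n$. Let $Z\sim\mathcal{N}(0,1)$. Then there exists a constant $C\in(0,\infty)$, independent of $n$, such that for all $n\ge 2$ $$d_W(\widetilde W_n,Z)\le C\begin{cases}\dfrac{1}{\sqrt n} & \text{if }\gamma\in(0,\tfrac14),\\[2mm] \sqrt{\dfrac{\log n}{n}} & \text{if }\gamma=\tfrac14,\\[2mm] n^{2\gamma-1} & \text{if }\gamma\in(\tfrac14,\tfrac12).\end{cases}$$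
   Context: Notation: $\mathbb{N}_0=\{0,1,2,\dots\}$, $[n]=\{1,\dots,n\}$. Preferential attachment model. Let $f:\mathbb{N}_0\to(0,\infty)$ satisfy $f(k)\le k+1$ for all $k$ (an attachment function). $\mathcal{G}_1$ is the graph with the single vertex $1$ and no edges. For $m\ge2$, $\mathcal{G}_m$ is obtained from $\mathcal{G}_{m-1}$ by adding vertex $m$ and, conditionally on $\mathcal{G}_{m-1}$, independently for each $k\in[m-1]$, inserting a directed edge $(m,k)$ from $m$ to $k$ with probability $f(d_{m-1}(k))/(m-1)$, where $d_{m-1}(k)$ is the indegree of vertex $k$ in $\mathcal{G}_{m-1}$ (the number of edges of $\mathcal{G}_{m-1}$ pointing to $k$). Edges are never removed. A vertex is isolated in $\mathcal{G}_n$ if it has neither incoming nor outgoing edges in $\mathcal{G}_n$. $d_W$ is the Wasserstein distance between the laws of two real random variables: $d_W(X,Y)=\sup|\mathbb{E}h(X)-\mathbb{E}h(Y)|$ over all 1-Lipschitz $h:\mathbb{R}\to\mathbb{R}$. *)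

theory Defs
  imports "HOL-Probability.Probability"
begin

definition attachment_function :: "(nat \<Rightarrow> real) \<Rightarrow> bool" where
  "attachment_function f \<longleftrightarrow> (\<forall>k. 0 < f k \<and> f k \<le> real k + 1)"

text \<open>
  A directed graph on the vertices \<open>{1..n}\<close> is represented by its edge set, where the pair
  \<open>(j, k)\<close> is the edge from \<open>j\<close> to \<open>k\<close>; the number \<open>n\<close> of vertices is kept separately.
\<close>

definition indegree :: "(nat \<times> nat) set \<Rightarrow> nat \<Rightarrow> nat" where
  "indegree E k = card {j. (j, k) \<in> E}"

text \<open>
  The law of the preferential attachment graph on \<open>n\<close> vertices. In the step from \<open>n\<close> to
  \<open>Suc n\<close> vertices, \<open>T k\<close> says whether the edge \<open>(Suc n, k)\<close> is inserted, so given \<open>E\<close> these are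
  independent Bernoulli variables. The recursion is started from the graph without vertices;
  the first step involves no coin flips and gives the graph with the single vertex \<open>1\<close>
  and no edges, see \<open>pref_attach_1\<close>.
\<close>

primrec pref_attach :: "(nat \<Rightarrow> real) \<Rightarrow> nat \<Rightarrow> (nat \<times> nat) set pmf" where
  "pref_attach f 0 = return_pmf {}"
| "pref_attach f (Suc n) =
     bind_pmf (pref_attach f n) (\<lambda>E.
       map_pmf (\<lambda>T. E \<union> {(Suc n, k) | k. k \<in> {1..n} \<and> T k})
         (Pi_pmf {1..n} False (\<lambda>k. bernoulli_pmf (f (indegree E k) / real n))))"

lemma pref_attach_1: "pref_attach f 1 = return_pmf {}"
  by (simp add: bind_return_pmf)

lemma set_pref_attach_subset:
  "E \<in> set_pmf (pref_attach f n) \<Longrightarrow> E \<subseteq> {(j, k). 1 \<le> k \<and> k < j \<and> j \<le> n}"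
proof (induction n arbitrary: E)
  case 0
  then show ?case by simp
next
  case (Suc n)
  then obtain E' T where E': "E' \<in> set_pmf (pref_attach f n)"
    and E: "E = E' \<union> {(Suc n, k) | k. k \<in> {1..n} \<and> T k}"
    by auto
  from Suc.IH[OF E'] show ?case unfolding E by fastforce
qed

text \<open>
  Since \<^const>\<open>bernoulli_pmf\<close> truncates its parameter to the unit interval, we check that the
  parameters used above are genuine probabilities.
\<close>

lemma pref_attach_prob:
  assumes f: "attachment_function f" and E: "E \<in> set_pmf (pref_attach f n)"
    and k: "k \<in> {1..n}"
  shows "f (indegree E k) / real n \<in> {0..1}"
proof -
  have "{j. (j, k) \<in> E} \<subseteq> {k<..n}"
    using set_pref_attach_subset[OF E] by auto
  then have "indegree E k \<le> card {k<..n}"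
    unfolding indegree_def by (intro card_mono) auto
  then have "real (indegree E k) + 1 \<le> real n"
    using k by auto
  moreover have "0 < f (indegree E k)" "f (indegree E k) \<le> real (indegree E k) + 1"
    using f by (auto simp: attachment_function_def)
  ultimately show ?thesis
    using k by auto
qed

definition isolated :: "(nat \<times> nat) set \<Rightarrow> nat \<Rightarrow> bool" where
  "isolated E v \<longleftrightarrow> (\<forall>u. (u, v) \<notin> E \<and> (v, u) \<notin> E)"

definition num_isolated :: "nat \<Rightarrow> (nat \<times> nat) set \<Rightarrow> nat" where
  "num_isolated n E = card {v \<in> {1..n}. isolated E v}"

definition mean_isolated :: "(nat \<Rightarrow> real) \<Rightarrow> nat \<Rightarrow> real" where
  "mean_isolated f n =
     measure_pmf.expectation (pref_attach f n) (\<lambda>E. real (num_isolated n E))"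

definition sd_isolated :: "(nat \<Rightarrow> real) \<Rightarrow> nat \<Rightarrow> real" where
  "sd_isolated f n =
     sqrt (measure_pmf.variance (pref_attach f n) (\<lambda>E. real (num_isolated n E)))"

definition std_isolated :: "(nat \<Rightarrow> real) \<Rightarrow> nat \<Rightarrow> (nat \<times> nat) set \<Rightarrow> real" where
  "std_isolated f n E = (real (num_isolated n E) - mean_isolated f n) / sd_isolated f n"

text \<open>
  The Wasserstein distance of two laws on the reals. The supremum is taken in the extended
  reals, so that it is meaningful also when it is infinite. Meant for laws with finite
  first moment, for which all the integrals exist.
\<close>

definition wasserstein_dist :: "real measure \<Rightarrow> real measure \<Rightarrow> ereal" where
  "wasserstein_dist M N =
     (SUP h\<in>{h :: real \<Rightarrow> real. 1-lipschitz_on UNIV h}.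
        ereal \<bar>integral\<^sup>L M h - integral\<^sup>L N h\<bar>)"

end

theory Submission
  imports Defs "HOL-Real_Asymp.Real_Asymp"
begin

text \<open>
  The in-edges of different vertices evolve independently, because the edges into \<open>k\<close> only depend
  on the earlier edges into \<open>k\<close>. Let \<open>H k\<close> consist of the in-neighbours of \<open>k\<close>, together with \<open>k\<close>
  itself if there are any. Then the isolated vertices are exactly the points of \<open>{1..n}\<close> that are
  not covered by the independent random sets \<open>H 1, ..., H n\<close>.

  Let \<open>W\<close> be the number of uncovered points, \<open>M j\<close> the increments of its Doob martingale with respect
  to \<open>H 1, H 2, ...\<close>, and \<open>\<delta> j\<close> the change of \<open>W\<close> when \<open>H j\<close> is replaced by the empty set. Then
  \<open>E[(W - E W) g(W)]\<close> is the sum of \<open>E[M j (g(W) - g(W - \<delta> j))]\<close>, so Stein's method bounds the distance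
  to the normal law in terms of the variance of \<open>T = sum M j \<delta> j\<close>, for which \<open>E T = Var W\<close>, and of third
  moments. The variance of \<open>T\<close> is estimated by the Efron--Stein inequality; the dominant terms are the fourth
  moments of the indegrees, of order \<open>(n / j) powr (4 * \<gamma>)\<close>, whose sum over \<open>j\<close> causes the three regimes
  of the theorem. That \<open>Var W\<close> is at least of order \<open>n\<close> follows from the Cauchy--Schwarz inequality for \<open>W\<close>
  and the number of empty \<open>H j\<close>.
\<close>

text \<open>The configuration with \<open>H j\<close> emptied does not involve \<open>H j\<close>,
  and \<open>M j\<close> averages to zero over \<open>H j\<close> with the other sets fixed. Hence
  E[M j g(W - \<delta> j)] = 0, and no second copy of the graph has to be coupled. Both |M j| and
  |\<delta> j| are at most |H j| + E|H j|, a function of \<open>H j\<close> alone, so independence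
  reduces every estimate to moments of a single indegree chain. The obstacle is the dependence
  inside \<open>T\<close>: emptying \<open>H i\<close> also alters the terms of the other sets. The
  change is confined to the points of \<open>H i\<close>, and controlling it needs joint moments of
  a degree and the indicator of one edge. The rate is sqrt (Var T) / Var W. The sum of j powr -(4
  \<gamma>) grows polynomially, grows logarithmically or stays bounded as \<gamma> is below, at or
  above 1/4. The condition \<gamma> < 1/2 makes the sum of (n / j) powr (2 \<gamma>) linear in n; by
  Cauchy--Schwarz the third moments are then of no larger order than the variance term.\<close>

section \<open>Stein's method for Lipschitz test functions\<close>

text \<open>Comparison from infinity: \<open>B + u\<close> and \<open>B - u\<close> decrease on the
  half-line from \<open>x\<close> and tend to 0, so they are nonnegative at \<open>x\<close>. The
  barrier \<open>B\<close> has to be guessed in each application.\<close>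

lemma abs_le_of_decay:
  fixes u u' B B' :: "real \<Rightarrow> real"
  assumes u: "\<And>y. x \<le> y \<Longrightarrow> (u has_real_derivative u' y) (at y)"
    and B: "\<And>y. x \<le> y \<Longrightarrow> (B has_real_derivative B' y) (at y)"
    and le: "\<And>y. x \<le> y \<Longrightarrow> \<bar>u' y\<bar> \<le> - B' y"
    and lim: "(u \<longlongrightarrow> 0) at_top" "(B \<longlongrightarrow> 0) at_top"
  shows "\<bar>u x\<bar> \<le> B x"
proof -
  have nonneg: "0 \<le> B x + c * u x" if c: "\<bar>c\<bar> = 1" for c
  proof (rule tendsto_upperbound)
    show "((\<lambda>y. B y + c * u y) \<longlongrightarrow> 0) at_top"
      using tendsto_add[OF lim(2) tendsto_mult_left[OF lim(1), of c]] by simp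
    show "\<forall>\<^sub>F y in at_top. B y + c * u y \<le> B x + c * u x"
      using eventually_ge_at_top[of x]
    proof eventually_elim
      case (elim y)
      show ?case
      proof (rule DERIV_nonpos_imp_nonincreasing[OF elim])
        fix z assume z: "x \<le> z" "z \<le> y"
        have "((\<lambda>y. B y + c * u y) has_real_derivative (B' z + c * u' z)) (at z)"
          by (auto intro!: derivative_eq_intros u B z)
        moreover have "B' z + c * u' z \<le> 0"
          using le[OF z(1)] c by (auto simp: abs_if split: if_splits)
        ultimately show "\<exists>d. ((\<lambda>y. B y + c * u y) has_real_derivative d) (at z) \<and> d \<le> 0"
          by blast
      qed
    qed
  qed simp
  from nonneg[of 1] nonneg[of "-1"] show ?thesis by simp
qed

lemma gaussian_has_derivative:
  "((\<lambda>y::real. exp (- y\<^sup>2 / 2)) has_real_derivative - y * exp (- y\<^sup>2 / 2)) (at y)"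
  by (auto intro!: derivative_eq_intros)

lemma gaussian_decay_linear:
  fixes u u' :: "real \<Rightarrow> real"
  assumes u: "\<And>y. (u has_real_derivative u' y) (at y)"
    and le: "\<And>y. \<bar>u' y\<bar> \<le> (\<bar>y\<bar> + 1) * exp (- y\<^sup>2 / 2)"
    and lim: "(u \<longlongrightarrow> 0) at_top" "(u \<longlongrightarrow> 0) at_bot"
  shows "\<bar>u x\<bar> \<le> 3 * exp (- x\<^sup>2 / 2)"
proof -
  have half: "\<bar>v x\<bar> \<le> 3 * exp (- x\<^sup>2 / 2)"
    if x: "0 \<le> x" and v: "\<And>y. (v has_real_derivative v' y) (at y)"
      and vle: "\<And>y. \<bar>v' y\<bar> \<le> (\<bar>y\<bar> + 1) * exp (- y\<^sup>2 / 2)"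
      and vlim: "(v \<longlongrightarrow> 0) at_top" for v v' :: "real \<Rightarrow> real" and x
  proof -
    \<comment> \<open>The barrier 2 exp(-y^2/2) has derivative of size 2y exp(-y^2/2), which falls
      short of y + 1 for y < 1. The summand 1/(1 + y) makes up for this, with equality at y =
      0.\<close>
    let ?B = "\<lambda>y::real. (2 + 1 / (1 + y)) * exp (- y\<^sup>2 / 2)"
    let ?B' = "\<lambda>y::real. - (1 / (1 + y)^2 + y * (2 + 1 / (1 + y))) * exp (- y\<^sup>2 / 2)"
    have "\<bar>v x\<bar> \<le> ?B x"
    proof (rule abs_le_of_decay[OF v _ _ vlim, where B' = ?B'])
      fix y assume y: "x \<le> y"
      with x have y0: "0 \<le> y" by simp
      have b: "((\<lambda>y. 2 + 1 / (1 + y)) has_real_derivative - (1 / (1 + y)^2)) (at y)"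
        using y0 by (auto intro!: derivative_eq_intros simp: power2_eq_square)
      show "(?B has_real_derivative ?B' y) (at y)"
        by (rule DERIV_cong[OF DERIV_mult[OF b gaussian_has_derivative]]) (simp add: algebra_simps)
      have "y + 1 \<le> 1 / (1 + y)^2 + y * (2 + 1 / (1 + y))"
        using y0 by (simp add: divide_simps power2_eq_square add_pos_nonneg) (simp add: algebra_simps)
      then have "(y + 1) * exp (- y\<^sup>2 / 2) \<le> - ?B' y"
        using mult_right_mono[of "y + 1" _ "exp (- y\<^sup>2 / 2)"] by (simp only: minus_mult_minus mult_minus_left minus_minus exp_ge_zero)
      then show "\<bar>v' y\<bar> \<le> - ?B' y"
        using vle[of y] y0 by simp
    next
      show "(?B \<longlongrightarrow> 0) at_top" by real_asymp
    qed
    also have "?B x \<le> 3 * exp (- x\<^sup>2 / 2)"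
      using x by (intro mult_right_mono) (auto simp: field_simps)
    finally show ?thesis .
  qed
  show ?thesis
  proof (cases "0 \<le> x")
    case True
    show ?thesis by (rule half[OF True u le lim(1)])
  next
    case False
    have "\<bar>u (- (- x))\<bar> \<le> 3 * exp (- (- x)\<^sup>2 / 2)"
    proof (rule half[where v = "\<lambda>y. u (- y)" and v' = "\<lambda>y. - u' (- y)"])
      show "((\<lambda>y. u (- y)) has_real_derivative - u' (- y)) (at y)" for y
        using DERIV_chain2[OF u[of "- y"] DERIV_minus[OF DERIV_ident]] by simp
      show "\<bar>- u' (- y)\<bar> \<le> (\<bar>y\<bar> + 1) * exp (- y\<^sup>2 / 2)" for y
        using le[of "- y"] by simp
      show "((\<lambda>y. u (- y)) \<longlongrightarrow> 0) at_top"
        using lim(2) by (simp add: filterlim_at_bot_mirror)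
    qed (use False in auto)
    then show ?thesis by simp
  qed
qed

text \<open>A Mills-ratio estimate. The gain 1/(1 + |x|) over the plain Gaussian factor is what
  later bounds x g'(x) for the Stein solution g.\<close>

lemma gaussian_decay_const:
  fixes u u' :: "real \<Rightarrow> real"
  assumes u: "\<And>y. (u has_real_derivative u' y) (at y)"
    and le: "\<And>y. \<bar>u' y\<bar> \<le> K * exp (- y\<^sup>2 / 2)"
    and lim: "(u \<longlongrightarrow> 0) at_top" "(u \<longlongrightarrow> 0) at_bot"
  shows "\<bar>u x\<bar> \<le> 2 * K / (1 + \<bar>x\<bar>) * exp (- x\<^sup>2 / 2)"
proof -
  have K: "0 \<le> K" using le[of 0] by simp
  have half: "\<bar>v x\<bar> \<le> 2 * K / (1 + x) * exp (- x\<^sup>2 / 2)"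
    if x: "0 \<le> x" and v: "\<And>y. (v has_real_derivative v' y) (at y)"
      and vle: "\<And>y. \<bar>v' y\<bar> \<le> K * exp (- y\<^sup>2 / 2)"
      and vlim: "(v \<longlongrightarrow> 0) at_top" for v v' :: "real \<Rightarrow> real" and x
  proof -
    let ?B = "\<lambda>y::real. 2 * K / (1 + y) * exp (- y\<^sup>2 / 2)"
    let ?B' = "\<lambda>y::real. - K * (2 / (1 + y)^2 + 2 * y / (1 + y)) * exp (- y\<^sup>2 / 2)"
    show "\<bar>v x\<bar> \<le> ?B x"
    proof (rule abs_le_of_decay[OF v _ _ vlim, where B' = ?B'])
      fix y assume y: "x \<le> y"
      with x have y0: "0 \<le> y" by simp
      have b: "((\<lambda>y. 2 * K / (1 + y)) has_real_derivative - (2 * K / (1 + y)^2)) (at y)"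
        using y0 by (auto intro!: derivative_eq_intros simp: power2_eq_square)
      show "(?B has_real_derivative ?B' y) (at y)"
        by (rule DERIV_cong[OF DERIV_mult[OF b gaussian_has_derivative]]) (simp add: algebra_simps)
      have "1 \<le> 2 / (1 + y)^2 + 2 * y / (1 + y)"
        using y0 by (simp add: divide_simps power2_eq_square add_pos_nonneg) (simp add: algebra_simps)
      then have "K * 1 * exp (- y\<^sup>2 / 2) \<le> K * (2 / (1 + y)^2 + 2 * y / (1 + y)) * exp (- y\<^sup>2 / 2)"
        using K by (intro mult_right_mono mult_left_mono) auto
      then show "\<bar>v' y\<bar> \<le> - ?B' y"
        using vle[of y] by simp
    next
      show "(?B \<longlongrightarrow> 0) at_top" by real_asymp
    qed
  qed
  show ?thesis
  proof (cases "0 \<le> x")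
    case True
    then show ?thesis using half[OF True u le lim(1)] by simp
  next
    case False
    have "\<bar>u (- (- x))\<bar> \<le> 2 * K / (1 + - x) * exp (- (- x)\<^sup>2 / 2)"
    proof (rule half[where v = "\<lambda>y. u (- y)" and v' = "\<lambda>y. - u' (- y)"])
      show "((\<lambda>y. u (- y)) has_real_derivative - u' (- y)) (at y)" for y
        using DERIV_chain2[OF u[of "- y"] DERIV_minus[OF DERIV_ident]] by simp
      show "\<bar>- u' (- y)\<bar> \<le> K * exp (- y\<^sup>2 / 2)" for y
        using le[of "- y"] by simp
      show "((\<lambda>y. u (- y)) \<longlongrightarrow> 0) at_top"
        using lim(2) by (simp add: filterlim_at_bot_mirror)
    qed (use False in auto)
    then show ?thesis using False by simp
  qed
qed

text \<open>G is the integral of \<open>k\<close> over the half-line up to x. Since the total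
  integral is 0, it is also minus the integral over the complementary half-line. Hence it vanishes
  at both ends; the end at minus infinity is treated by reflecting \<open>k\<close>.\<close>

lemma antiderivative_of_integrable:
  fixes k :: "real \<Rightarrow> real"
  assumes int: "integrable lborel k" and cont: "continuous_on UNIV k" and zero: "(\<integral>x. k x \<partial>lborel) = 0"
  obtains G where "\<And>x. (G has_real_derivative k x) (at x)"
    "(G \<longlongrightarrow> 0) at_top" "(G \<longlongrightarrow> 0) at_bot"
proof -
  define G where "G = (\<lambda>x. \<integral>y. indicator {..x} y *\<^sub>R k y \<partial>lborel)"
  have ind: "integrable lborel (\<lambda>y. indicator A y *\<^sub>R k y)" if "A \<in> sets borel" for A
    using integrable_mult_indicator[of A lborel k] int that by simp
  have G_eq: "G x = G a + integral {a..x} k" if ax: "a \<le> x" for a x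
  proof -
    have "integral {a..x} k = (LINT y:{a..x}|lborel. k y)"
      by (rule set_borel_integral_eq_integral(2)[symmetric])
         (use ind in \<open>auto simp: set_integrable_def\<close>)
    also have "\<dots> = (\<integral>y. indicator {a<..x} y *\<^sub>R k y \<partial>lborel)"
      unfolding set_lebesgue_integral_def
      by (rule integral_cong_AE)
         (use AE_lborel_singleton[of a] int in \<open>auto split: split_indicator\<close>)
    also have "\<dots> = (\<integral>y. indicator {..x} y *\<^sub>R k y - indicator {..a} y *\<^sub>R k y \<partial>lborel)"
      by (rule Bochner_Integration.integral_cong) (use ax in \<open>auto split: split_indicator\<close>)
    also have "\<dots> = G x - G a"
      unfolding G_def by (rule Bochner_Integration.integral_diff) (use ind in auto)
    finally show ?thesis by simp
  qed
  have deriv: "(G has_real_derivative k x) (at x)" for x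
  proof -
    have "((\<lambda>u. G (x - 1) + integral {x - 1..u} k) has_real_derivative 0 + k x) (at x within {x - 1..x + 1})"
      by (intro DERIV_add DERIV_const integral_has_real_derivative)
         (auto intro: continuous_on_subset[OF cont])
    then have d: "((\<lambda>u. G (x - 1) + integral {x - 1..u} k) has_real_derivative k x) (at x)"
      using at_within_interior[of x "{x - 1..x + 1}"] by simp
    have ev: "\<forall>\<^sub>F u in nhds x. G (x - 1) + integral {x - 1..u} k = G u"
    proof (rule eventually_mono)
      show "\<forall>\<^sub>F u in nhds x. u \<in> {x - 1<..}"
        by (rule eventually_nhds_in_open) auto
      show "G (x - 1) + integral {x - 1..u} k = G u" if "u \<in> {x - 1<..}" for u
        using that G_eq[of "x - 1" u] by simp
    qed
    show ?thesis
      using DERIV_cong_ev[OF refl ev refl, THEN iffD1] d by blast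
  qed
  have top: "(G \<longlongrightarrow> 0) at_top"
    using tendsto_integral_at_top[of lborel k] int zero unfolding G_def by simp
  have "(G \<longlongrightarrow> 0) at_bot"
  proof -
    define k2 where "k2 = (\<lambda>y. k (- y))"
    have int2: "integrable lborel k2"
      using lborel_integrable_real_affine[OF int, of "-1" 0] by (simp add: k2_def)
    have zero2: "(\<integral>x. k2 x \<partial>lborel) = 0"
      using lborel_integral_real_affine[of "-1" k 0] zero by (simp add: k2_def)
    have "G (- x) = - (\<integral>y. indicator {..x} y *\<^sub>R k2 y \<partial>lborel)" for x
    proof -
      have "(\<integral>y. indicator {..x} y *\<^sub>R k2 y \<partial>lborel) = (\<integral>y. indicator {-x..} y *\<^sub>R k y \<partial>lborel)"
        using lborel_integral_real_affine[of "-1" "\<lambda>y. indicator {-x..} y *\<^sub>R k y" 0]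
        by (simp add: k2_def indicator_def)
      moreover have "G (- x) + (\<integral>y. indicator {-x..} y *\<^sub>R k y \<partial>lborel)
          = (\<integral>y. indicator {..-x} y *\<^sub>R k y + indicator {-x..} y *\<^sub>R k y \<partial>lborel)"
        unfolding G_def by (rule Bochner_Integration.integral_add[symmetric]) (use ind in auto)
      moreover have "\<dots> = (\<integral>y. k y \<partial>lborel)"
        by (rule integral_cong_AE)
           (use AE_lborel_singleton[of "-x"] int in \<open>auto split: split_indicator\<close>)
      ultimately show ?thesis using zero by simp
    qed
    then have "((\<lambda>x. G (- x)) \<longlongrightarrow> 0) at_top"
      using tendsto_minus[OF tendsto_integral_at_top[of lborel k2]] int2 zero2 by simp
    then show ?thesis by (simp add: filterlim_at_bot_mirror)
  qed
  with deriv top show ?thesis by (rule that)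
qed

section \<open>Lipschitz functions under the normal law\<close>

lemma integrable_normal_of_lipschitz:
  assumes "1-lipschitz_on UNIV h"
  shows "integrable lborel (\<lambda>x. std_normal_density x * h x)"
proof (rule Bochner_Integration.integrable_bound)
  show "integrable lborel (\<lambda>x. std_normal_density x * \<bar>x\<bar> ^ 1 + \<bar>h 0\<bar> * std_normal_density x)"
    by (intro Bochner_Integration.integrable_add integrable_std_normal_moment_abs) auto
  have "continuous_on UNIV h" by (rule lipschitz_on_continuous_on[OF assms])
  then show "(\<lambda>x. std_normal_density x * h x) \<in> borel_measurable lborel"
    using borel_measurable_continuous_onI[of h] by simp
  show "AE x in lborel. norm (std_normal_density x * h x)
      \<le> norm (std_normal_density x * \<bar>x\<bar> ^ 1 + \<bar>h 0\<bar> * std_normal_density x)"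
  proof (rule AE_I2)
    fix x
    have "\<bar>h x - h 0\<bar> \<le> \<bar>x\<bar>"
      using lipschitz_onD[OF assms, of x 0] by (simp add: dist_real_def)
    then have "\<bar>h x\<bar> \<le> \<bar>x\<bar> + \<bar>h 0\<bar>" by simp
    then have "std_normal_density x * \<bar>h x\<bar> \<le> std_normal_density x * (\<bar>x\<bar> + \<bar>h 0\<bar>)"
      by (intro mult_left_mono) auto
    then show "norm (std_normal_density x * h x)
        \<le> norm (std_normal_density x * \<bar>x\<bar> ^ 1 + \<bar>h 0\<bar> * std_normal_density x)"
      by (simp add: abs_mult algebra_simps)
  qed
qed

lemma integral_std_normal_distribution:
  assumes "h \<in> borel_measurable borel"
  shows "integral\<^sup>L std_normal_distribution h = (\<integral>x. std_normal_density x * h x \<partial>lborel)"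
  by (subst integral_density) (use assms in auto)

text \<open>The difference is at most E|y - Z|, hence at most |y| + E|Z|, and E|Z| = sqrt (2 / pi)
  is below 1.\<close>

lemma abs_diff_normal_mean_le:
  assumes lip: "1-lipschitz_on UNIV h"
  shows "\<bar>h y - integral\<^sup>L std_normal_distribution h\<bar> \<le> \<bar>y\<bar> + 1"
proof -
  have meas: "h \<in> borel_measurable borel"
    using lipschitz_on_continuous_on[OF lip] by (rule borel_measurable_continuous_onI)
  note int = integrable_normal_of_lipschitz[OF lip]
  have bint: "integrable lborel (\<lambda>x. \<bar>y\<bar> * std_normal_density x + std_normal_density x * \<bar>x\<bar> ^ 1)"
    by (intro Bochner_Integration.integrable_add integrable_std_normal_moment_abs) auto
  have "h y - integral\<^sup>L std_normal_distribution h = (\<integral>x. h y * std_normal_density x - std_normal_density x * h x \<partial>lborel)"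
    by (subst Bochner_Integration.integral_diff)
       (use int in \<open>auto simp: integral_std_normal_distribution[OF meas]\<close>)
  also have "\<bar>\<dots>\<bar> \<le> (\<integral>x. \<bar>y\<bar> * std_normal_density x + std_normal_density x * \<bar>x\<bar> ^ 1 \<partial>lborel)"
  proof (rule integral_abs_bound_integral[OF _ bint])
    show "integrable lborel (\<lambda>x. h y * std_normal_density x - std_normal_density x * h x)"
      using int by (intro Bochner_Integration.integrable_diff) auto
    fix x
    have "\<bar>h y - h x\<bar> \<le> \<bar>y\<bar> + \<bar>x\<bar>"
      using lipschitz_onD[OF lip, of y x] abs_triangle_ineq4[of y x] by (simp add: dist_real_def)
    then have "std_normal_density x * \<bar>h y - h x\<bar> \<le> std_normal_density x * (\<bar>y\<bar> + \<bar>x\<bar>)"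
      by (intro mult_left_mono) auto
    moreover have "h y * std_normal_density x - std_normal_density x * h x = std_normal_density x * (h y - h x)"
      by (simp add: algebra_simps)
    ultimately show "\<bar>h y * std_normal_density x - std_normal_density x * h x\<bar>
        \<le> \<bar>y\<bar> * std_normal_density x + std_normal_density x * \<bar>x\<bar> ^ 1"
      by (simp only: abs_mult) (simp add: algebra_simps)
  qed
  also have "\<dots> = \<bar>y\<bar> + sqrt (2 / pi)"
    by (subst Bochner_Integration.integral_add)
       (use integrable_std_normal_moment_abs[of 1] integral_std_normal_moment_abs_odd[of 0] in auto)
  also have "sqrt (2 / pi) \<le> 1" using pi_ge_two by simp
  finally show ?thesis by simp
qed

lemma lipschitz_of_derivative_le_1:
  fixes h h' :: "real \<Rightarrow> real"
  assumes h: "\<And>x. (h has_real_derivative h' x) (at x)" and h': "\<And>x. \<bar>h' x\<bar> \<le> 1"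
  shows "1-lipschitz_on UNIV h"
  using field_differentiable_bound[of UNIV h h' 1] h h'
  by (intro lipschitz_onI) (auto simp: dist_norm)

text \<open>The constants 8 and 12 are those that \<open>stein_solution\<close> produces for test
  functions with derivative at most 1.\<close>

definition stein_class :: "(real \<Rightarrow> real) \<Rightarrow> (real \<Rightarrow> real) \<Rightarrow> bool" where
  "stein_class g g' \<longleftrightarrow> (\<forall>x. (g has_real_derivative g' x) (at x)) \<and> (\<forall>x. \<bar>g' x\<bar> \<le> 8) \<and>
     (\<exists>g''. \<forall>x. (g' has_real_derivative g'' x) (at x) \<and> \<bar>g'' x\<bar> \<le> 12)"

text \<open>The mean value inequality for y \<mapsto> g y - g' x * y, whose derivative is at most 12
  |d| between x - d and x.\<close>

lemma stein_class_taylor: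
  assumes "stein_class g g'"
  shows "\<bar>g x - g (x - d) - g' x * d\<bar> \<le> 12 * d\<^sup>2"
proof -
  obtain g'' where g: "\<And>x. (g has_real_derivative g' x) (at x)"
    and g': "\<And>x. (g' has_real_derivative g'' x) (at x)" "\<And>x. \<bar>g'' x\<bar> \<le> 12"
    using assms unfolding stein_class_def by blast
  have lip: "\<bar>g' y - g' z\<bar> \<le> 12 * \<bar>y - z\<bar>" for y z
    using field_differentiable_bound[of UNIV g' g'' 12 y z] g' by simp
  have "\<bar>(g x - g' x * x) - (g (x - d) - g' x * (x - d))\<bar> \<le> 12 * \<bar>d\<bar> * \<bar>x - (x - d)\<bar>"
  proof -
    have "norm ((\<lambda>y. g y - g' x * y) x - (\<lambda>y. g y - g' x * y) (x - d)) \<le> 12 * \<bar>d\<bar> * norm (x - (x - d))"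
    proof (rule field_differentiable_bound[of "closed_segment (x - d) x" _ "\<lambda>y. g' y - g' x"])
      fix y assume y: "y \<in> closed_segment (x - d) x"
      show "((\<lambda>y. g y - g' x * y) has_real_derivative g' y - g' x) (at y within closed_segment (x - d) x)"
        by (auto intro!: derivative_eq_intros DERIV_subset[OF g])
      have "\<bar>y - x\<bar> \<le> \<bar>d\<bar>"
        using y by (auto simp: closed_segment_eq_real_ivl split: if_splits)
      then show "norm (g' y - g' x) \<le> 12 * \<bar>d\<bar>" using lip[of y x] by simp
    qed auto
    then show ?thesis by simp
  qed
  then show ?thesis by (simp add: algebra_simps power2_eq_square abs_mult_self_eq mult.assoc)
qed

text \<open>The classical solution g = exp(x^2/2) times the integral of the centred \<open>h\<close>
  against exp(-y^2/2), bounded by 3. Differentiating the Stein equation shows that p = g' satisfies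
  p' - x p = g + h', again a Stein equation, now with right-hand side at most 4. So |p| is at most
  8/(1 + |x|), which bounds both p and x p by 8, and p' = g + x p + h' by 3 + 8 + 1.\<close>

lemma stein_solution:
  fixes h h' :: "real \<Rightarrow> real"
  assumes h: "\<And>x. (h has_real_derivative h' x) (at x)" and h': "\<And>x. \<bar>h' x\<bar> \<le> 1"
  obtains g g' where "stein_class g g'"
    "\<And>x. g' x - x * g x = h x - integral\<^sup>L std_normal_distribution h"
proof -
  have lip: "1-lipschitz_on UNIV h"
    by (rule lipschitz_of_derivative_le_1[OF h h'])
  note cont = lipschitz_on_continuous_on[OF lip]
  define m where "m = integral\<^sup>L std_normal_distribution h"
  define ht where "ht = (\<lambda>x. h x - m)"
  have ht_le: "\<bar>ht y\<bar> \<le> \<bar>y\<bar> + 1" for y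
    unfolding ht_def m_def by (rule abs_diff_normal_mean_le[OF lip])
  define k where "k = (\<lambda>x. ht x * exp (- x\<^sup>2 / 2))"
  have k_eq: "k x = sqrt (2 * pi) * (std_normal_density x * h x - m * std_normal_density x)" for x
    by (simp add: k_def ht_def std_normal_density_def field_simps)
  have int: "integrable lborel (\<lambda>x. std_normal_density x * h x - m * std_normal_density x)"
    using integrable_normal_of_lipschitz[OF lip] by (intro Bochner_Integration.integrable_diff) auto
  have "integrable lborel k"
    unfolding k_eq[abs_def] by (intro integrable_mult_right int)
  moreover have "(\<integral>x. k x \<partial>lborel) = 0"
  proof -
    have "(\<integral>x. std_normal_density x * h x - m * std_normal_density x \<partial>lborel) = 0"
      by (subst Bochner_Integration.integral_diff)
         (use integrable_normal_of_lipschitz[OF lip] in \<open>auto simp: m_def integral_std_normal_distribution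
            borel_measurable_continuous_onI[OF cont]\<close>)
    then show ?thesis unfolding k_eq[abs_def] by simp
  qed
  moreover have "continuous_on UNIV k"
    unfolding k_def ht_def by (intro continuous_intros cont) auto
  ultimately obtain G where G: "\<And>x. (G has_real_derivative k x) (at x)"
    and Glim: "(G \<longlongrightarrow> 0) at_top" "(G \<longlongrightarrow> 0) at_bot"
    using antiderivative_of_integrable by blast
  define g where "g = (\<lambda>x. exp (x\<^sup>2 / 2) * G x)"
  have exp_cancel: "exp (x\<^sup>2 / 2) * exp (- x\<^sup>2 / 2) = 1" for x :: real
    by (simp flip: exp_add)
  have g_le: "\<bar>g x\<bar> \<le> 3" for x
  proof -
    have "\<bar>G x\<bar> \<le> 3 * exp (- x\<^sup>2 / 2)"
      by (rule gaussian_decay_linear[OF G _ Glim])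
         (use ht_le in \<open>auto simp: k_def abs_mult intro!: mult_right_mono\<close>)
    then have "exp (x\<^sup>2 / 2) * \<bar>G x\<bar> \<le> exp (x\<^sup>2 / 2) * (3 * exp (- x\<^sup>2 / 2))"
      by (intro mult_left_mono) auto
    also have "\<dots> = 3" using exp_cancel[of x] by (simp add: mult_ac)
    finally show ?thesis by (simp add: g_def abs_mult)
  qed
  define p where "p = (\<lambda>x. x * g x + ht x)"
  have g_deriv: "(g has_real_derivative p x) (at x)" for x
  proof -
    have d: "((\<lambda>x::real. exp (x\<^sup>2 / 2)) has_real_derivative x * exp (x\<^sup>2 / 2)) (at x)"
      by (auto intro!: derivative_eq_intros)
    have "p x = x * exp (x\<^sup>2 / 2) * G x + ht x * (exp (x\<^sup>2 / 2) * exp (- x\<^sup>2 / 2))"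
      unfolding exp_cancel by (simp add: p_def g_def)
    also have "\<dots> = x * exp (x\<^sup>2 / 2) * G x + k x * exp (x\<^sup>2 / 2)"
      by (simp add: k_def)
    finally show ?thesis
      using DERIV_mult[OF d G[of x]] by (simp only: g_def)
  qed
  define p' where "p' = (\<lambda>x. g x + x * p x + h' x)"
  have p_deriv: "(p has_real_derivative p' x) (at x)" for x
    unfolding p_def ht_def
    by (rule derivative_eq_intros g_deriv h refl)+ (simp add: p'_def p_def ht_def)
  define u where "u = (\<lambda>x. p x * exp (- x\<^sup>2 / 2))"
  \<comment> \<open>The integrating factor removes the term x p, so that only the bounded part g +
    h' remains.\<close>
  have u_deriv: "(u has_real_derivative (g x + h' x) * exp (- x\<^sup>2 / 2)) (at x)" for x
    unfolding u_def
    using DERIV_mult[OF p_deriv[of x] gaussian_has_derivative[of x]]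
    by (rule DERIV_cong) (simp add: p'_def ring_distribs mult_ac)
  have p_lin: "\<bar>p x\<bar> \<le> 4 * \<bar>x\<bar> + 1" for x
  proof -
    have "\<bar>x * g x\<bar> \<le> \<bar>x\<bar> * 3" unfolding abs_mult by (intro mult_left_mono g_le) auto
    then show ?thesis using ht_le[of x] unfolding p_def by linarith
  qed
  have u_le: "norm (u x) \<le> (4 * \<bar>x\<bar> + 1) * exp (- x\<^sup>2 / 2)" for x
    using p_lin[of x] by (auto simp: u_def abs_mult intro!: mult_right_mono)
  have p_decay: "\<bar>p x\<bar> \<le> 8 / (1 + \<bar>x\<bar>)" for x
  proof -
    have "\<bar>u x\<bar> \<le> 2 * 4 / (1 + \<bar>x\<bar>) * exp (- x\<^sup>2 / 2)"
    proof (rule gaussian_decay_const[OF u_deriv])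
      show "\<bar>(g y + h' y) * exp (- y\<^sup>2 / 2)\<bar> \<le> 4 * exp (- y\<^sup>2 / 2)" for y
        using g_le[of y] h'[of y] by (auto simp: abs_mult intro!: mult_right_mono)
      have lim: "((\<lambda>x::real. (4 * \<bar>x\<bar> + 1) * exp (- x\<^sup>2 / 2)) \<longlongrightarrow> 0) at_top"
        "((\<lambda>x::real. (4 * \<bar>x\<bar> + 1) * exp (- x\<^sup>2 / 2)) \<longlongrightarrow> 0) at_bot"
        by real_asymp+
      have "\<forall>\<^sub>F x in F. norm (u x) \<le> (4 * \<bar>x\<bar> + 1) * exp (- x\<^sup>2 / 2)" for F
        by (rule always_eventually) (use u_le in blast)
      then show "(u \<longlongrightarrow> 0) at_top" "(u \<longlongrightarrow> 0) at_bot"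
        by (rule Lim_null_comparison[OF _ lim(1)] Lim_null_comparison[OF _ lim(2)])+
    qed
    then have "\<bar>u x\<bar> * exp (x\<^sup>2 / 2) \<le> 2 * 4 / (1 + \<bar>x\<bar>) * exp (- x\<^sup>2 / 2) * exp (x\<^sup>2 / 2)"
      by (intro mult_right_mono) auto
    moreover have "\<bar>u x\<bar> * exp (x\<^sup>2 / 2) = \<bar>p x\<bar>"
      using exp_cancel[of x] by (simp add: u_def abs_mult mult_ac)
    moreover have "2 * 4 / (1 + \<bar>x\<bar>) * exp (- x\<^sup>2 / 2) * exp (x\<^sup>2 / 2) = 8 / (1 + \<bar>x\<bar>)"
      using exp_cancel[of x] by (simp add: mult_ac)
    ultimately show ?thesis by linarith
  qed
  have "8 / (1 + \<bar>x\<bar>) \<le> 8" for x :: real by (simp add: field_simps)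
  then have p8: "\<bar>p x\<bar> \<le> 8" for x using p_decay[of x] order_trans by blast
  have xp8: "\<bar>x * p x\<bar> \<le> 8" for x
  proof -
    have "\<bar>x * p x\<bar> \<le> \<bar>x\<bar> * (8 / (1 + \<bar>x\<bar>))" unfolding abs_mult by (intro mult_left_mono p_decay) auto
    also have "\<dots> \<le> 8" by (simp add: field_simps)
    finally show ?thesis .
  qed
  have "\<bar>p' x\<bar> \<le> 12" for x
    using g_le[of x] xp8[of x] h'[of x] unfolding p'_def by linarith
  then have "stein_class g p"
    unfolding stein_class_def by (intro conjI allI exI[of _ p'] g_deriv p_deriv p8)
  moreover have "p x - x * g x = h x - integral\<^sup>L std_normal_distribution h" for x
    by (simp add: p_def ht_def m_def)
  ultimately show ?thesis by (rule that)
qed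

text \<open>The average of \<open>h\<close> over [x, x + \<epsilon>]: its derivative is a difference
  quotient of \<open>h\<close>, and by the mean value theorem its value is attained by
  \<open>h\<close> inside the interval.\<close>

lemma lipschitz_smoothing:
  fixes h :: "real \<Rightarrow> real"
  assumes lip: "1-lipschitz_on UNIV h" and \<epsilon>: "\<epsilon> > 0"
  obtains s s' where "\<And>x. (s has_real_derivative s' x) (at x)" "\<And>x. \<bar>s' x\<bar> \<le> 1"
    "\<And>x. \<bar>s x - h x\<bar> \<le> \<epsilon>"
proof -
  note cont = lipschitz_on_continuous_on[OF lip]
  have hd: "\<bar>h x - h y\<bar> \<le> \<bar>x - y\<bar>" for x y
    using lipschitz_onD[OF lip, of x y] by (simp add: dist_real_def)
  have "\<exists>H. \<forall>x. (H has_real_derivative h x) (at x)"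
  proof -
    have "isCont h x" for x
      using cont by (simp add: continuous_on_eq_continuous_at)
    then obtain F where "\<forall>x::real. - \<infinity> < ereal x \<longrightarrow> ereal x < \<infinity> \<longrightarrow> (F has_vector_derivative h x) (at x)"
      using einterval_antiderivative[of "- \<infinity>" \<infinity> h] by auto
    then show ?thesis by (auto simp: has_real_derivative_iff_has_vector_derivative)
  qed
  then obtain H where H: "\<And>x. (H has_real_derivative h x) (at x)" by blast
  define s where "s = (\<lambda>x. (H (x + \<epsilon>) - H x) / \<epsilon>)"
  define s' where "s' = (\<lambda>x. (h (x + \<epsilon>) - h x) / \<epsilon>)"
  have "(s has_real_derivative s' x) (at x)" for x
    unfolding s_def s'_def using \<epsilon>
    by (auto intro!: derivative_eq_intros DERIV_chain2[OF H] H)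
  moreover have "\<bar>s' x\<bar> \<le> 1" for x
    using hd[of "x + \<epsilon>" x] \<epsilon> by (simp add: s'_def)
  moreover have "\<bar>s x - h x\<bar> \<le> \<epsilon>" for x
  proof -
    obtain z where z: "x < z" "z < x + \<epsilon>" "H (x + \<epsilon>) - H x = (x + \<epsilon> - x) * h z"
      using MVT2[of x "x + \<epsilon>" H h] H \<epsilon> by auto
    then have "s x = h z" using \<epsilon> by (simp add: s_def)
    then show ?thesis using hd[of z x] z by simp
  qed
  ultimately show ?thesis by (rule that)
qed

text \<open>The Stein equation is solved for a smoothed test function. The smoothing costs
  \<epsilon>/2 under each of the two laws, and \<epsilon> is arbitrary.\<close>

lemma wasserstein_dist_std_normal_le:
  assumes fin: "finite (set_pmf P)"
    and B: "\<And>g g'. stein_class g g' \<Longrightarrow>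
      \<bar>measure_pmf.expectation P (\<lambda>\<omega>. g' (X \<omega>) - X \<omega> * g (X \<omega>))\<bar> \<le> B"
  shows "wasserstein_dist (distr (measure_pmf P) borel X) std_normal_distribution \<le> ereal B"
  unfolding wasserstein_dist_def
proof (rule SUP_least)
  fix h :: "real \<Rightarrow> real" assume "h \<in> {h. 1-lipschitz_on UNIV h}"
  then have lip: "1-lipschitz_on UNIV h" by simp
  have meas: "h \<in> borel_measurable borel" if "1-lipschitz_on UNIV h" for h :: "real \<Rightarrow> real"
    using lipschitz_on_continuous_on[OF that] by (rule borel_measurable_continuous_onI)
  note [simp] = integrable_measure_pmf_finite[OF fin]
  have "\<bar>integral\<^sup>L (distr (measure_pmf P) borel X) h - integral\<^sup>L std_normal_distribution h\<bar> \<le> B + \<epsilon>"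
    if \<epsilon>: "\<epsilon> > 0" for \<epsilon>
  proof -
    from \<epsilon> have \<epsilon>2: "\<epsilon> / 2 > 0" by simp
    obtain s s' where s: "\<And>x. (s has_real_derivative s' x) (at x)" "\<And>x. \<bar>s' x\<bar> \<le> 1"
      and close: "\<And>x. \<bar>s x - h x\<bar> \<le> \<epsilon> / 2"
      using lipschitz_smoothing[OF lip \<epsilon>2] by blast
    have slip: "1-lipschitz_on UNIV s"
      by (rule lipschitz_of_derivative_le_1[OF s])
    obtain g g' where g: "stein_class g g'"
      and eq: "\<And>x. g' x - x * g x = s x - integral\<^sup>L std_normal_distribution s"
      using stein_solution[OF s] by blast
    have "\<bar>measure_pmf.expectation P (\<lambda>\<omega>. s (X \<omega>)) - integral\<^sup>L std_normal_distribution s\<bar> \<le> B"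
      using B[OF g] by (simp add: eq)
    moreover have "\<bar>measure_pmf.expectation P (\<lambda>\<omega>. s (X \<omega>)) - measure_pmf.expectation P (\<lambda>\<omega>. h (X \<omega>))\<bar> \<le> \<epsilon> / 2"
    proof -
      have "\<bar>measure_pmf.expectation P (\<lambda>\<omega>. s (X \<omega>) - h (X \<omega>))\<bar> \<le> measure_pmf.expectation P (\<lambda>\<omega>. \<epsilon> / 2)"
        by (intro order_trans[OF integral_abs_bound] integral_mono) (simp_all add: close del: le_divide_eq_numeral1)
      then show ?thesis by simp
    qed
    moreover have "\<bar>integral\<^sup>L std_normal_distribution s - integral\<^sup>L std_normal_distribution h\<bar> \<le> \<epsilon> / 2"
    proof -
      have "integral\<^sup>L std_normal_distribution s - integral\<^sup>L std_normal_distribution h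
          = (\<integral>x. std_normal_density x * s x - std_normal_density x * h x \<partial>lborel)"
        by (simp add: integral_std_normal_distribution meas lip slip integrable_normal_of_lipschitz)
      also have "\<bar>\<dots>\<bar> \<le> (\<integral>x. \<epsilon> / 2 * std_normal_density x \<partial>lborel)"
      proof (rule integral_abs_bound_integral)
        fix x
        have "std_normal_density x * \<bar>s x - h x\<bar> \<le> std_normal_density x * (\<epsilon> / 2)"
          by (intro mult_left_mono close) auto
        moreover have "std_normal_density x * s x - std_normal_density x * h x = std_normal_density x * (s x - h x)"
          by (simp add: algebra_simps)
        ultimately show "\<bar>std_normal_density x * s x - std_normal_density x * h x\<bar> \<le> \<epsilon> / 2 * std_normal_density x"
          by (simp add: abs_mult mult.commute)
      qed (use integrable_normal_of_lipschitz lip slip in auto)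
      finally show ?thesis by simp
    qed
    moreover have "integral\<^sup>L (distr (measure_pmf P) borel X) h = measure_pmf.expectation P (\<lambda>\<omega>. h (X \<omega>))"
      by (rule integral_distr) (auto intro: meas lip)
    ultimately show ?thesis by linarith
  qed
  then have "\<bar>integral\<^sup>L (distr (measure_pmf P) borel X) h - integral\<^sup>L std_normal_distribution h\<bar> \<le> B"
    by (rule field_le_epsilon)
  then show "ereal \<bar>integral\<^sup>L (distr (measure_pmf P) borel X) h - integral\<^sup>L std_normal_distribution h\<bar> \<le> ereal B"
    by simp
qed

section \<open>Products of finitely supported distributions\<close>

abbreviation expect :: "'a pmf \<Rightarrow> ('a \<Rightarrow> real) \<Rightarrow> real" where
  "expect P \<phi> \<equiv> measure_pmf.expectation P \<phi>"

lemma expect_mono_finite: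
  assumes "finite (set_pmf P)" "\<And>x. x \<in> set_pmf P \<Longrightarrow> \<phi> x \<le> \<psi> x"
  shows "expect P \<phi> \<le> expect P \<psi>"
  by (intro integral_mono_AE integrable_measure_pmf_finite assms AE_pmfI)

lemma expect_cong:
  assumes "\<And>x. x \<in> set_pmf P \<Longrightarrow> \<phi> x = \<psi> x"
  shows "expect P \<phi> = expect P \<psi>"
  by (intro integral_cong_AE AE_pmfI assms) auto

lemma expect_Cauchy_Schwarz:
  assumes fin: "finite (set_pmf P)"
  shows "(expect P (\<lambda>x. \<phi> x * \<psi> x))\<^sup>2 \<le> expect P (\<lambda>x. (\<phi> x)\<^sup>2) * expect P (\<lambda>x. (\<psi> x)\<^sup>2)"
proof -
  have eq: "expect P \<xi> = (\<Sum>x\<in>set_pmf P. \<xi> x * pmf P x)" for \<xi> :: "'a \<Rightarrow> real"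
    by (rule integral_measure_pmf_real[OF fin]) auto
  have "expect P (\<lambda>x. \<phi> x * \<psi> x)
      = (\<Sum>x\<in>set_pmf P. (sqrt (pmf P x) * \<phi> x) * (sqrt (pmf P x) * \<psi> x))"
    unfolding eq by (intro sum.cong refl) (simp add: mult_ac)
  also have "\<dots>\<^sup>2 \<le> (\<Sum>x\<in>set_pmf P. (sqrt (pmf P x) * \<phi> x)\<^sup>2) * (\<Sum>x\<in>set_pmf P. (sqrt (pmf P x) * \<psi> x)\<^sup>2)"
    by (rule Cauchy_Schwarz_ineq_sum)
  also have "\<dots> = expect P (\<lambda>x. (\<phi> x)\<^sup>2) * expect P (\<lambda>x. (\<psi> x)\<^sup>2)"
    unfolding eq by (simp add: power_mult_distrib mult_ac)
  finally show ?thesis .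
qed

lemma expect_square_le:
  assumes "finite (set_pmf P)"
  shows "(expect P \<phi>)\<^sup>2 \<le> expect P (\<lambda>x. (\<phi> x)\<^sup>2)"
  using expect_Cauchy_Schwarz[OF assms, of \<phi> "\<lambda>_. 1"] by simp

lemma expect_abs_le:
  assumes "finite (set_pmf P)"
  shows "expect P (\<lambda>x. \<bar>\<phi> x\<bar>) \<le> sqrt (expect P (\<lambda>x. (\<phi> x)\<^sup>2))"
  using expect_square_le[OF assms, of "\<lambda>x. \<bar>\<phi> x\<bar>"] by (intro real_le_rsqrt) simp

lemma expect_square_deviation:
  assumes fin: "finite (set_pmf P)"
  shows "expect P (\<lambda>x. (\<phi> x - c)\<^sup>2) = expect P (\<lambda>x. (\<phi> x - expect P \<phi>)\<^sup>2) + (expect P \<phi> - c)\<^sup>2"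
proof -
  note [simp] = integrable_measure_pmf_finite[OF fin]
  define m where "m = expect P \<phi>"
  have "expect P (\<lambda>x. (\<phi> x - c)\<^sup>2) = expect P (\<lambda>x. (\<phi> x - m)\<^sup>2 + 2 * (m - c) * (\<phi> x - m) + (m - c)\<^sup>2)"
    by (intro Bochner_Integration.integral_cong refl) (simp add: power2_eq_square algebra_simps)
  also have "\<dots> = expect P (\<lambda>x. (\<phi> x - m)\<^sup>2) + 2 * (m - c) * (expect P \<phi> - m) + (m - c)\<^sup>2"
    by simp
  finally show ?thesis by (simp add: m_def)
qed

lemma expect_swap:
  assumes "finite (set_pmf P)" "finite (set_pmf Q)"
  shows "expect P (\<lambda>x. expect Q (\<lambda>y. \<phi> x y)) = expect Q (\<lambda>y. expect P (\<lambda>x. \<phi> x y))"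
proof -
  have eq: "expect P \<xi> = (\<Sum>x\<in>set_pmf P. \<xi> x * pmf P x)" for \<xi> :: "'a \<Rightarrow> real"
    by (rule integral_measure_pmf_real[OF assms(1)]) auto
  have eq': "expect Q \<xi> = (\<Sum>x\<in>set_pmf Q. \<xi> x * pmf Q x)" for \<xi> :: "'b \<Rightarrow> real"
    by (rule integral_measure_pmf_real[OF assms(2)]) auto
  show ?thesis
    unfolding eq eq' sum_distrib_right by (subst sum.swap) (simp add: mult_ac)
qed

lemma expect_pair_pmf:
  assumes "finite (set_pmf P)" "finite (set_pmf Q)"
  shows "expect (pair_pmf P Q) \<phi> = expect P (\<lambda>x. expect Q (\<lambda>y. \<phi> (x, y)))"
proof -
  have eq: "pair_pmf P Q = bind_pmf P (\<lambda>x. map_pmf (Pair x) Q)"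
    by (simp add: pair_pmf_def map_pmf_def)
  have "expect (pair_pmf P Q) \<phi> = (\<Sum>x\<in>set_pmf P. pmf P x *\<^sub>R expect (map_pmf (Pair x) Q) \<phi>)"
    unfolding eq by (rule pmf_expectation_bind) (use assms in auto)
  also have "\<dots> = expect P (\<lambda>x. expect Q (\<lambda>y. \<phi> (x, y)))"
    by (subst integral_measure_pmf[OF assms(1)]) auto
  finally show ?thesis .
qed

lemma finite_set_Pi_pmf:
  assumes "finite I" "\<And>i. i \<in> I \<Longrightarrow> finite (set_pmf (p i))"
  shows "finite (set_pmf (Pi_pmf I d p))"
  using assms by (auto simp: set_Pi_pmf)

lemma expect_Pi_pmf_insert:
  assumes "finite I" "i \<notin> I" "\<And>j. j \<in> insert i I \<Longrightarrow> finite (set_pmf (p j))"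
  shows "expect (Pi_pmf (insert i I) d p) \<phi>
    = expect (Pi_pmf I d p) (\<lambda>Y. expect (p i) (\<lambda>y. \<phi> (Y(i := y))))"
proof -
  have fin: "finite (set_pmf (Pi_pmf I d p))" "finite (set_pmf (p i))"
    using assms by (auto intro: finite_set_Pi_pmf)
  have "expect (Pi_pmf (insert i I) d p) \<phi>
      = expect (pair_pmf (p i) (Pi_pmf I d p)) (\<lambda>z. \<phi> ((snd z)(i := fst z)))"
    using assms by (simp add: Pi_pmf_insert case_prod_beta)
  also have "\<dots> = expect (p i) (\<lambda>y. expect (Pi_pmf I d p) (\<lambda>Y. \<phi> (Y(i := y))))"
    using fin by (simp add: expect_pair_pmf)
  also have "\<dots> = expect (Pi_pmf I d p) (\<lambda>Y. expect (p i) (\<lambda>y. \<phi> (Y(i := y))))"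
    using fin by (intro expect_swap)
  finally show ?thesis .
qed

text \<open>Plays the role of conditioning on all coordinates except \<open>i\<close>: the inner
  expectation averages over coordinate \<open>i\<close> only.\<close>

lemma expect_resample:
  assumes "finite I" "i \<in> I" "\<And>j. j \<in> I \<Longrightarrow> finite (set_pmf (p j))"
  shows "expect (Pi_pmf I d p) \<phi> = expect (Pi_pmf I d p) (\<lambda>Y. expect (p i) (\<lambda>y. \<phi> (Y(i := y))))"
proof -
  have eq: "insert i (I - {i}) = I" using assms by auto
  have ins: "expect (Pi_pmf I d p) \<xi>
      = expect (Pi_pmf (I - {i}) d p) (\<lambda>Y. expect (p i) (\<lambda>y. \<xi> (Y(i := y))))" for \<xi>
    using expect_Pi_pmf_insert[of "I - {i}" i p d \<xi>] assms unfolding eq by auto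
  show ?thesis
    unfolding ins by simp
qed

text \<open>
  The reference value \<open>a i\<close> can be a fixed one instead of an independent copy, because a variance
  is at most the second moment about any point.
\<close>

lemma efron_stein:
  assumes "finite I" "\<And>i. i \<in> I \<Longrightarrow> finite (set_pmf (p i))"
  shows "expect (Pi_pmf I d p) (\<lambda>Y. (\<phi> Y - expect (Pi_pmf I d p) \<phi>)\<^sup>2)
    \<le> (\<Sum>i\<in>I. expect (Pi_pmf I d p) (\<lambda>Y. (\<phi> Y - \<phi> (Y(i := a i)))\<^sup>2))"
  using assms
proof (induction I arbitrary: \<phi> rule: finite_induct)
  case empty
  then show ?case by simp
next
  case (insert i I)
  define P where "P = Pi_pmf I d p"
  define Q where "Q = Pi_pmf (insert i I) d p"
  have fini: "finite (set_pmf (p i))" using insert.prems by auto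
  have finP: "finite (set_pmf P)"
    unfolding P_def using insert by (intro finite_set_Pi_pmf) auto
  note [simp] = integrable_measure_pmf_finite[OF fini] integrable_measure_pmf_finite[OF finP]
  have Q: "expect Q \<xi> = expect P (\<lambda>Y. expect (p i) (\<lambda>y. \<xi> (Y(i := y))))" for \<xi>
    unfolding Q_def P_def using insert by (intro expect_Pi_pmf_insert) auto
  define \<psi> where "\<psi> = (\<lambda>Y. expect (p i) (\<lambda>y. \<phi> (Y(i := y))))"
  have m: "expect Q \<phi> = expect P \<psi>" by (simp add: Q \<psi>_def)
  \<comment> \<open>Law of total variance: the mean conditional variance in coordinate
    \<open>i\<close>, plus the variance of the conditional mean \<open>\<psi>\<close>, which is left
    to the induction hypothesis.\<close>
  have decomp: "expect Q (\<lambda>Y. (\<phi> Y - expect Q \<phi>)\<^sup>2)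
      = expect P (\<lambda>Y. expect (p i) (\<lambda>y. (\<phi> (Y(i := y)) - \<psi> Y)\<^sup>2)) + expect P (\<lambda>Y. (\<psi> Y - expect P \<psi>)\<^sup>2)"
    unfolding Q m \<psi>_def by (subst expect_square_deviation[OF fini]) simp
  have IH: "expect P (\<lambda>Y. (\<psi> Y - expect P \<psi>)\<^sup>2) \<le> (\<Sum>j\<in>I. expect P (\<lambda>Y. (\<psi> Y - \<psi> (Y(j := a j)))\<^sup>2))"
    unfolding P_def by (rule insert.IH) (use insert.prems in auto)
  have inner: "expect P (\<lambda>Y. expect (p i) (\<lambda>y. (\<phi> (Y(i := y)) - \<psi> Y)\<^sup>2))
      \<le> expect P (\<lambda>Y. expect (p i) (\<lambda>y. (\<phi> (Y(i := y)) - \<phi> (Y(i := a i)))\<^sup>2))"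
  proof -
    have "expect (p i) (\<lambda>y. (\<phi> (Y(i := y)) - \<psi> Y)\<^sup>2)
        \<le> expect (p i) (\<lambda>y. (\<phi> (Y(i := y)) - \<phi> (Y(i := a i)))\<^sup>2)" for Y
      unfolding \<psi>_def using expect_square_deviation[OF fini, of "\<lambda>y. \<phi> (Y(i := y))" "\<phi> (Y(i := a i))"]
      by simp
    then show ?thesis
      by (rule integral_mono[rotated 2]) auto
  qed
  have jensen: "(\<Sum>j\<in>I. expect P (\<lambda>Y. (\<psi> Y - \<psi> (Y(j := a j)))\<^sup>2))
      \<le> (\<Sum>j\<in>I. expect P (\<lambda>Y. expect (p i) (\<lambda>y. (\<phi> (Y(i := y)) - \<phi> ((Y(i := y))(j := a j)))\<^sup>2)))"
  proof (intro sum_mono integral_mono)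
    fix j Y assume "j \<in> I"
    with insert have "j \<noteq> i" by auto
    then have "\<psi> Y - \<psi> (Y(j := a j)) = expect (p i) (\<lambda>y. \<phi> (Y(i := y)) - \<phi> ((Y(i := y))(j := a j)))"
      by (simp add: \<psi>_def fun_upd_twist)
    then show "(\<psi> Y - \<psi> (Y(j := a j)))\<^sup>2
        \<le> expect (p i) (\<lambda>y. (\<phi> (Y(i := y)) - \<phi> ((Y(i := y))(j := a j)))\<^sup>2)"
      by (simp only: expect_square_le[OF fini])
  qed auto
  have "expect Q (\<lambda>Y. (\<phi> Y - expect Q \<phi>)\<^sup>2)
      \<le> expect P (\<lambda>Y. expect (p i) (\<lambda>y. (\<phi> (Y(i := y)) - \<phi> (Y(i := a i)))\<^sup>2))
        + (\<Sum>j\<in>I. expect P (\<lambda>Y. expect (p i) (\<lambda>y. (\<phi> (Y(i := y)) - \<phi> ((Y(i := y))(j := a j)))\<^sup>2)))"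
    using decomp inner IH jensen by linarith
  also have "\<dots> = (\<Sum>j\<in>insert i I. expect Q (\<lambda>Y. (\<phi> Y - \<phi> (Y(j := a j)))\<^sup>2))"
    using insert.hyps by (simp add: Q)
  finally show ?case unfolding Q_def .
qed

section \<open>Points not covered by independent random sets\<close>

text \<open>The factors are exchanged one at a time in the order of the indices. With indicators for
  \<open>x\<close> and their means for \<open>y\<close> this is the Doob decomposition of a product
  of independent indicators.\<close>

lemma prod_diff_telescope:
  fixes x y :: "'i::linorder \<Rightarrow> 'a::comm_ring_1"
  assumes "finite I"
  shows "(\<Prod>i\<in>I. x i) - (\<Prod>i\<in>I. y i)
    = (\<Sum>j\<in>I. (\<Prod>i\<in>{i\<in>I. i < j}. x i) * (x j - y j) * (\<Prod>i\<in>{i\<in>I. j < i}. y i))"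
  using assms
proof (induction I rule: finite_linorder_max_induct)
  case empty
  then show ?case by simp
next
  case (insert b A)
  then have b: "b \<notin> A" by auto
  have lower: "{i \<in> insert b A. i < b} = A" "{i \<in> insert b A. b < i} = {}"
    using insert by auto
  have "(\<Prod>i\<in>{i \<in> insert b A. i < j}. x i) * (x j - y j) * (\<Prod>i\<in>{i \<in> insert b A. j < i}. y i)
      = y b * ((\<Prod>i\<in>{i\<in>A. i < j}. x i) * (x j - y j) * (\<Prod>i\<in>{i\<in>A. j < i}. y i))" if "j \<in> A" for j
  proof -
    have "{i \<in> insert b A. i < j} = {i\<in>A. i < j}" "{i \<in> insert b A. j < i} = insert b {i\<in>A. j < i}"
      using insert that by auto
    then show ?thesis using insert b by (simp add: mult_ac)
  qed
  then have "(\<Sum>j\<in>A. (\<Prod>i\<in>{i \<in> insert b A. i < j}. x i) * (x j - y j) * (\<Prod>i\<in>{i \<in> insert b A. j < i}. y i))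
      = y b * ((\<Prod>i\<in>A. x i) - (\<Prod>i\<in>A. y i))"
    unfolding insert.IH sum_distrib_left by (intro sum.cong) auto
  then show ?case
    using insert.hyps(1) b insert.IH
    unfolding sum.insert[OF insert.hyps(1) b] lower prod.insert[OF insert.hyps(1) b]
    by (simp add: algebra_simps)
qed

locale random_cover =
  fixes I :: "nat set" and K :: "'k set" and p :: "nat \<Rightarrow> 'k set pmf"
  assumes fin_I: "finite I" and fin_K: "finite K"
    and supp: "\<And>i. i \<in> I \<Longrightarrow> set_pmf (p i) \<subseteq> Pow K"
begin

definition P :: "(nat \<Rightarrow> 'k set) pmf" where
  "P = Pi_pmf I {} p"

definition q :: "'k \<Rightarrow> nat \<Rightarrow> real" where
  "q k i = expect (p i) (\<lambda>y. of_bool (k \<in> y))"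

definition uncovered :: "(nat \<Rightarrow> 'k set) \<Rightarrow> real" where
  "uncovered Y = (\<Sum>k\<in>K. \<Prod>i\<in>I. of_bool (k \<notin> Y i))"

definition mean_uncovered :: real where
  "mean_uncovered = (\<Sum>k\<in>K. \<Prod>i\<in>I. (1 - q k i))"

text \<open>
  \<open>M j Y\<close> is \<open>E[uncovered | Y i, i \<le> j] - E[uncovered | Y i, i < j]\<close>.
\<close>

definition M :: "nat \<Rightarrow> (nat \<Rightarrow> 'k set) \<Rightarrow> real" where
  "M j Y = (\<Sum>k\<in>K. (\<Prod>i\<in>{i\<in>I. i < j}. of_bool (k \<notin> Y i)) * (of_bool (k \<notin> Y j) - (1 - q k j))
      * (\<Prod>i\<in>{i\<in>I. j < i}. (1 - q k i)))"

definition \<delta> :: "nat \<Rightarrow> (nat \<Rightarrow> 'k set) \<Rightarrow> real" where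
  "\<delta> j Y = uncovered Y - uncovered (Y(j := {}))"

definition T :: "(nat \<Rightarrow> 'k set) \<Rightarrow> real" where
  "T Y = (\<Sum>j\<in>I. M j Y * \<delta> j Y)"

text \<open>Dominates at the point \<open>k\<close> both the centred indicator in \<open>M\<close>
  and the indicator in \<open>\<delta>\<close>. Its sum \<open>V\<close> over all points is the size
  of the set plus its expected size.\<close>

definition a :: "'k \<Rightarrow> nat \<Rightarrow> 'k set \<Rightarrow> real" where
  "a k i y = of_bool (k \<in> y) + q k i"

definition V :: "nat \<Rightarrow> 'k set \<Rightarrow> real" where
  "V i y = (\<Sum>k\<in>K. a k i y)"

lemma finite_supp: "i \<in> I \<Longrightarrow> finite (set_pmf (p i))"
  using supp fin_K by (meson finite_Pow_iff finite_subset)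

lemma finite_P: "finite (set_pmf P)"
  unfolding P_def by (intro finite_set_Pi_pmf fin_I finite_supp)

lemma integrable_P [simp]: "integrable (measure_pmf P) (\<phi> :: _ \<Rightarrow> real)"
  by (rule integrable_measure_pmf_finite[OF finite_P])

lemma integrable_p: "i \<in> I \<Longrightarrow> integrable (measure_pmf (p i)) (\<phi> :: _ \<Rightarrow> real)"
  by (rule integrable_measure_pmf_finite[OF finite_supp])

lemma resample: "i \<in> I \<Longrightarrow> expect P \<phi> = expect P (\<lambda>Y. expect (p i) (\<lambda>y. \<phi> (Y(i := y))))"
  unfolding P_def by (intro expect_resample fin_I finite_supp)

text \<open>Independence of \<open>R\<close> from coordinate \<open>i\<close> is expressed as
  invariance of \<open>R\<close> under updates at \<open>i\<close>, which turns it into a rewriting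
  condition.\<close>

lemma expect_P_independent:
  assumes i: "i \<in> I" and R: "\<And>Y y. R (Y(i := y)) = R Y"
  shows "expect P (\<lambda>Y. \<alpha> (Y i) * R Y) = expect (p i) \<alpha> * expect P R"
  by (subst resample[OF i]) (simp add: R)

lemma expect_P_component: "i \<in> I \<Longrightarrow> expect P (\<lambda>Y. \<alpha> (Y i)) = expect (p i) \<alpha>"
  using expect_P_independent[of i "\<lambda>_. 1" \<alpha>] by simp

lemma q_nonneg: "0 \<le> q k i"
  unfolding q_def by (intro Bochner_Integration.integral_nonneg) simp

lemma q_le_1:
  assumes "i \<in> I"
  shows "q k i \<le> 1"
proof -
  have "q k i \<le> expect (p i) (\<lambda>_. 1)"
    unfolding q_def by (intro integral_mono integrable_p assms) auto
  then show ?thesis by simp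
qed

lemma expect_not_in: "i \<in> I \<Longrightarrow> expect (p i) (\<lambda>y. of_bool (k \<notin> y)) = 1 - q k i"
  unfolding q_def of_bool_not_iff by (simp add: integrable_p)

lemma a_nonneg: "0 \<le> a k i y"
  by (simp add: a_def q_nonneg)

lemma V_nonneg: "0 \<le> V i y"
  unfolding V_def by (intro sum_nonneg a_nonneg)

lemma sum_M: "(\<Sum>j\<in>I. M j Y) = uncovered Y - mean_uncovered"
  unfolding M_def uncovered_def mean_uncovered_def
  by (subst sum.swap) (simp add: prod_diff_telescope[OF fin_I] flip: sum_subtractf)

lemma expect_M:
  assumes j: "j \<in> I"
  shows "expect (p j) (\<lambda>y. M j (Y(j := y))) = 0"
proof -
  have "expect (p j) (\<lambda>y. M j (Y(j := y)))
      = expect (p j) (\<lambda>y. \<Sum>k\<in>K. (\<Prod>i\<in>{i\<in>I. i < j}. of_bool (k \<notin> Y i)) * (of_bool (k \<notin> y) - (1 - q k j))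
          * (\<Prod>i\<in>{i\<in>I. j < i}. (1 - q k i)))"
    unfolding M_def
    by (intro Bochner_Integration.integral_cong refl sum.cong arg_cong2[of _ _ _ _ "(*)"] prod.cong) auto
  also have "\<dots> = 0"
    using j by (simp add: integrable_p expect_not_in)
  finally show ?thesis .
qed

text \<open>Redrawing coordinate \<open>j\<close> does not touch the second factor, and
  \<open>M j\<close> averages to zero over that coordinate by \<open>expect_M\<close>.\<close>

lemma expect_M_mult:
  assumes j: "j \<in> I"
  shows "expect P (\<lambda>Y. M j Y * G (Y(j := {}))) = 0"
  by (subst resample[OF j]) (simp add: expect_M[OF j])

text \<open>Integration by parts for the uncovered count. It is applied with G = 1 for the mean,
  with G the centred count for the variance, and with G a Stein solution.\<close>

lemma expect_centered_mult:
  "expect P (\<lambda>Y. (uncovered Y - mean_uncovered) * G Y)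
    = (\<Sum>j\<in>I. expect P (\<lambda>Y. M j Y * (G Y - G (Y(j := {})))))"
proof -
  have "expect P (\<lambda>Y. (uncovered Y - mean_uncovered) * G Y) = (\<Sum>j\<in>I. expect P (\<lambda>Y. M j Y * G Y))"
    unfolding sum_M[symmetric] sum_distrib_right by simp
  also have "\<dots> = (\<Sum>j\<in>I. expect P (\<lambda>Y. M j Y * (G Y - G (Y(j := {})))))"
    by (intro sum.cong refl) (simp add: right_diff_distrib expect_M_mult)
  finally show ?thesis .
qed

lemma expect_uncovered: "expect P uncovered = mean_uncovered"
  using expect_centered_mult[of "\<lambda>_. 1"] by simp

lemma expect_T: "expect P T = expect P (\<lambda>Y. (uncovered Y - mean_uncovered)\<^sup>2)"
proof -
  have "expect P (\<lambda>Y. (uncovered Y - mean_uncovered) * (uncovered Y - mean_uncovered))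
      = (\<Sum>j\<in>I. expect P (\<lambda>Y. M j Y * \<delta> j Y))"
    unfolding expect_centered_mult by (simp add: \<delta>_def)
  also have "\<dots> = expect P T" unfolding T_def by simp
  finally show ?thesis by (simp add: power2_eq_square)
qed

text \<open>Emptying \<open>Y j\<close> uncovers exactly those of its points that lie in no other
  set, so \<open>- \<delta> j Y\<close> counts the points covered by \<open>Y j\<close>
  alone.\<close>

lemma \<delta>_eq:
  assumes j: "j \<in> I"
  shows "\<delta> j Y = - (\<Sum>k\<in>K. of_bool (k \<in> Y j) * (\<Prod>i\<in>I - {j}. of_bool (k \<notin> Y i)))"
proof -
  have rem: "(\<Prod>i\<in>I. of_bool (k \<notin> Y i)) = of_bool (k \<notin> Y j) * (\<Prod>i\<in>I - {j}. (of_bool (k \<notin> Y i) :: real))" for k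
    by (rule prod.remove[OF fin_I j])
  have rem': "(\<Prod>i\<in>I. of_bool (k \<notin> (Y(j := {})) i)) = (\<Prod>i\<in>I - {j}. (of_bool (k \<notin> Y i) :: real))" for k
    by (subst prod.remove[OF fin_I j]) (auto intro!: prod.cong)
  have "\<delta> j Y = (\<Sum>k\<in>K. of_bool (k \<notin> Y j) * (\<Prod>i\<in>I - {j}. of_bool (k \<notin> Y i))
      - (\<Prod>i\<in>I - {j}. of_bool (k \<notin> Y i)))"
    unfolding \<delta>_def uncovered_def sum_subtractf[symmetric] rem rem' by (rule refl)
  also have "\<dots> = (\<Sum>k\<in>K. - (of_bool (k \<in> Y j) * (\<Prod>i\<in>I - {j}. of_bool (k \<notin> Y i))))"
    by (intro sum.cong refl) auto
  finally show ?thesis by (simp add: sum_negf)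
qed

lemma prod_of_bool_bounds: "0 \<le> (\<Prod>i\<in>J. of_bool (\<theta> i) :: real)" "(\<Prod>i\<in>J. of_bool (\<theta> i) :: real) \<le> 1"
  by (auto intro!: prod_nonneg prod_le_1)

lemma prod_q_bounds:
  assumes "J \<subseteq> I"
  shows "0 \<le> (\<Prod>i\<in>J. 1 - q k i)" "(\<Prod>i\<in>J. 1 - q k i) \<le> 1"
  using assms q_nonneg q_le_1 by (auto intro!: prod_nonneg prod_le_1)

lemma prod_of_bool_diff:
  "\<bar>(\<Prod>l\<in>J. of_bool (k \<notin> Y l) :: real) - (\<Prod>l\<in>J. of_bool (k \<notin> (Y(i := {})) l))\<bar> \<le> of_bool (k \<in> Y i)"
proof (cases "k \<in> Y i")
  case True
  then show ?thesis
    using prod_of_bool_bounds[where J = J and \<theta> = "\<lambda>l. k \<notin> Y l"]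
      prod_of_bool_bounds[where J = J and \<theta> = "\<lambda>l. k \<notin> (Y(i := {})) l"] by simp
next
  case False
  then have "(k \<notin> Y l) = (k \<notin> (Y(i := {})) l)" for l by auto
  then show ?thesis by simp
qed

lemma abs_M_le:
  assumes j: "j \<in> I"
  shows "\<bar>M j Y\<bar> \<le> V j (Y j)"
  unfolding M_def V_def
proof (intro order_trans[OF sum_abs] sum_mono)
  fix k
  have "\<bar>of_bool (k \<notin> Y j) - (1 - q k j)\<bar> \<le> a k j (Y j)"
    using q_nonneg[of k j] q_le_1[OF j, of k] by (auto simp: a_def)
  moreover have "{i\<in>I. j < i} \<subseteq> I" by auto
  note prod_q_bounds[OF this, of k] prod_of_bool_bounds[where J = "{i\<in>I. i < j}" and \<theta> = "\<lambda>i. k \<notin> Y i"]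
  ultimately have "(\<Prod>i\<in>{i\<in>I. i < j}. of_bool (k \<notin> Y i)) * \<bar>of_bool (k \<notin> Y j) - (1 - q k j)\<bar>
      * (\<Prod>i\<in>{i\<in>I. j < i}. (1 - q k i)) \<le> 1 * a k j (Y j) * 1"
    by (intro mult_mono mult_nonneg_nonneg a_nonneg) auto
  then show "\<bar>(\<Prod>i\<in>{i\<in>I. i < j}. of_bool (k \<notin> Y i)) * (of_bool (k \<notin> Y j) - (1 - q k j))
      * (\<Prod>i\<in>{i\<in>I. j < i}. (1 - q k i))\<bar> \<le> a k j (Y j)"
    using prod_q_bounds[OF \<open>{i\<in>I. j < i} \<subseteq> I\<close>, of k]
      prod_of_bool_bounds[where J = "{i\<in>I. i < j}" and \<theta> = "\<lambda>i. k \<notin> Y i"]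
    by (simp add: abs_mult)
qed

lemma abs_\<delta>_le_sum:
  assumes j: "j \<in> I"
  shows "\<bar>\<delta> j Y\<bar> \<le> (\<Sum>k\<in>K. of_bool (k \<in> Y j))"
  unfolding \<delta>_eq[OF j] abs_minus_cancel
proof (intro order_trans[OF sum_abs] sum_mono)
  fix k
  show "\<bar>of_bool (k \<in> Y j) * (\<Prod>i\<in>I - {j}. of_bool (k \<notin> Y i))\<bar> \<le> (of_bool (k \<in> Y j) :: real)"
    using prod_of_bool_bounds[where J = "I - {j}" and \<theta> = "\<lambda>i. k \<notin> Y i"]
    by (auto simp: abs_mult)
qed

lemma abs_\<delta>_le:
  assumes j: "j \<in> I"
  shows "\<bar>\<delta> j Y\<bar> \<le> V j (Y j)"
  using abs_\<delta>_le_sum[OF j, of Y] unfolding V_def a_def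
  by (rule order_trans) (auto intro!: sum_mono q_nonneg)

text \<open>Only the summands of points in \<open>Y i\<close> can change, and each changes through
  the first product alone, which stays in [0, 1].\<close>

lemma M_diff_le:
  assumes j: "j \<in> I" and ij: "i \<noteq> j"
  shows "\<bar>M j Y - M j (Y(i := {}))\<bar> \<le> (\<Sum>k\<in>K. of_bool (k \<in> Y i) * a k j (Y j))"
  unfolding M_def sum_subtractf[symmetric]
proof (intro order_trans[OF sum_abs] sum_mono)
  fix k
  let ?x = "\<Prod>l\<in>{l\<in>I. l < j}. of_bool (k \<notin> Y l) :: real"
  let ?x' = "\<Prod>l\<in>{l\<in>I. l < j}. of_bool (k \<notin> (Y(i := {})) l) :: real"
  let ?z = "\<Prod>l\<in>{l\<in>I. j < l}. 1 - q k l"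
  have z: "0 \<le> ?z" "?z \<le> 1" by (auto intro!: prod_q_bounds)
  have "\<bar>of_bool (k \<notin> Y j) - (1 - q k j)\<bar> \<le> a k j (Y j)"
    using q_nonneg[of k j] q_le_1[OF j, of k] by (auto simp: a_def)
  then have "\<bar>?x - ?x'\<bar> * \<bar>of_bool (k \<notin> Y j) - (1 - q k j)\<bar> * ?z \<le> of_bool (k \<in> Y i) * a k j (Y j) * 1"
    using z by (intro mult_mono mult_nonneg_nonneg a_nonneg prod_of_bool_diff) auto
  moreover have "?x * (of_bool (k \<notin> Y j) - (1 - q k j)) * ?z
      - ?x' * (of_bool (k \<notin> (Y(i := {})) j) - (1 - q k j)) * ?z
      = (?x - ?x') * (of_bool (k \<notin> Y j) - (1 - q k j)) * ?z"
    using ij by (simp add: algebra_simps)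
  ultimately show "\<bar>?x * (of_bool (k \<notin> Y j) - (1 - q k j)) * ?z
      - ?x' * (of_bool (k \<notin> (Y(i := {})) j) - (1 - q k j)) * ?z\<bar> \<le> of_bool (k \<in> Y i) * a k j (Y j)"
    using z by (simp only: abs_mult abs_of_nonneg mult_1_right)
qed

lemma \<delta>_diff_le:
  assumes j: "j \<in> I" and ij: "i \<noteq> j"
  shows "\<bar>\<delta> j Y - \<delta> j (Y(i := {}))\<bar> \<le> (\<Sum>k\<in>K. of_bool (k \<in> Y i) * a k j (Y j))"
proof -
  let ?x = "\<lambda>k. \<Prod>l\<in>I - {j}. of_bool (k \<notin> Y l) :: real"
  let ?x' = "\<lambda>k. \<Prod>l\<in>I - {j}. of_bool (k \<notin> (Y(i := {})) l) :: real"
  have eq: "\<delta> j Y - \<delta> j (Y(i := {})) = (\<Sum>k\<in>K. - (of_bool (k \<in> Y j) * (?x k - ?x' k)))"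
    using ij unfolding \<delta>_eq[OF j] by (simp add: right_diff_distrib sum_subtractf)
  show ?thesis
    unfolding eq
  proof (intro order_trans[OF sum_abs] sum_mono)
    fix k
    have "of_bool (k \<in> Y j) * \<bar>?x k - ?x' k\<bar> \<le> a k j (Y j) * of_bool (k \<in> Y i)"
      by (intro mult_mono prod_of_bool_diff a_nonneg) (auto simp: a_def q_nonneg)
    then show "\<bar>- (of_bool (k \<in> Y j) * (?x k - ?x' k))\<bar> \<le> of_bool (k \<in> Y i) * a k j (Y j)"
      by (simp add: abs_mult mult.commute)
  qed
qed

text \<open>The weight that all other sets put on the point \<open>k\<close>. Leaving out
  \<open>i\<close> makes it independent of \<open>Y i\<close>, so that expectations factorize in
  \<open>variance_T_le\<close>.\<close>

definition R :: "nat \<Rightarrow> 'k \<Rightarrow> (nat \<Rightarrow> 'k set) \<Rightarrow> real" where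
  "R i k Y = (\<Sum>j\<in>I - {i}. V j (Y j) * a k j (Y j))"

text \<open>The product rule for M j * \<delta> j, with the differences then regrouped by the points
  of \<open>Y i\<close> through which they arise.\<close>

lemma T_diff_le:
  assumes i: "i \<in> I"
  shows "\<bar>T Y - T (Y(i := {}))\<bar> \<le> (V i (Y i))\<^sup>2 + 2 * (\<Sum>k\<in>K. of_bool (k \<in> Y i) * R i k Y)"
proof -
  let ?Z = "Y(i := {})"
  let ?s = "\<lambda>j. \<Sum>k\<in>K. of_bool (k \<in> Y i) * a k j (Y j)"
  have split: "T Y - T ?Z = M i Y * \<delta> i Y + (\<Sum>j\<in>I - {i}. M j Y * \<delta> j Y - M j ?Z * \<delta> j ?Z)"
  proof -
    \<comment> \<open>Emptying \<open>Y i\<close> a second time has no effect, so the summand of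
      index \<open>i\<close> disappears from \<open>T ?Z\<close>.\<close>
    have "\<delta> i ?Z = 0" by (simp add: \<delta>_def)
    then show ?thesis
      unfolding T_def sum.remove[OF fin_I i] by (simp add: sum_subtractf)
  qed
  have 1: "\<bar>M i Y * \<delta> i Y\<bar> \<le> (V i (Y i))\<^sup>2"
    unfolding abs_mult power2_eq_square by (intro mult_mono abs_M_le abs_\<delta>_le i V_nonneg) auto
  have 2: "\<bar>\<Sum>j\<in>I - {i}. M j Y * \<delta> j Y - M j ?Z * \<delta> j ?Z\<bar> \<le> (\<Sum>j\<in>I - {i}. 2 * (V j (Y j) * ?s j))"
  proof (intro order_trans[OF sum_abs] sum_mono)
    fix j assume "j \<in> I - {i}"
    then have j: "j \<in> I" and ij: "i \<noteq> j" by auto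
    have s: "0 \<le> ?s j" by (intro sum_nonneg mult_nonneg_nonneg a_nonneg) auto
    have eq: "M j Y * \<delta> j Y - M j ?Z * \<delta> j ?Z = M j Y * (\<delta> j Y - \<delta> j ?Z) + (M j Y - M j ?Z) * \<delta> j ?Z"
      by (simp add: algebra_simps)
    have "\<bar>M j Y * \<delta> j Y - M j ?Z * \<delta> j ?Z\<bar> \<le> \<bar>M j Y\<bar> * \<bar>\<delta> j Y - \<delta> j ?Z\<bar> + \<bar>M j Y - M j ?Z\<bar> * \<bar>\<delta> j ?Z\<bar>"
      unfolding eq by (rule order_trans[OF abs_triangle_ineq]) (simp add: abs_mult)
    also have "\<dots> \<le> V j (Y j) * ?s j + ?s j * V j (?Z j)"
      by (intro add_mono mult_mono abs_M_le abs_\<delta>_le M_diff_le \<delta>_diff_le j ij V_nonneg s) auto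
    finally show "\<bar>M j Y * \<delta> j Y - M j ?Z * \<delta> j ?Z\<bar> \<le> 2 * (V j (Y j) * ?s j)"
      using ij by simp
  qed
  have 3: "(\<Sum>j\<in>I - {i}. 2 * (V j (Y j) * ?s j)) = 2 * (\<Sum>k\<in>K. of_bool (k \<in> Y i) * R i k Y)"
    unfolding R_def sum_distrib_left by (subst sum.swap) (simp add: mult_ac)
  show ?thesis
    unfolding split using 1 2 unfolding 3 by linarith
qed

text \<open>Off-diagonal products factorize. Adding the nonnegative products of means on the
  diagonal completes the square of the sum of means.\<close>

lemma expect_sum_independent_square:
  assumes J: "J \<subseteq> I" and \<alpha>: "\<And>j y. j \<in> J \<Longrightarrow> 0 \<le> \<alpha> j y"
  shows "expect P (\<lambda>Y. (\<Sum>j\<in>J. \<alpha> j (Y j))\<^sup>2)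
    \<le> (\<Sum>j\<in>J. expect (p j) (\<alpha> j))\<^sup>2 + (\<Sum>j\<in>J. expect (p j) (\<lambda>y. (\<alpha> j y)\<^sup>2))"
proof -
  have finJ: "finite J" using J fin_I finite_subset by blast
  have "expect P (\<lambda>Y. (\<Sum>j\<in>J. \<alpha> j (Y j))\<^sup>2)
      = (\<Sum>i\<in>J. \<Sum>j\<in>J. expect P (\<lambda>Y. \<alpha> i (Y i) * \<alpha> j (Y j)))"
    by (simp add: power2_eq_square sum_product)
  also have "\<dots> \<le> (\<Sum>i\<in>J. \<Sum>j\<in>J. expect (p i) (\<alpha> i) * expect (p j) (\<alpha> j)
      + (if i = j then expect (p i) (\<lambda>y. (\<alpha> i y)\<^sup>2) else 0))"
  proof (intro sum_mono)
    fix i j assume ij: "i \<in> J" "j \<in> J"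
    then have iI: "i \<in> I" "j \<in> I" using J by auto
    have nn: "0 \<le> expect (p i) (\<alpha> i)" if "i \<in> J" for i
      using \<alpha> that by (intro Bochner_Integration.integral_nonneg) auto
    show "expect P (\<lambda>Y. \<alpha> i (Y i) * \<alpha> j (Y j)) \<le> expect (p i) (\<alpha> i) * expect (p j) (\<alpha> j)
        + (if i = j then expect (p i) (\<lambda>y. (\<alpha> i y)\<^sup>2) else 0)"
    proof (cases "i = j")
      case True
      then have "expect P (\<lambda>Y. \<alpha> i (Y i) * \<alpha> j (Y j)) = expect (p i) (\<lambda>y. (\<alpha> i y)\<^sup>2)"
        using expect_P_component[OF iI(1), of "\<lambda>y. (\<alpha> i y)\<^sup>2"] by (simp add: power2_eq_square)
      then show ?thesis using True nn[OF ij(1)] by simp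
    next
      case False
      then show ?thesis
        using expect_P_independent[OF iI(1), of "\<lambda>Y. \<alpha> j (Y j)" "\<alpha> i"]
          expect_P_component[OF iI(2), of "\<alpha> j"] by simp
    qed
  qed
  also have "\<dots> = (\<Sum>j\<in>J. expect (p j) (\<alpha> j))\<^sup>2 + (\<Sum>j\<in>J. expect (p j) (\<lambda>y. (\<alpha> j y)\<^sup>2))"
    using finJ by (simp add: sum.distrib power2_eq_square sum_product)
  finally show ?thesis .
qed

text \<open>The bound of \<open>expect_sum_independent_square\<close> for the second moment of
  \<open>R i k\<close>, taken over all of \<open>I\<close> so as not to depend on
  \<open>i\<close>.\<close>

definition \<rho> :: "'k \<Rightarrow> real" where
  "\<rho> k = (\<Sum>j\<in>I. expect (p j) (\<lambda>y. V j y * a k j y))\<^sup>2 + (\<Sum>j\<in>I. expect (p j) (\<lambda>y. (V j y * a k j y)\<^sup>2))"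

lemma expect_R_square: "expect P (\<lambda>Y. (R i k Y)\<^sup>2) \<le> \<rho> k"
proof -
  have nn: "0 \<le> V j y * a k j y" for j y by (intro mult_nonneg_nonneg V_nonneg a_nonneg)
  have "expect P (\<lambda>Y. (R i k Y)\<^sup>2)
      \<le> (\<Sum>j\<in>I - {i}. expect (p j) (\<lambda>y. V j y * a k j y))\<^sup>2
        + (\<Sum>j\<in>I - {i}. expect (p j) (\<lambda>y. (V j y * a k j y)\<^sup>2))"
    unfolding R_def by (rule expect_sum_independent_square) (auto intro: nn)
  also have "\<dots> \<le> \<rho> k"
    unfolding \<rho>_def
    by (intro add_mono power_mono sum_mono2 sum_nonneg Bochner_Integration.integral_nonneg fin_I)
       (auto intro: nn)
  finally show ?thesis .
qed

definition variance_T_bound :: real where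
  "variance_T_bound = (\<Sum>i\<in>I. 2 * expect (p i) (\<lambda>y. (V i y) ^ 4)
      + 8 * (\<Sum>k\<in>K. expect (p i) (\<lambda>y. (\<Sum>l\<in>K. of_bool (l \<in> y)) * of_bool (k \<in> y)) * \<rho> k))"

lemma variance_T_le: "expect P (\<lambda>Y. (T Y - expect P T)\<^sup>2) \<le> variance_T_bound"
proof -
  have "expect P (\<lambda>Y. (T Y - expect P T)\<^sup>2) \<le> (\<Sum>i\<in>I. expect P (\<lambda>Y. (T Y - T (Y(i := {})))\<^sup>2))"
    unfolding P_def by (intro efron_stein[where a = "\<lambda>_. {}"] fin_I finite_supp)
  also have "\<dots> \<le> variance_T_bound"
    unfolding variance_T_bound_def
  proof (intro sum_mono)
    fix i assume i: "i \<in> I"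
    let ?N = "\<lambda>y. \<Sum>l\<in>K. of_bool (l \<in> y) :: real"
    have "(T Y - T (Y(i := {})))\<^sup>2
        \<le> 2 * (V i (Y i)) ^ 4 + 8 * (\<Sum>k\<in>K. (?N (Y i) * of_bool (k \<in> Y i)) * (R i k Y)\<^sup>2)" for Y
    proof -
      define x where "x = (V i (Y i))\<^sup>2"
      define z where "z = (\<Sum>k\<in>K. of_bool (k \<in> Y i) * R i k Y)"
      have 1: "(T Y - T (Y(i := {})))\<^sup>2 \<le> (x + 2 * z)\<^sup>2"
        using power_mono[OF T_diff_le[OF i, of Y] abs_ge_zero, of 2] unfolding x_def z_def by simp
      \<comment> \<open>Source of the constants 2 and 8 in \<open>variance_T_bound\<close>.\<close>
      have 2: "(x + 2 * z)\<^sup>2 = 2 * x\<^sup>2 + 8 * z\<^sup>2 - (x - 2 * z)\<^sup>2"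
        by (simp add: power2_eq_square algebra_simps)
      \<comment> \<open>Because the indicator is idempotent, it may be written twice.
        Cauchy--Schwarz then gives the size of \<open>Y i\<close> times the sum of the squares over
        the points of \<open>Y i\<close> only.\<close>
      have sq: "(of_bool b :: real)\<^sup>2 = of_bool b" for b by (cases b) auto
      have "z\<^sup>2 = (\<Sum>k\<in>K. of_bool (k \<in> Y i) * (of_bool (k \<in> Y i) * R i k Y))\<^sup>2"
        unfolding z_def by (intro arg_cong[of _ _ "\<lambda>x. x\<^sup>2"] sum.cong) auto
      also have "\<dots> \<le> (\<Sum>k\<in>K. (of_bool (k \<in> Y i))\<^sup>2) * (\<Sum>k\<in>K. (of_bool (k \<in> Y i) * R i k Y)\<^sup>2)"
        by (rule Cauchy_Schwarz_ineq_sum)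
      also have "\<dots> = (\<Sum>k\<in>K. (?N (Y i) * of_bool (k \<in> Y i)) * (R i k Y)\<^sup>2)"
        unfolding power_mult_distrib sq sum_distrib_left by (simp add: mult.assoc)
      finally have 3: "z\<^sup>2 \<le> (\<Sum>k\<in>K. (?N (Y i) * of_bool (k \<in> Y i)) * (R i k Y)\<^sup>2)" .
      have 4: "x\<^sup>2 = (V i (Y i)) ^ 4" by (simp add: x_def flip: power_mult)
      show ?thesis
        using 1 2 3 zero_le_power2[of "x - 2 * z"] unfolding 4 by linarith
    qed
    then have "expect P (\<lambda>Y. (T Y - T (Y(i := {})))\<^sup>2)
        \<le> expect P (\<lambda>Y. 2 * (V i (Y i)) ^ 4 + 8 * (\<Sum>k\<in>K. (?N (Y i) * of_bool (k \<in> Y i)) * (R i k Y)\<^sup>2))"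
      by (intro integral_mono) auto
    also have "\<dots> = 2 * expect P (\<lambda>Y. (V i (Y i)) ^ 4)
        + 8 * (\<Sum>k\<in>K. expect P (\<lambda>Y. (?N (Y i) * of_bool (k \<in> Y i)) * (R i k Y)\<^sup>2))"
      by simp
    finally have 1: "expect P (\<lambda>Y. (T Y - T (Y(i := {})))\<^sup>2) \<le> 2 * expect P (\<lambda>Y. (V i (Y i)) ^ 4)
        + 8 * (\<Sum>k\<in>K. expect P (\<lambda>Y. (?N (Y i) * of_bool (k \<in> Y i)) * (R i k Y)\<^sup>2))" .
    have 2: "expect P (\<lambda>Y. (V i (Y i)) ^ 4) = expect (p i) (\<lambda>y. (V i y) ^ 4)"
      by (rule expect_P_component[OF i])
    have 3: "(\<Sum>k\<in>K. expect P (\<lambda>Y. (?N (Y i) * of_bool (k \<in> Y i)) * (R i k Y)\<^sup>2))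
        \<le> (\<Sum>k\<in>K. expect (p i) (\<lambda>y. ?N y * of_bool (k \<in> y)) * \<rho> k)"
    proof (intro sum_mono)
      fix k
      have "R i k (Y(i := y)) = R i k Y" for Y y
        unfolding R_def by (intro sum.cong) auto
      then have "expect P (\<lambda>Y. (?N (Y i) * of_bool (k \<in> Y i)) * (R i k Y)\<^sup>2)
          = expect (p i) (\<lambda>y. ?N y * of_bool (k \<in> y)) * expect P (\<lambda>Y. (R i k Y)\<^sup>2)"
        by (intro expect_P_independent[OF i, where \<alpha> = "\<lambda>y. ?N y * of_bool (k \<in> y)"]) simp
      also have "\<dots> \<le> expect (p i) (\<lambda>y. ?N y * of_bool (k \<in> y)) * \<rho> k"
        by (intro mult_left_mono expect_R_square Bochner_Integration.integral_nonneg mult_nonneg_nonneg sum_nonneg) auto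
      finally show "expect P (\<lambda>Y. (?N (Y i) * of_bool (k \<in> Y i)) * (R i k Y)\<^sup>2)
          \<le> expect (p i) (\<lambda>y. ?N y * of_bool (k \<in> y)) * \<rho> k" .
    qed
    show "expect P (\<lambda>Y. (T Y - T (Y(i := {})))\<^sup>2)
        \<le> 2 * expect (p i) (\<lambda>y. (V i y) ^ 4) + 8 * (\<Sum>k\<in>K. expect (p i) (\<lambda>y. ?N y * of_bool (k \<in> y)) * \<rho> k)"
      using 1 3 unfolding 2 by linarith
  qed
  finally show ?thesis .
qed

text \<open>A first-order Taylor expansion turns E[X g(X)] into E[g'(X) T] / \<sigma>^2 plus
  remainders. As E T = \<sigma>^2, the main term is controlled by the standard deviation of
  \<open>T\<close>, with |g'| at most 8. The remainders are at most 12 |M j| (\<delta> j)^2 /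
  \<sigma>^3 each, and \<open>V j\<close> dominates both \<open>M j\<close> and
  \<open>\<delta> j\<close>.\<close>

lemma stein_bound:
  assumes g: "stein_class g g'" and \<sigma>: "\<sigma> > 0"
    and var: "\<sigma>\<^sup>2 = expect P (\<lambda>Y. (uncovered Y - mean_uncovered)\<^sup>2)"
  defines "X \<equiv> \<lambda>Y. (uncovered Y - mean_uncovered) / \<sigma>"
  shows "\<bar>expect P (\<lambda>Y. g' (X Y) - X Y * g (X Y))\<bar>
    \<le> 8 * sqrt variance_T_bound / \<sigma>\<^sup>2 + 12 * (\<Sum>j\<in>I. expect (p j) (\<lambda>y. (V j y) ^ 3)) / \<sigma> ^ 3"
proof -
  define e where "e = (\<lambda>j Y. g (X Y) - g (X (Y(j := {}))) - g' (X Y) * (\<delta> j Y / \<sigma>))"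
  have Xd: "X (Y(j := {})) = X Y - \<delta> j Y / \<sigma>" for j Y
    by (simp add: X_def \<delta>_def diff_divide_distrib)
  have e_le: "\<bar>e j Y\<bar> \<le> 12 * (\<delta> j Y / \<sigma>)\<^sup>2" for j Y
    unfolding e_def Xd by (rule stein_class_taylor[OF g])
  have "expect P (\<lambda>Y. X Y * g (X Y)) = expect P (\<lambda>Y. (uncovered Y - mean_uncovered) * g (X Y)) / \<sigma>"
    by (simp add: X_def)
  also have "\<dots> = (\<Sum>j\<in>I. expect P (\<lambda>Y. M j Y * (g (X Y) - g (X (Y(j := {})))))) / \<sigma>"
    by (simp add: expect_centered_mult)
  also have "\<dots> = (\<Sum>j\<in>I. expect P (\<lambda>Y. g' (X Y) * (M j Y * \<delta> j Y) / \<sigma> + M j Y * e j Y)) / \<sigma>"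
    by (intro arg_cong2[of _ _ _ _ "(/)"] sum.cong refl Bochner_Integration.integral_cong)
       (simp add: e_def algebra_simps)
  also have "\<dots> = expect P (\<lambda>Y. g' (X Y) * T Y) / \<sigma>\<^sup>2 + (\<Sum>j\<in>I. expect P (\<lambda>Y. M j Y * e j Y)) / \<sigma>"
    by (simp add: T_def sum_distrib_left sum.distrib add_divide_distrib power2_eq_square
        flip: sum_divide_distrib)
  finally have split: "expect P (\<lambda>Y. g' (X Y) - X Y * g (X Y))
      = expect P (\<lambda>Y. g' (X Y) * (\<sigma>\<^sup>2 - T Y)) / \<sigma>\<^sup>2 - (\<Sum>j\<in>I. expect P (\<lambda>Y. M j Y * e j Y)) / \<sigma>"
    using \<sigma> by (simp add: right_diff_distrib diff_divide_distrib)
  have main: "\<bar>expect P (\<lambda>Y. g' (X Y) * (\<sigma>\<^sup>2 - T Y))\<bar> \<le> 8 * sqrt variance_T_bound"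
  proof -
    have "\<bar>expect P (\<lambda>Y. g' (X Y) * (\<sigma>\<^sup>2 - T Y))\<bar> \<le> expect P (\<lambda>Y. \<bar>g' (X Y) * (\<sigma>\<^sup>2 - T Y)\<bar>)"
      by (rule integral_abs_bound)
    also have "\<dots> \<le> expect P (\<lambda>Y. 8 * \<bar>T Y - expect P T\<bar>)"
      using g by (intro integral_mono) (auto simp: abs_mult var expect_T abs_minus_commute stein_class_def intro!: mult_right_mono)
    also have "\<dots> = 8 * expect P (\<lambda>Y. \<bar>T Y - expect P T\<bar>)" by simp
    also have "\<dots> \<le> 8 * sqrt (expect P (\<lambda>Y. (T Y - expect P T)\<^sup>2))"
      by (intro mult_left_mono expect_abs_le finite_P) auto
    also have "\<dots> \<le> 8 * sqrt variance_T_bound"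
      using variance_T_le by simp
    finally show ?thesis .
  qed
  have rest: "\<bar>expect P (\<lambda>Y. M j Y * e j Y)\<bar> \<le> 12 * expect (p j) (\<lambda>y. (V j y) ^ 3) / \<sigma>\<^sup>2" if j: "j \<in> I" for j
  proof -
    have "\<bar>M j Y * e j Y\<bar> \<le> 12 / \<sigma>\<^sup>2 * (V j (Y j)) ^ 3" for Y
    proof -
      have "(\<delta> j Y)\<^sup>2 \<le> (V j (Y j))\<^sup>2"
        using abs_\<delta>_le[OF j, of Y] by (metis abs_ge_zero power2_abs power_mono)
      then have "12 * (\<delta> j Y / \<sigma>)\<^sup>2 \<le> 12 * ((V j (Y j))\<^sup>2 / \<sigma>\<^sup>2)"
        by (simp add: power_divide divide_right_mono)
      then have "\<bar>M j Y\<bar> * \<bar>e j Y\<bar> \<le> V j (Y j) * (12 * ((V j (Y j))\<^sup>2 / \<sigma>\<^sup>2))"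
        using e_le[of j Y] by (intro mult_mono abs_M_le j V_nonneg) auto
      then show ?thesis by (simp add: abs_mult power3_eq_cube power2_eq_square mult_ac)
    qed
    then have "expect P (\<lambda>Y. \<bar>M j Y * e j Y\<bar>) \<le> expect P (\<lambda>Y. 12 / \<sigma>\<^sup>2 * (V j (Y j)) ^ 3)"
      by (intro integral_mono) auto
    also have "\<dots> = 12 * expect (p j) (\<lambda>y. (V j y) ^ 3) / \<sigma>\<^sup>2"
      using expect_P_component[OF j, of "\<lambda>y. (V j y) ^ 3"] by simp
    finally show ?thesis
      by (rule order_trans[OF integral_abs_bound])
  qed
  have "\<bar>(\<Sum>j\<in>I. expect P (\<lambda>Y. M j Y * e j Y))\<bar> \<le> (\<Sum>j\<in>I. 12 * expect (p j) (\<lambda>y. (V j y) ^ 3) / \<sigma>\<^sup>2)"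
    by (rule order_trans[OF sum_abs]) (intro sum_mono rest)
  also have "\<dots> = 12 * (\<Sum>j\<in>I. expect (p j) (\<lambda>y. (V j y) ^ 3)) / \<sigma>\<^sup>2"
    by (simp add: sum_distrib_left sum_divide_distrib)
  finally have "\<bar>(\<Sum>j\<in>I. expect P (\<lambda>Y. M j Y * e j Y))\<bar> / \<sigma> \<le> 12 * (\<Sum>j\<in>I. expect (p j) (\<lambda>y. (V j y) ^ 3)) / \<sigma>\<^sup>2 / \<sigma>"
    using \<sigma> by (intro divide_right_mono) auto
  moreover have "\<bar>expect P (\<lambda>Y. g' (X Y) * (\<sigma>\<^sup>2 - T Y))\<bar> / \<sigma>\<^sup>2 \<le> 8 * sqrt variance_T_bound / \<sigma>\<^sup>2"
    using main by (intro divide_right_mono) auto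
  ultimately show ?thesis
    unfolding split using \<sigma>
    by (intro order_trans[OF abs_triangle_ineq4] add_mono)
       (auto simp: power3_eq_cube power2_eq_square mult_ac)
qed

section \<open>Lower bound for the variance\<close>

lemma expect_prod_not_in:
  assumes J: "J \<subseteq> I"
  shows "expect P (\<lambda>Y. \<Prod>i\<in>J. of_bool (k \<notin> Y i)) = (\<Prod>i\<in>J. 1 - q k i)"
proof -
  define h :: "nat \<Rightarrow> 'k set \<Rightarrow> real" where "h i y = (if i \<in> J then of_bool (k \<notin> y) else 1)" for i y
  have h: "h i = (if i \<in> J then (\<lambda>y. of_bool (k \<notin> y)) else (\<lambda>_. 1))" for i
    by (auto simp: h_def)
  have "expect P (\<lambda>Y. \<Prod>i\<in>J. of_bool (k \<notin> Y i)) = expect P (\<lambda>Y. \<Prod>i\<in>I. h i (Y i))"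
    by (intro Bochner_Integration.integral_cong refl prod.mono_neutral_cong_left)
       (use J fin_I in \<open>auto simp: h_def\<close>)
  also have "\<dots> = (\<Prod>i\<in>I. expect (p i) (h i))"
    unfolding P_def by (intro expectation_prod_Pi_pmf fin_I integrable_p) (auto simp: h_def)
  also have "\<dots> = (\<Prod>i\<in>J. 1 - q k i)"
    by (rule prod.mono_neutral_cong_right)
       (use J fin_I in \<open>auto simp: h expect_not_in simp del: of_bool_not_iff\<close>)
  finally show ?thesis .
qed

text \<open>
  Cauchy--Schwarz against the number of empty \<open>Y j\<close>. Emptying \<open>Y j\<close> uncovers in
  particular the point \<open>\<kappa> j\<close> unless another set contains it.
\<close>

lemma variance_lower_bound:
  assumes own: "\<And>j y. j \<in> I \<Longrightarrow> y \<in> set_pmf (p j) \<Longrightarrow> y \<noteq> {} \<Longrightarrow> \<kappa> j \<in> y"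
    and \<kappa>: "\<And>j. j \<in> I \<Longrightarrow> \<kappa> j \<in> K"
  defines "\<zeta> \<equiv> \<lambda>j. pmf (p j) {}"
  shows "(\<Sum>j\<in>I. \<zeta> j * (1 - \<zeta> j) * (\<Prod>i\<in>I - {j}. 1 - q (\<kappa> j) i))\<^sup>2
    \<le> expect P (\<lambda>Y. (uncovered Y - mean_uncovered)\<^sup>2) * (\<Sum>j\<in>I. \<zeta> j * (1 - \<zeta> j))"
proof -
  have \<zeta>: "0 \<le> \<zeta> j" "\<zeta> j \<le> 1" for j by (auto simp: \<zeta>_def pmf_le_1)
  have empty: "expect (p j) (\<lambda>y. of_bool (y = {})) = \<zeta> j" for j
    by (subst integral_measure_pmf_real[of "{{}}"]) (auto simp: \<zeta>_def)
  \<comment> \<open>By \<open>own\<close>, the set \<open>Y j\<close> contains the point \<kappa> j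
    exactly if it is nonempty.\<close>
  have q\<kappa>: "q (\<kappa> j) j = 1 - \<zeta> j" if j: "j \<in> I" for j
  proof -
    have "q (\<kappa> j) j = expect (p j) (\<lambda>y. 1 - of_bool (y = {}))"
      unfolding q_def by (rule expect_cong) (use own[OF j] in \<open>auto simp: of_bool_def\<close>)
    then show ?thesis using j empty[of j] by (simp add: integrable_p)
  qed
  define D :: "nat \<Rightarrow> 'k set \<Rightarrow> real" where "D j y = of_bool (y = {}) - \<zeta> j" for j y
  have expD: "expect (p j) (D j) = 0" if "j \<in> I" for j
    unfolding D_def using that empty[of j] by (simp add: integrable_p)
  have expD2: "expect (p j) (\<lambda>y. (D j y)\<^sup>2) = \<zeta> j * (1 - \<zeta> j)" if "j \<in> I" for j
  proof -
    have "expect (p j) (\<lambda>y. (D j y)\<^sup>2) = expect (p j) (\<lambda>y. (1 - 2 * \<zeta> j) * of_bool (y = {}) + (\<zeta> j)\<^sup>2)"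
      by (intro Bochner_Integration.integral_cong refl)
         (auto simp: D_def power2_eq_square algebra_simps)
    then show ?thesis using that empty[of j]
      by (simp add: integrable_p power2_eq_square algebra_simps)
  qed
  have cov: "\<zeta> j * (1 - \<zeta> j) * (\<Prod>i\<in>I - {j}. 1 - q (\<kappa> j) i)
      \<le> expect P (\<lambda>Y. (uncovered Y - mean_uncovered) * D j (Y j))" if j: "j \<in> I" for j
  proof -
    have "expect P (\<lambda>Y. D j (Y j) * (uncovered (Y(j := {})) - mean_uncovered)) = 0"
      using expect_P_independent[OF j, of "\<lambda>Y. uncovered (Y(j := {})) - mean_uncovered" "D j"]
      by (simp add: expD[OF j])
    \<comment> \<open>If \<open>Y j\<close> is empty, then \<delta> j = 0 and nothing changes;
      otherwise D j = - \<zeta> j. Since D j is centred and independent of the configuration with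
      \<open>Y j\<close> emptied, only the term with \<delta> j survives in the mean.\<close>
    moreover have "(uncovered Y - mean_uncovered) * D j (Y j)
        = - \<zeta> j * \<delta> j Y + D j (Y j) * (uncovered (Y(j := {})) - mean_uncovered)" for Y
    proof (cases "Y j = {}")
      case True
      then have "Y(j := {}) = Y" by (auto simp: fun_eq_iff)
      then show ?thesis by (simp add: \<delta>_def)
    next
      case False
      then show ?thesis by (simp add: \<delta>_def D_def algebra_simps)
    qed
    ultimately have eq: "expect P (\<lambda>Y. (uncovered Y - mean_uncovered) * D j (Y j)) = \<zeta> j * expect P (\<lambda>Y. - \<delta> j Y)"
      by simp
    have "of_bool (\<kappa> j \<in> Y j) * (\<Prod>i\<in>I - {j}. of_bool (\<kappa> j \<notin> Y i)) \<le> - \<delta> j Y" for Y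
      unfolding \<delta>_eq[OF j] minus_minus
      by (rule member_le_sum[OF \<kappa>[OF j] _ fin_K, where f = "\<lambda>k. of_bool (k \<in> Y j) * (\<Prod>i\<in>I - {j}. of_bool (k \<notin> Y i))"])
         (intro mult_nonneg_nonneg prod_nonneg, auto)
    then have "expect P (\<lambda>Y. of_bool (\<kappa> j \<in> Y j) * (\<Prod>i\<in>I - {j}. of_bool (\<kappa> j \<notin> Y i))) \<le> expect P (\<lambda>Y. - \<delta> j Y)"
      by (intro integral_mono) auto
    moreover have "expect P (\<lambda>Y. of_bool (\<kappa> j \<in> Y j) * (\<Prod>i\<in>I - {j}. of_bool (\<kappa> j \<notin> Y i)))
        = q (\<kappa> j) j * (\<Prod>i\<in>I - {j}. 1 - q (\<kappa> j) i)"
    proof -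
      have "(\<Prod>i\<in>I - {j}. of_bool (\<kappa> j \<notin> (Y(j := y)) i) :: real) = (\<Prod>i\<in>I - {j}. of_bool (\<kappa> j \<notin> Y i))" for Y y
        by (intro prod.cong) auto
      then show ?thesis
        using expect_P_independent[OF j, of "\<lambda>Y. \<Prod>i\<in>I - {j}. of_bool (\<kappa> j \<notin> Y i)" "\<lambda>y. of_bool (\<kappa> j \<in> y)"]
          expect_prod_not_in[of "I - {j}" "\<kappa> j"]
        unfolding q_def by auto
    qed
    ultimately show ?thesis
      unfolding eq q\<kappa>[OF j] mult.assoc using \<zeta> by (intro mult_left_mono) auto
  qed
  have sum_sq: "expect P (\<lambda>Y. (\<Sum>j\<in>I. D j (Y j))\<^sup>2) = (\<Sum>j\<in>I. \<zeta> j * (1 - \<zeta> j))"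
  proof -
    have "expect P (\<lambda>Y. (\<Sum>j\<in>I. D j (Y j))\<^sup>2) = (\<Sum>i\<in>I. \<Sum>j\<in>I. expect P (\<lambda>Y. D i (Y i) * D j (Y j)))"
      by (simp add: power2_eq_square sum_product)
    also have "\<dots> = (\<Sum>i\<in>I. \<Sum>j\<in>I. if i = j then \<zeta> i * (1 - \<zeta> i) else 0)"
    proof (intro sum.cong refl)
      fix i j assume ij: "i \<in> I" "j \<in> I"
      show "expect P (\<lambda>Y. D i (Y i) * D j (Y j)) = (if i = j then \<zeta> i * (1 - \<zeta> i) else 0)"
      proof (cases "i = j")
        case True
        then show ?thesis
          using expect_P_component[OF ij(1), of "\<lambda>y. (D i y)\<^sup>2"] expD2[OF ij(1)]
          by (simp add: power2_eq_square)
      next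
        case False
        then show ?thesis
          using expect_P_independent[OF ij(1), of "\<lambda>Y. D j (Y j)" "D i"] expD[OF ij(1)] by simp
      qed
    qed
    also have "\<dots> = (\<Sum>j\<in>I. \<zeta> j * (1 - \<zeta> j))" using fin_I by simp
    finally show ?thesis .
  qed
  have "(\<Sum>j\<in>I. \<zeta> j * (1 - \<zeta> j) * (\<Prod>i\<in>I - {j}. 1 - q (\<kappa> j) i))
      \<le> (\<Sum>j\<in>I. expect P (\<lambda>Y. (uncovered Y - mean_uncovered) * D j (Y j)))"
    by (intro sum_mono cov)
  also have "\<dots> = expect P (\<lambda>Y. (uncovered Y - mean_uncovered) * (\<Sum>j\<in>I. D j (Y j)))"
    by (simp add: sum_distrib_left)
  finally have "(\<Sum>j\<in>I. \<zeta> j * (1 - \<zeta> j) * (\<Prod>i\<in>I - {j}. 1 - q (\<kappa> j) i))\<^sup>2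
      \<le> (expect P (\<lambda>Y. (uncovered Y - mean_uncovered) * (\<Sum>j\<in>I. D j (Y j))))\<^sup>2"
    using \<zeta> by (intro power_mono sum_nonneg mult_nonneg_nonneg prod_q_bounds) auto
  also have "\<dots> \<le> expect P (\<lambda>Y. (uncovered Y - mean_uncovered)\<^sup>2) * expect P (\<lambda>Y. (\<Sum>j\<in>I. D j (Y j))\<^sup>2)"
    by (rule expect_Cauchy_Schwarz[OF finite_P])
  finally show ?thesis unfolding sum_sq .
qed

end

section \<open>The in-neighbourhoods in the preferential attachment graph\<close>

text \<open>
  The law of \<open>H k\<close>: the set of in-neighbours of \<open>k\<close> in the graph on \<open>n\<close> vertices, with \<open>k\<close>
  itself added if there are any.
\<close>

primrec hits :: "(nat \<Rightarrow> real) \<Rightarrow> nat \<Rightarrow> nat \<Rightarrow> nat set pmf" where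
  "hits f k 0 = return_pmf {}"
| "hits f k (Suc n) =
     bind_pmf (hits f k n) (\<lambda>A.
       map_pmf (\<lambda>b. if b then insert k (insert (Suc n) A) else A)
         (if k \<in> {1..n} then bernoulli_pmf (f (card (A - {k})) / real n) else return_pmf False))"

text \<open>The member \<open>k\<close> of \<open>H k\<close> only marks that \<open>k\<close> has
  in-edges; the diagonal pair is not an edge.\<close>

definition edges :: "(nat \<Rightarrow> nat set) \<Rightarrow> (nat \<times> nat) set" where
  "edges H = {(j, k). j \<in> H k \<and> j \<noteq> k}"

lemma hits_trivial: "n \<le> k \<Longrightarrow> hits f k n = return_pmf {}"
  by (induction n) (auto simp: bind_return_pmf)

lemma set_hits:
  assumes "A \<in> set_pmf (hits f k n)"
  shows "A \<subseteq> {k..n} \<and> (A \<noteq> {} \<longrightarrow> k \<in> A \<and> (\<exists>j\<in>A. j \<noteq> k))"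
  using assms
proof (induction n arbitrary: A)
  case 0
  then show ?case by simp
next
  case (Suc n)
  from Suc.prems obtain B where B: "B \<in> set_pmf (hits f k n)"
    and A: "A = B \<or> k \<in> {1..n} \<and> A = insert k (insert (Suc n) B)"
    by (auto split: if_splits)
  from A show ?case
  proof
    assume "A = B"
    then show ?thesis using Suc.IH[OF B] by auto
  next
    assume A: "k \<in> {1..n} \<and> A = insert k (insert (Suc n) B)"
    then have "Suc n \<in> A" "Suc n \<noteq> k" by auto
    then show ?thesis using A Suc.IH[OF B] by fastforce
  qed
qed

lemma finite_set_hits: "finite (set_pmf (hits f k n))"
  by (rule finite_subset[of _ "Pow {k..n}"]) (auto dest!: set_hits)

lemma Pi_pmf_insert_default:
  assumes "finite A" "x \<notin> A" "p x = return_pmf d"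
  shows "Pi_pmf (insert x A) d p = Pi_pmf A d p"
proof -
  have "Pi_pmf (insert x A) d p = map_pmf (\<lambda>f. f(x := d)) (Pi_pmf A d p)"
    using assms by (simp add: Pi_pmf_insert' bind_return_pmf map_pmf_def)
  also have "\<dots> = map_pmf id (Pi_pmf A d p)"
    using set_Pi_pmf_subset[OF assms(1), of d p] assms(2)
    by (intro map_pmf_cong refl) (auto simp: fun_eq_iff)
  finally show ?thesis by simp
qed

text \<open>The two default values are unrelated because the value outside \<open>A\<close> is set
  explicitly. Below, coins with default \<open>False\<close> are turned into sets with default
  \<open>{}\<close>.\<close>

lemma Pi_pmf_map_dep:
  assumes "finite A"
  shows "Pi_pmf A d (\<lambda>x. map_pmf (g x) (p x))
    = map_pmf (\<lambda>h x. if x \<in> A then g x (h x) else d) (Pi_pmf A d' p)"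
proof -
  have "Pi_pmf A d (\<lambda>x. map_pmf (g x) (p x))
      = bind_pmf (Pi_pmf A d' p) (\<lambda>h. Pi_pmf A d (\<lambda>x. return_pmf (g x (h x))))"
    unfolding map_pmf_def by (rule Pi_pmf_bind[OF assms])
  then show ?thesis using assms by (simp add: map_pmf_def)
qed

lemma indegree_edges: "indegree (edges H) k = card (H k - {k})"
  unfolding indegree_def edges_def by (rule arg_cong[of _ _ card]) auto

text \<open>One step of the graph tosses, for each vertex, a coin whose bias depends on the indegree
  of this vertex only. It is therefore a simultaneous step of independent chains, and
  \<open>Pi_pmf_bind\<close> exchanges product and step.\<close>

lemma pref_attach_eq_hits:
  "pref_attach f n = map_pmf edges (Pi_pmf {1..n} {} (\<lambda>k. hits f k n))"
proof (induction n)
  case 0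
  then show ?case by (simp add: edges_def)
next
  case (Suc n)
  define step where "step = (\<lambda>(H :: nat \<Rightarrow> nat set) k. bernoulli_pmf (f (card (H k - {k})) / real n))"
  have "{1..Suc n} = insert (Suc n) {1..n}" by auto
  then have "Pi_pmf {1..Suc n} {} (\<lambda>k. hits f k (Suc n)) = Pi_pmf {1..n} {} (\<lambda>k. hits f k (Suc n))"
    using Pi_pmf_insert_default[of "{1..n}" "Suc n" "\<lambda>k. hits f k (Suc n)" "{}"] hits_trivial[of "Suc n" "Suc n" f]
    by (simp del: hits.simps)
  also have "\<dots> = bind_pmf (Pi_pmf {1..n} {} (\<lambda>k. hits f k n)) (\<lambda>H. Pi_pmf {1..n} {} (\<lambda>k.
        map_pmf (\<lambda>b. if b then insert k (insert (Suc n) (H k)) else H k)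
          (if k \<in> {1..n} then step H k else return_pmf False)))"
    unfolding hits.simps step_def by (rule Pi_pmf_bind) simp
  also have "\<dots> = bind_pmf (Pi_pmf {1..n} {} (\<lambda>k. hits f k n)) (\<lambda>H.
        map_pmf (\<lambda>T k. if k \<in> {1..n} then (if T k then insert k (insert (Suc n) (H k)) else H k) else {})
          (Pi_pmf {1..n} False (step H)))"
    by (subst Pi_pmf_map_dep[where d' = False])
       (auto intro!: bind_pmf_cong map_pmf_cong Pi_pmf_cong)
  finally have "map_pmf edges (Pi_pmf {1..Suc n} {} (\<lambda>k. hits f k (Suc n)))
      = bind_pmf (Pi_pmf {1..n} {} (\<lambda>k. hits f k n)) (\<lambda>H.
        map_pmf (\<lambda>T. edges (\<lambda>k. if k \<in> {1..n} then (if T k then insert k (insert (Suc n) (H k)) else H k) else {}))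
          (Pi_pmf {1..n} False (step H)))"
    by (simp add: map_bind_pmf pmf.map_comp o_def)
  also have "\<dots> = bind_pmf (Pi_pmf {1..n} {} (\<lambda>k. hits f k n)) (\<lambda>H.
        map_pmf (\<lambda>T. edges H \<union> {(Suc n, k) | k. k \<in> {1..n} \<and> T k}) (Pi_pmf {1..n} False (step H)))"
  proof (intro bind_pmf_cong map_pmf_cong refl)
    fix H T assume "H \<in> set_pmf (Pi_pmf {1..n} {} (\<lambda>k. hits f k n))"
    \<comment> \<open>Outside {1..n} the family is already empty, so replacing it by
      \<open>{}\<close> there leaves the edges unchanged.\<close>
    then have "k \<notin> {1..n} \<Longrightarrow> H k = {}" for k
      using set_Pi_pmf_subset[of "{1..n}" "{}" "\<lambda>k. hits f k n"] by auto
    then show "edges (\<lambda>k. if k \<in> {1..n} then (if T k then insert k (insert (Suc n) (H k)) else H k) else {})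
        = edges H \<union> {(Suc n, k) | k. k \<in> {1..n} \<and> T k}"
      unfolding edges_def by (auto split: if_splits)
  qed
  also have "\<dots> = pref_attach f (Suc n)"
    by (simp add: Suc.IH bind_map_pmf indegree_edges step_def)
  finally show ?case by simp
qed

text \<open>For i \<noteq> v, membership of v in H i is an out-edge of v. Membership in H v signals
  an in-edge, since a nonempty H v contains v and some other vertex.\<close>

lemma isolated_edges:
  assumes H: "H \<in> set_pmf (Pi_pmf {1..n} {} (\<lambda>k. hits f k n))"
  shows "isolated (edges H) v \<longleftrightarrow> (\<forall>i\<in>{1..n}. v \<notin> H i)"
proof -
  have in_supp: "H k \<in> set_pmf (hits f k n)" if "k \<in> {1..n}" for k
    using H that by (auto simp: set_Pi_pmf PiE_dflt_def)
  have outside: "H k = {}" if "k \<notin> {1..n}" for k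
    using H that set_Pi_pmf_subset[of "{1..n}" "{}" "\<lambda>k. hits f k n"] by auto
  have H_cases: "H k = {} \<or> (k \<in> H k \<and> (\<exists>j\<in>H k. j \<noteq> k))" for k
    using set_hits[OF in_supp[of k]] outside[of k] by blast
  show ?thesis
  proof
    assume iso: "isolated (edges H) v"
    show "\<forall>i\<in>{1..n}. v \<notin> H i"
    proof
      fix i assume "i \<in> {1..n}"
      show "v \<notin> H i"
        using iso H_cases[of i] unfolding isolated_def edges_def by (cases "i = v") auto
    qed
  next
    assume "\<forall>i\<in>{1..n}. v \<notin> H i"
    then have "v \<notin> H i" for i using outside by (cases "i \<in> {1..n}") auto
    then show "isolated (edges H) v"
      using H_cases[of v] unfolding isolated_def edges_def by auto
  qed
qed

lemma prod_of_bool: "finite A \<Longrightarrow> (\<Prod>i\<in>A. of_bool (\<theta> i) :: real) = of_bool (\<forall>i\<in>A. \<theta> i)"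
  by (induction A rule: finite_induct) auto

lemma num_isolated_edges:
  assumes H: "H \<in> set_pmf (Pi_pmf {1..n} {} (\<lambda>k. hits f k n))"
  shows "real (num_isolated n (edges H)) = (\<Sum>k\<in>{1..n}. \<Prod>i\<in>{1..n}. of_bool (k \<notin> H i))"
proof -
  have "real (num_isolated n (edges H)) = (\<Sum>k\<in>{1..n}. of_bool (\<forall>i\<in>{1..n}. k \<notin> H i))"
    unfolding num_isolated_def isolated_edges[OF H] of_bool_def
    by (subst sum.inter_filter[symmetric]) auto
  then show ?thesis by (simp only: prod_of_bool[OF finite_atLeastAtMost])
qed

section \<open>One step of the indegree chain and the probability of having no in-edges\<close>

context
  fixes f :: "nat \<Rightarrow> real"
  assumes att: "attachment_function f"
begin

lemma hits_prob:
  assumes A: "A \<in> set_pmf (hits f j n)" and j: "1 \<le> j" "j \<le> n"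
  shows "0 \<le> f (card (A - {j})) / real n" "f (card (A - {j})) / real n \<le> 1"
proof -
  have "card (A - {j}) \<le> card {j<..n}"
    using set_hits[OF A] by (intro card_mono) auto
  then have "real (card (A - {j})) + 1 \<le> real n" using j by auto
  moreover have "0 < f (card (A - {j}))" "f (card (A - {j})) \<le> real (card (A - {j})) + 1"
    using att by (auto simp: attachment_function_def)
  ultimately show "0 \<le> f (card (A - {j})) / real n" "f (card (A - {j})) / real n \<le> 1"
    using j by auto
qed

lemma expect_hits_Suc:
  assumes j: "1 \<le> j" "j \<le> n"
  shows "expect (hits f j (Suc n)) \<phi> = expect (hits f j n) (\<lambda>A.
    f (card (A - {j})) / real n * \<phi> (insert j (insert (Suc n) A))
    + (1 - f (card (A - {j})) / real n) * \<phi> A)"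
proof -
  define step where "step = (\<lambda>A. map_pmf (\<lambda>b. if b then insert j (insert (Suc n) A) else A)
    (bernoulli_pmf (f (card (A - {j})) / real n)))"
  have "expect (hits f j (Suc n)) \<phi> = expect (bind_pmf (hits f j n) step) \<phi>"
    using j by (simp add: step_def)
  also have "\<dots> = (\<Sum>A\<in>set_pmf (hits f j n). pmf (hits f j n) A *\<^sub>R expect (step A) \<phi>)"
    by (rule pmf_expectation_bind) (auto simp: finite_set_hits step_def)
  also have "\<dots> = expect (hits f j n) (\<lambda>A. expect (step A) \<phi>)"
    by (rule integral_measure_pmf[symmetric]) (auto simp: finite_set_hits)
  also have "\<dots> = expect (hits f j n) (\<lambda>A.
    f (card (A - {j})) / real n * \<phi> (insert j (insert (Suc n) A))
    + (1 - f (card (A - {j})) / real n) * \<phi> A)"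
    \<comment> \<open>By \<open>hits_prob\<close> the parameter is a genuine probability, so
      \<open>bernoulli_pmf\<close> does not truncate it.\<close>
    by (rule expect_cong) (use hits_prob[OF _ j] in \<open>simp add: step_def mult.commute\<close>)
  finally show ?thesis .
qed

lemma card_insert_hits:
  assumes A: "A \<in> set_pmf (hits f j n)" and j: "j \<le> n"
  shows "card (insert j (insert (Suc n) A) - {j}) = Suc (card (A - {j}))"
proof -
  have "A \<subseteq> {j..n}" using set_hits[OF A] by auto
  then have "finite A" "Suc n \<notin> A" by (auto intro: finite_subset)
  moreover have "insert j (insert (Suc n) A) - {j} = insert (Suc n) (A - {j})"
    using j by auto
  ultimately show ?thesis by simp
qed

lemma pmf_hits_empty_Suc:
  assumes j: "1 \<le> j" "j \<le> n"
  shows "pmf (hits f j (Suc n)) {} = (1 - f 0 / real n) * pmf (hits f j n) {}"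
proof -
  have eq: "expect (hits f j m) (\<lambda>y. of_bool (y = {})) = pmf (hits f j m) {}" for m
    by (subst integral_measure_pmf_real[of "{{}}"]) auto
  have "pmf (hits f j (Suc n)) {} = expect (hits f j n) (\<lambda>A. (1 - f 0 / real n) * of_bool (A = {}))"
    unfolding eq[symmetric] expect_hits_Suc[OF j] by (rule expect_cong) auto
  then show ?thesis by (simp add: eq)
qed

text \<open>The probability is the product of 1 - f 0 / m over j \<le> m < n. For m \<ge> 2 each
  factor is at least 1 - 1/m, and these telescope against the denominator n - 1; so the stronger
  bound with n - 1 is proved by induction. The factor for m = 1 is 1 - f 0, which accounts for this
  constant.\<close>

lemma pmf_hits_empty_lower:
  assumes f0: "f 0 < 1" and j: "1 \<le> j" "j \<le> n" and n: "2 \<le> n"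
  shows "(1 - f 0) * real j / (2 * real n) \<le> pmf (hits f j n) {}"
proof -
  have f0': "0 < f 0" using att by (auto simp: attachment_function_def)
  have "(1 - f 0) * real j / (2 * (real n - 1)) \<le> pmf (hits f j n) {}"
    using j n
  proof (induction n)
    case 0
    then show ?case by simp
  next
    case (Suc n)
    show ?case
    proof (cases "j = Suc n")
      case True
      then have "(1 - f 0) * real j / (2 * (real (Suc n) - 1)) \<le> 1"
        using Suc.prems f0 f0' mult_mono[of "1 - f 0" 1 "real (Suc n)" "2 * real n"] by (simp add: field_simps)
      then show ?thesis using True by (simp add: hits_trivial del: hits.simps)
    next
      case False
      then have jn: "1 \<le> j" "j \<le> n" using Suc.prems by auto
      show ?thesis
      proof (cases "n = 1")
        case True
        then show ?thesis using jn f0 pmf_hits_empty_Suc[OF jn] hits_trivial[of 1 j f]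
          by (simp del: hits.simps)
      next
        case False
        then have n2: "2 \<le> n" using jn by auto
        have "(1 - f 0) * real j / (2 * (real (Suc n) - 1))
            = (1 - 1 / real n) * ((1 - f 0) * real j / (2 * (real n - 1)))"
          using n2 by (simp add: field_simps)
        also have "\<dots> \<le> (1 - f 0 / real n) * pmf (hits f j n) {}"
          using n2 f0 Suc.IH[OF jn n2] by (intro mult_mono diff_left_mono divide_right_mono) auto
        finally show ?thesis using pmf_hits_empty_Suc[OF jn] by simp
      qed
    qed
  qed
  moreover have "(1 - f 0) * real j / (2 * real n) \<le> (1 - f 0) * real j / (2 * (real n - 1))"
    using n f0 by (intro divide_left_mono) auto
  ultimately show ?thesis by linarith
qed

text \<open>While the subtracted term x is at most 1/2, each step lowers the bound 1 - x by at least
  f 0 / (2 n), whereas x itself grows by f 0 j / (2 n (n + 1)) only.\<close>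

lemma pmf_hits_empty_upper:
  assumes f0: "f 0 < 1" and j: "1 \<le> j" "j \<le> n"
  shows "pmf (hits f j n) {} \<le> 1 - f 0 * (real n - real j) / (2 * real n)"
  using j(2)
proof (induction n rule: dec_induct)
  case base
  then show ?case by (simp add: pmf_le_1)
next
  case (step n)
  have f0': "0 < f 0" using att by (auto simp: attachment_function_def)
  have n: "real n \<ge> 1" "j \<le> n" using step j by auto
  define x where "x = f 0 * (real n - real j) / (2 * real n)"
  have x: "x \<le> 1 / 2"
    using n f0 f0' j mult_mono[of "f 0" 1 "real n - real j" "real n"] by (simp add: x_def field_simps)
  have "pmf (hits f j (Suc n)) {} = (1 - f 0 / real n) * pmf (hits f j n) {}"
    by (rule pmf_hits_empty_Suc[OF j(1) n(2)])
  also have "\<dots> \<le> (1 - f 0 / real n) * (1 - x)"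
    unfolding x_def using n f0 by (intro mult_left_mono step.IH) (auto simp: field_simps)
  also have "\<dots> = 1 - x - f 0 / real n * (1 - x)" by (simp add: algebra_simps)
  also have "\<dots> \<le> 1 - x - f 0 / real n * (1 / 2)"
    using x f0' n by (intro diff_left_mono mult_left_mono) auto
  also have "\<dots> \<le> 1 - f 0 * (real (Suc n) - real j) / (2 * real (Suc n))"
  proof -
    have "f 0 * (real (Suc n) - real j) / (2 * real (Suc n)) - x = f 0 * real j / (2 * real n * real (Suc n))"
      using n unfolding x_def of_nat_Suc by (simp add: divide_simps) (simp add: algebra_simps)
    also have "\<dots> \<le> f 0 * real (Suc n) / (2 * real n * real (Suc n))"
      using n f0' by (intro divide_right_mono mult_left_mono) auto
    also have "\<dots> = f 0 / real n * (1 / 2)" using n by simp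
    finally show ?thesis by linarith
  qed
  finally show ?case .
qed

end

text \<open>A discrete Gronwall inequality: the sum of c / m over a \<le> m < n is c ln (n / a) up
  to a bounded error.\<close>

lemma growth_bound:
  fixes x :: "nat \<Rightarrow> real"
  assumes a: "1 \<le> a" "a \<le> n" and c: "0 \<le> c" and x: "0 \<le> x a"
    and step: "\<And>m. a \<le> m \<Longrightarrow> m < n \<Longrightarrow> x (Suc m) \<le> (1 + c / real m) * x m"
  shows "x n \<le> exp c * (real n / real a) powr c * x a"
proof -
  have "x m \<le> exp (c / real a - c / real m) * (real m / real a) powr c * x a" if "a \<le> m" "m \<le> n" for m
    using that
  proof (induction m rule: dec_induct)
    case base
    then show ?case using a by simp
  next
    case (step m)
    have m: "real m \<ge> 1" using step a by auto
    have e1: "1 + c / real m \<le> exp (c / real m)" by (rule exp_ge_add_one_self)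
    have e2: "exp (c / real (Suc m)) \<le> (real (Suc m) / real m) powr c"
    proof -
      have "real m / real (Suc m) = 1 + - 1 / real (Suc m)" by (simp add: field_simps)
      also have "\<dots> \<le> exp (- 1 / real (Suc m))" by (rule exp_ge_add_one_self)
      finally have "exp (1 / real (Suc m)) \<le> real (Suc m) / real m"
        using m by (simp add: exp_minus field_simps)
      then have "exp (1 / real (Suc m)) powr c \<le> (real (Suc m) / real m) powr c"
        using c by (intro powr_mono2) auto
      then show ?thesis by (simp add: powr_def)
    qed
    have "x (Suc m) \<le> (1 + c / real m) * x m" using step assms(5) by auto
    also have "\<dots> \<le> (1 + c / real m) * (exp (c / real a - c / real m) * (real m / real a) powr c * x a)"
      using step c by (intro mult_left_mono) auto
    also have "\<dots> \<le> exp (c / real m) * (exp (c / real a - c / real m) * (real m / real a) powr c * x a)"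
      using x by (intro mult_right_mono e1) auto
    also have "\<dots> = exp (c / real a) * (real m / real a) powr c * x a"
      by (simp add: exp_diff)
    also have "\<dots> = exp (c / real a - c / real (Suc m)) * exp (c / real (Suc m)) * (real m / real a) powr c * x a"
      by (simp add: exp_diff)
    also have "\<dots> \<le> exp (c / real a - c / real (Suc m)) * (real (Suc m) / real m) powr c * (real m / real a) powr c * x a"
      using x by (intro mult_right_mono mult_left_mono e2) auto
    also have "\<dots> = exp (c / real a - c / real (Suc m)) * (real (Suc m) / real a) powr c * x a"
      using m a by (simp add: powr_divide)
    finally show ?case .
  qed
  from this[OF a(2) order_refl] have "x n \<le> exp (c / real a - c / real n) * (real n / real a) powr c * x a" .
  also have "\<dots> \<le> exp c * (real n / real a) powr c * x a"
  proof (intro mult_right_mono)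
    have "c / real a \<le> c" using a c by (simp add: divide_le_eq mult_le_cancel_left1)
    moreover have "0 \<le> c / real n" using c by simp
    ultimately show "exp (c / real a - c / real n) \<le> exp c" by simp
  qed (use x in auto)
  finally show ?thesis .
qed

lemma power_le_pochhammer:
  fixes x :: real
  assumes "0 \<le> x"
  shows "x ^ r \<le> pochhammer x r"
  using prod_mono[of "{0..<r}" "\<lambda>_. x" "\<lambda>i. x + real i"] assms by (simp add: pochhammer_prod)

section \<open>Moments of the indegree and joint moments with one edge\<close>

context
  fixes f :: "nat \<Rightarrow> real" and \<gamma> :: real
  assumes att: "attachment_function f" and \<gamma>: "0 < \<gamma>" "\<gamma> < 1 / 2"
    and f_le: "\<And>k. f k \<le> \<gamma> * real k + 1"
begin

text \<open>
  The rising factorials of \<open>degree + 1 / \<gamma>\<close> are adapted to the chain: if the bound on \<open>f\<close>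
  were an equality, each step would multiply their expectations by \<open>1 + r * \<gamma> / m\<close>.
\<close>

definition rising :: "nat \<Rightarrow> nat \<Rightarrow> nat set \<Rightarrow> real" where
  "rising j r A = pochhammer (real (card (A - {j})) + 1 / \<gamma>) r"

lemma rising_nonneg: "0 \<le> rising j r A"
  unfolding rising_def using \<gamma> by (intro pochhammer_nonneg) (simp add: add_nonneg_pos)

text \<open>The shift 1 / \<gamma> is at least 1, which absorbs the vertex \<open>j\<close> in its
  own set.\<close>

lemma card_power_le_rising:
  assumes "finite A"
  shows "real (card A) ^ r \<le> rising j r A"
proof -
  have "card A \<le> card (insert j (A - {j}))"
    using assms by (intro card_mono) auto
  also have "\<dots> = card (A - {j}) + 1"
    using assms by (subst card_insert_disjoint) auto
  finally have "card A \<le> card (A - {j}) + 1" .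
  moreover have "1 \<le> 1 / \<gamma>" using \<gamma> by (simp add: field_simps)
  ultimately have "real (card A) \<le> real (card (A - {j})) + 1 / \<gamma>" by linarith
  then have "real (card A) ^ r \<le> (real (card (A - {j})) + 1 / \<gamma>) ^ r" by (intro power_mono) auto
  also have "\<dots> \<le> rising j r A"
    unfolding rising_def using \<gamma> by (intro power_le_pochhammer) auto
  finally show ?thesis .
qed

text \<open>\<open>f d\<close> is at most \<gamma> times d + 1 / \<gamma>, and this is the missing
  first factor of the rising factorial. Weighting with an edge probability thus raises the order by
  one.\<close>

lemma f_mult_pochhammer:
  "f d * pochhammer (real (Suc d) + 1 / \<gamma>) r \<le> \<gamma> * pochhammer (real d + 1 / \<gamma>) (Suc r)"
proof -
  have "\<gamma> * (real d + 1 / \<gamma>) = \<gamma> * real d + 1" using \<gamma> by (simp add: distrib_left)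
  then have "f d \<le> \<gamma> * (real d + 1 / \<gamma>)" using f_le[of d] by simp
  moreover have "0 \<le> pochhammer (real (Suc d) + 1 / \<gamma>) r"
    using \<gamma> by (intro pochhammer_nonneg) (simp add: add_pos_pos)
  ultimately have "f d * pochhammer (real (Suc d) + 1 / \<gamma>) r
      \<le> \<gamma> * (real d + 1 / \<gamma>) * pochhammer (real (Suc d) + 1 / \<gamma>) r"
    by (intro mult_right_mono)
  then show ?thesis by (simp add: pochhammer_rec add_ac)
qed

text \<open>The difference identity u ((u + 1)_r - (u)_r) = r (u)_r for rising factorials cancels
  the linear growth of \<open>f\<close>. The weight \<open>\<psi>\<close>, unaffected by the new
  edge, will be the indicator of an earlier edge.\<close>

lemma expect_rising_Suc:
  assumes j: "1 \<le> j" "j \<le> m" and \<psi>: "\<And>A. 0 \<le> \<psi> A" "\<And>A. \<psi> (insert j (insert (Suc m) A)) = \<psi> A"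
  shows "expect (hits f j (Suc m)) (\<lambda>A. \<psi> A * rising j r A)
    \<le> (1 + real r * \<gamma> / real m) * expect (hits f j m) (\<lambda>A. \<psi> A * rising j r A)"
proof -
  have "expect (hits f j (Suc m)) (\<lambda>A. \<psi> A * rising j r A)
      \<le> expect (hits f j m) (\<lambda>A. (1 + real r * \<gamma> / real m) * (\<psi> A * rising j r A))"
    unfolding expect_hits_Suc[OF att j] \<psi>(2)
  proof (rule expect_mono_finite[OF finite_set_hits])
    fix A assume A: "A \<in> set_pmf (hits f j m)"
    define d where "d = card (A - {j})"
    define u where "u = real d + 1 / \<gamma>"
    have u: "0 < u" using \<gamma> by (simp add: u_def add_nonneg_pos)
    have "\<gamma> * u = \<gamma> * real d + 1" using \<gamma> by (simp add: u_def distrib_left)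
    then have fd: "0 \<le> f d" "f d \<le> \<gamma> * u"
      using att f_le[of d] by (auto simp: attachment_function_def less_imp_le)
    have p: "pochhammer u r \<le> pochhammer (u + 1) r"
      unfolding pochhammer_prod using u by (intro prod_mono) auto
    have key: "u * (pochhammer (u + 1) r - pochhammer u r) = real r * pochhammer u r"
      using pochhammer_rec[of u r] pochhammer_rec'[of u r] by (simp add: algebra_simps)
    have "f d * (pochhammer (u + 1) r - pochhammer u r) \<le> \<gamma> * u * (pochhammer (u + 1) r - pochhammer u r)"
      using fd p by (intro mult_right_mono) auto
    also have "\<dots> = real r * \<gamma> * pochhammer u r" using key by (simp add: mult_ac)
    finally have "f d * (pochhammer (u + 1) r - pochhammer u r) / real m \<le> real r * \<gamma> * pochhammer u r / real m"
      by (intro divide_right_mono) auto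
    then have "f d / real m * pochhammer (u + 1) r + (1 - f d / real m) * pochhammer u r
        \<le> (1 + real r * \<gamma> / real m) * pochhammer u r"
      by (simp add: algebra_simps diff_divide_distrib)
    then have "\<psi> A * (f d / real m * pochhammer (u + 1) r + (1 - f d / real m) * pochhammer u r)
        \<le> \<psi> A * ((1 + real r * \<gamma> / real m) * pochhammer u r)"
      by (intro mult_left_mono \<psi>)
    moreover have "rising j r A = pochhammer u r"
      "rising j r (insert j (insert (Suc m) A)) = pochhammer (u + 1) r"
      using card_insert_hits[OF att A j(2)] by (simp_all add: rising_def u_def d_def add_ac)
    ultimately show "f (card (A - {j})) / real m * (\<psi> A * rising j r (insert j (insert (Suc m) A)))
        + (1 - f (card (A - {j})) / real m) * (\<psi> A * rising j r A)
        \<le> (1 + real r * \<gamma> / real m) * (\<psi> A * rising j r A)"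
      unfolding d_def[symmetric] by (simp add: algebra_simps)
  qed
  then show ?thesis by simp
qed

lemma expect_rising_growth:
  assumes j: "1 \<le> j" "j \<le> k" "k \<le> n" and \<psi>: "\<And>A. 0 \<le> \<psi> A"
    "\<And>m A. k \<le> m \<Longrightarrow> \<psi> (insert j (insert (Suc m) A)) = \<psi> A"
  shows "expect (hits f j n) (\<lambda>A. \<psi> A * rising j r A)
    \<le> exp (real r * \<gamma>) * (real n / real k) powr (real r * \<gamma>) * expect (hits f j k) (\<lambda>A. \<psi> A * rising j r A)"
proof (rule growth_bound)
  show "0 \<le> expect (hits f j k) (\<lambda>A. \<psi> A * rising j r A)"
    by (intro Bochner_Integration.integral_nonneg mult_nonneg_nonneg \<psi>(1) rising_nonneg)
  show "expect (hits f j (Suc m)) (\<lambda>A. \<psi> A * rising j r A)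
      \<le> (1 + real r * \<gamma> / real m) * expect (hits f j m) (\<lambda>A. \<psi> A * rising j r A)" if "k \<le> m" for m
    using that j by (intro expect_rising_Suc \<psi>) auto
qed (use j \<gamma> in auto)

lemma expect_rising_le:
  assumes j: "1 \<le> j" "j \<le> n"
  shows "expect (hits f j n) (rising j r)
    \<le> exp (real r * \<gamma>) * (real n / real j) powr (real r * \<gamma>) * pochhammer (1 / \<gamma>) r"
  using expect_rising_growth[OF j(1) order_refl j(2), of "\<lambda>_. 1" r]
  by (simp add: hits_trivial rising_def[abs_def])

lemma expect_edge_rising_at:
  assumes j: "1 \<le> j" "j \<le> m"
  shows "expect (hits f j (Suc m)) (\<lambda>A. of_bool (Suc m \<in> A) * \<xi> A)
    = expect (hits f j m) (\<lambda>A. f (card (A - {j})) / real m * \<xi> (insert j (insert (Suc m) A)))"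
  unfolding expect_hits_Suc[OF att j]
  \<comment> \<open>At time \<open>m\<close> the set cannot contain \<open>Suc m\<close>, so the
    branch without insertion contributes 0.\<close>
  by (rule expect_cong) (use set_hits j in fastforce)

text \<open>Order r + 1 is propagated from j up to k - 1, the edge from k costs a factor \<gamma> /
  (k - 1), and order r is propagated from k to n. The powers of n / k and k / j then
  combine.\<close>

lemma expect_edge_rising_le:
  assumes j: "1 \<le> j" "j < k" "k \<le> n"
  shows "expect (hits f j n) (\<lambda>A. of_bool (k \<in> A) * rising j r A)
    \<le> 2 * exp (real (2 * r + 1) * \<gamma>) * pochhammer (1 / \<gamma>) (Suc r)
      * ((real n / real j) powr (real r * \<gamma>) * ((real k / real j) powr \<gamma> / real k))"
proof -
  obtain m where m: "k = Suc m" "j \<le> m" using j by (cases k) auto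
  have m1: "1 \<le> real m" using m j by auto
  let ?E = "exp (real (Suc r) * \<gamma>) * (real m / real j) powr (real (Suc r) * \<gamma>) * pochhammer (1 / \<gamma>) (Suc r)"
  have poch: "0 \<le> pochhammer (1 / \<gamma>) (Suc r)" using \<gamma> by (intro pochhammer_nonneg) auto
  have "expect (hits f j k) (\<lambda>A. of_bool (k \<in> A) * rising j r A)
      = expect (hits f j m) (\<lambda>A. f (card (A - {j})) / real m * rising j r (insert j (insert (Suc m) A)))"
    unfolding m by (rule expect_edge_rising_at) (use j m in auto)
  also have "\<dots> \<le> expect (hits f j m) (\<lambda>A. \<gamma> / real m * rising j (Suc r) A)"
  proof (rule expect_mono_finite[OF finite_set_hits])
    fix A assume A: "A \<in> set_pmf (hits f j m)"
    have "f (card (A - {j})) * rising j r (insert j (insert (Suc m) A)) / real m \<le> \<gamma> * rising j (Suc r) A / real m"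
      unfolding rising_def card_insert_hits[OF att A m(2)]
      by (intro divide_right_mono f_mult_pochhammer) auto
    then show "f (card (A - {j})) / real m * rising j r (insert j (insert (Suc m) A)) \<le> \<gamma> / real m * rising j (Suc r) A"
      by simp
  qed
  also have "\<dots> = \<gamma> / real m * expect (hits f j m) (rising j (Suc r))" by simp
  also have "\<dots> \<le> \<gamma> / real m * ?E"
    using \<gamma> by (intro mult_left_mono expect_rising_le j m) auto
  also have "\<dots> \<le> 2 / real k * (exp (real (Suc r) * \<gamma>) * (real k / real j) powr (real (Suc r) * \<gamma>) * pochhammer (1 / \<gamma>) (Suc r))"
  proof (intro mult_mono powr_mono2 divide_right_mono poch mult_nonneg_nonneg)
    have "\<gamma> * real k \<le> 1 * real k" using \<gamma> by (intro mult_right_mono) auto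
    then show "\<gamma> / real m \<le> 2 / real k" using m m1 \<gamma> by (simp add: field_simps)
  qed (use \<gamma> m in auto)
  finally have at_k: "expect (hits f j k) (\<lambda>A. of_bool (k \<in> A) * rising j r A)
      \<le> 2 / real k * (exp (real (Suc r) * \<gamma>) * (real k / real j) powr (real (Suc r) * \<gamma>) * pochhammer (1 / \<gamma>) (Suc r))" .
  have "expect (hits f j n) (\<lambda>A. of_bool (k \<in> A) * rising j r A)
      \<le> exp (real r * \<gamma>) * (real n / real k) powr (real r * \<gamma>) * expect (hits f j k) (\<lambda>A. of_bool (k \<in> A) * rising j r A)"
    by (rule expect_rising_growth) (use j in auto)
  also have "\<dots> \<le> exp (real r * \<gamma>) * (real n / real k) powr (real r * \<gamma>)
      * (2 / real k * (exp (real (Suc r) * \<gamma>) * (real k / real j) powr (real (Suc r) * \<gamma>) * pochhammer (1 / \<gamma>) (Suc r)))"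
    by (intro mult_left_mono at_k) auto
  also have "\<dots> = 2 * (exp (real r * \<gamma>) * exp (real (Suc r) * \<gamma>)) * pochhammer (1 / \<gamma>) (Suc r)
      * ((real n / real k) powr (real r * \<gamma>) * (real k / real j) powr (real (Suc r) * \<gamma>) / real k)"
    by (simp add: mult_ac)
  also have "exp (real r * \<gamma>) * exp (real (Suc r) * \<gamma>) = exp (real (2 * r + 1) * \<gamma>)"
    by (simp add: exp_add[symmetric] algebra_simps)
  also have "(real n / real k) powr (real r * \<gamma>) * (real k / real j) powr (real (Suc r) * \<gamma>)
      = (real n / real j) powr (real r * \<gamma>) * (real k / real j) powr \<gamma>"
    using j by (simp add: powr_divide powr_add algebra_simps)
  finally show ?thesis by (simp add: mult_ac)
qed

text \<open>Keeps the covering probabilities away from 1, as \<open>prod_not_covered_ge\<close>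
  requires. Only the edge from 2 to 1 needs f 0 < 1: for m \<ge> 2 the indegree is at most m - 1,
  and (m + 1) / 2 \<le> 3 m / 4.\<close>

lemma expect_edge_le:
  assumes f0: "f 0 < 1" and j: "1 \<le> j" "j < k" "k \<le> n"
  shows "expect (hits f j n) (\<lambda>A. of_bool (k \<in> A)) \<le> max (3 / 4) (f 0)"
proof -
  obtain m where m: "k = Suc m" "j \<le> m" using j by (cases k) auto
  have m1: "1 \<le> m" using m j by auto
  \<comment> \<open>Order 0 of the growth estimate: after time \<open>k\<close> the probability of
    this edge no longer increases.\<close>
  have "expect (hits f j n) (\<lambda>A. of_bool (k \<in> A)) \<le> expect (hits f j k) (\<lambda>A. of_bool (k \<in> A))"
    using expect_rising_growth[of j k n "\<lambda>A. of_bool (k \<in> A)" 0] j by (simp add: rising_def)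
  also have "\<dots> = expect (hits f j m) (\<lambda>A. f (card (A - {j})) / real m)"
    using expect_edge_rising_at[OF j(1) m(2), of "\<lambda>_. 1"] m by simp
  also have "\<dots> \<le> expect (hits f j m) (\<lambda>_. max (3 / 4) (f 0))"
  proof (rule expect_mono_finite[OF finite_set_hits])
    fix A assume A: "A \<in> set_pmf (hits f j m)"
    have "card (A - {j}) \<le> card {j<..m}" using set_hits[OF A] by (intro card_mono) auto
    then have d: "card (A - {j}) \<le> m - 1" using j by simp
    show "f (card (A - {j})) / real m \<le> max (3 / 4) (f 0)"
    proof (cases "m = 1")
      case True
      then show ?thesis using d by simp
    next
      case False
      have "f (card (A - {j})) \<le> \<gamma> * real (card (A - {j})) + 1" by (rule f_le)
      also have "\<dots> \<le> 1 / 2 * (real m - 1) + 1"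
        using \<gamma> d m1 by (intro add_right_mono mult_mono) auto
      also have "\<dots> \<le> 3 / 4 * real m"
      proof -
        have "2 \<le> real m" using False m1 by simp
        moreover have "1 / 2 * (real m - 1) + 1 = real m / 2 + 1 / 2" by (simp add: field_simps)
        ultimately show ?thesis by linarith
      qed
      finally have "f (card (A - {j})) / real m \<le> 3 / 4" using m1 by (simp add: field_simps)
      then show ?thesis by (rule max.coboundedI1)
    qed
  qed
  also have "\<dots> = max (3 / 4) (f 0)" by simp
  finally show ?thesis .
qed

lemma hits_moments:
  obtains C where "C \<ge> 1"
    "\<And>j n r. 1 \<le> j \<Longrightarrow> j \<le> n \<Longrightarrow> r \<le> 4 \<Longrightarrow>
      expect (hits f j n) (\<lambda>A. real (card A) ^ r) \<le> C * (real n / real j) powr (real r * \<gamma>)"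
    "\<And>j k n r. 1 \<le> j \<Longrightarrow> j < k \<Longrightarrow> k \<le> n \<Longrightarrow> r \<le> 4 \<Longrightarrow>
      expect (hits f j n) (\<lambda>A. of_bool (k \<in> A) * real (card A) ^ r)
        \<le> C * ((real n / real j) powr (real r * \<gamma>) * ((real k / real j) powr \<gamma> / real k))"
proof -
  define c1 where "c1 = (\<lambda>r::nat. exp (real r * \<gamma>) * pochhammer (1 / \<gamma>) r)"
  define c2 where "c2 = (\<lambda>r::nat. 2 * exp (real (2 * r + 1) * \<gamma>) * pochhammer (1 / \<gamma>) (Suc r))"
  define C where "C = 1 + (\<Sum>r\<le>4. c1 r + c2 r)"
  have nn: "0 \<le> c1 r" "0 \<le> c2 r" for r
    using \<gamma> by (auto simp: c1_def c2_def intro!: mult_nonneg_nonneg pochhammer_nonneg)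
  have "c1 r + c2 r \<le> C - 1" if "r \<le> 4" for r
    unfolding C_def using member_le_sum[of r "{..4}" "\<lambda>r. c1 r + c2 r"] that nn by (auto intro: add_nonneg_nonneg)
  then have le: "c1 r \<le> C" "c2 r \<le> C" if "r \<le> 4" for r
    using that nn[of r] by force+
  have fin: "finite A" if "A \<in> set_pmf (hits f j n)" for A j n
    using set_hits[OF that] by (auto intro: finite_subset)
  show ?thesis
  proof (rule that)
    show "C \<ge> 1" unfolding C_def using nn by (simp add: sum_nonneg)
  next
    fix j n r :: nat assume j: "1 \<le> j" "j \<le> n" and r: "r \<le> 4"
    have "expect (hits f j n) (\<lambda>A. real (card A) ^ r) \<le> expect (hits f j n) (rising j r)"
      by (rule expect_mono_finite[OF finite_set_hits]) (auto intro: card_power_le_rising fin)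
    also have "\<dots> \<le> c1 r * (real n / real j) powr (real r * \<gamma>)"
      using expect_rising_le[OF j, of r] by (simp add: c1_def mult_ac)
    also have "\<dots> \<le> C * (real n / real j) powr (real r * \<gamma>)"
      by (intro mult_right_mono le r) auto
    finally show "expect (hits f j n) (\<lambda>A. real (card A) ^ r) \<le> C * (real n / real j) powr (real r * \<gamma>)" .
  next
    fix j k n r :: nat assume j: "1 \<le> j" "j < k" "k \<le> n" and r: "r \<le> 4"
    have "expect (hits f j n) (\<lambda>A. of_bool (k \<in> A) * real (card A) ^ r)
        \<le> expect (hits f j n) (\<lambda>A. of_bool (k \<in> A) * rising j r A)"
      by (rule expect_mono_finite[OF finite_set_hits])
         (auto intro!: mult_left_mono intro: card_power_le_rising fin)
    also have "\<dots> \<le> c2 r * ((real n / real j) powr (real r * \<gamma>) * ((real k / real j) powr \<gamma> / real k))"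
      unfolding c2_def by (rule expect_edge_rising_le[OF j])
    also have "\<dots> \<le> C * ((real n / real j) powr (real r * \<gamma>) * ((real k / real j) powr \<gamma> / real k))"
      by (intro mult_right_mono le r) auto
    finally show "expect (hits f j n) (\<lambda>A. of_bool (k \<in> A) * real (card A) ^ r)
        \<le> C * ((real n / real j) powr (real r * \<gamma>) * ((real k / real j) powr \<gamma> / real k))" .
  qed
qed

end

section \<open>Bounds under polynomial growth of the moments\<close>

text \<open>Comparison with the integral of x powr -s, termwise by the mean value theorem. Together
  with the logarithmic and the convergent case below it provides the three regimes.\<close>

lemma sum_powr_less_1:
  assumes s: "0 \<le> s" "s < 1"
  shows "(\<Sum>i=1..n. real i powr - s) \<le> real n powr (1 - s) / (1 - s)"
proof (induction n)
  case 0
  then show ?case by simp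
next
  case (Suc n)
  have step: "(1 - s) * real (Suc n) powr - s \<le> real (Suc n) powr (1 - s) - real n powr (1 - s)"
  proof (cases "n = 0")
    case True
    then show ?thesis using s by simp
  next
    case False
    then have n: "0 < real n" by simp
    obtain z where z: "real n < z" "z < real (Suc n)"
      and eq: "real (Suc n) powr (1 - s) - real n powr (1 - s) = (real (Suc n) - real n) * ((1 - s) * z powr (1 - s - 1))"
      using MVT2[of "real n" "real (Suc n)" "\<lambda>x. x powr (1 - s)" "\<lambda>x. (1 - s) * x powr (1 - s - 1)"]
        n has_real_derivative_powr[of _ "1 - s"] by force
    have "real (Suc n) powr - s \<le> z powr - s"
      using z n s by (intro powr_mono2') auto
    then show ?thesis using eq s by (simp add: mult_left_mono)
  qed
  then have "real (Suc n) powr - s \<le> (real (Suc n) powr (1 - s) - real n powr (1 - s)) / (1 - s)"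
    using s by (simp add: field_simps)
  then show ?case using Suc.IH by (simp add: diff_divide_distrib)
qed

lemma sum_powr_eq_1:
  assumes "1 \<le> n"
  shows "(\<Sum>i=1..n. real i powr - 1) \<le> 1 + ln (real n)"
  using assms
proof (induction n rule: dec_induct)
  case base
  then show ?case by simp
next
  case (step n)
  have n: "0 < real n" using step by simp
  have "ln (real n / real (Suc n)) \<le> real n / real (Suc n) - 1"
    using n by (intro ln_le_minus_one) simp
  then have "real (Suc n) powr - 1 \<le> ln (real (Suc n)) - ln (real n)"
    using n by (simp add: ln_div powr_minus field_simps)
  then show ?case using step by simp
qed

lemma sum_powr_greater_1:
  assumes "1 < s"
  shows "(\<Sum>i=1..n. real i powr - s) \<le> (\<Sum>i. real i powr - s)"
  using assms summable_real_powr_iff[of "- s"] by (intro sum_le_suminf) auto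

text \<open>Isolates what the estimates use of the graph: the sets point upwards, and their moments
  grow polynomially, also jointly with the indicator of one point.\<close>

locale scaled_cover = random_cover "{1..n}" "{1..n}" p for n :: nat and p :: "nat \<Rightarrow> nat set pmf" +
  fixes \<gamma> C :: real
  assumes n: "1 \<le> n" and \<gamma>: "0 < \<gamma>" "\<gamma> < 1 / 2" and C: "1 \<le> C"
    and supp_ge: "\<And>j A. j \<in> {1..n} \<Longrightarrow> A \<in> set_pmf (p j) \<Longrightarrow> A \<subseteq> {j..n}"
    and moment: "\<And>j r. 1 \<le> j \<Longrightarrow> j \<le> n \<Longrightarrow> r \<le> 4 \<Longrightarrow>
      expect (p j) (\<lambda>A. real (card A) ^ r) \<le> C * (real n / real j) powr (real r * \<gamma>)"
    and edge_moment: "\<And>j k r. 1 \<le> j \<Longrightarrow> j < k \<Longrightarrow> k \<le> n \<Longrightarrow> r \<le> 4 \<Longrightarrow>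
      expect (p j) (\<lambda>A. of_bool (k \<in> A) * real (card A) ^ r)
        \<le> C * ((real n / real j) powr (real r * \<gamma>) * ((real k / real j) powr \<gamma> / real k))"
begin

definition \<mu> :: "nat \<Rightarrow> real" where
  "\<mu> j = expect (p j) (\<lambda>A. real (card A))"

lemma sum_of_bool_card:
  assumes "j \<in> {1..n}" "A \<in> set_pmf (p j)"
  shows "(\<Sum>k\<in>{1..n}. of_bool (k \<in> A) :: real) = real (card A)"
proof -
  have "A \<subseteq> {1..n}" using supp assms by auto
  then have "{k \<in> {1..n}. k \<in> A} = A" by auto
  then show ?thesis by (simp add: of_bool_def sum.inter_filter[symmetric])
qed

lemma sum_q: "j \<in> {1..n} \<Longrightarrow> (\<Sum>k\<in>{1..n}. q k j) = \<mu> j"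
proof -
  assume j: "j \<in> {1..n}"
  have "\<mu> j = expect (p j) (\<lambda>A. \<Sum>k\<in>{1..n}. of_bool (k \<in> A))"
    unfolding \<mu>_def by (rule expect_cong) (simp only: sum_of_bool_card[OF j])
  also have "\<dots> = (\<Sum>k\<in>{1..n}. q k j)"
    unfolding q_def by (rule Bochner_Integration.integral_sum) (simp add: integrable_p[OF j])
  finally show ?thesis by simp
qed

lemma V_eq:
  assumes "j \<in> {1..n}" "A \<in> set_pmf (p j)"
  shows "V j A = real (card A) + \<mu> j"
  unfolding V_def a_def sum.distrib using assms by (simp only: sum_of_bool_card sum_q)

lemma \<mu>_nonneg: "0 \<le> \<mu> j"
  unfolding \<mu>_def by (intro Bochner_Integration.integral_nonneg) simp

lemma \<mu>_le:
  assumes "1 \<le> j" "j \<le> n"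
  shows "\<mu> j \<le> C * (real n / real j) powr \<gamma>"
  using moment[OF assms, of 1] by (simp add: \<mu>_def)

lemma V_moment:
  assumes j: "1 \<le> j" "j \<le> n" and r: "r \<le> 4"
  shows "expect (p j) (\<lambda>A. V j A ^ r) \<le> 32 * C ^ 4 * (real n / real j) powr (real r * \<gamma>)"
proof -
  let ?N = "(real n / real j) powr (real r * \<gamma>)"
  have jI: "j \<in> {1..n}" using j by auto
  \<comment> \<open>The factor 16 is 2 powr 4 and serves all orders up to 4 at once.\<close>
  have pow: "(x + y) ^ r \<le> 16 * (x ^ r + y ^ r)" if "0 \<le> x" "0 \<le> y" for x y :: real
  proof -
    have "(x + y) ^ r \<le> (2 * max x y) ^ r" using that by (intro power_mono) auto
    also have "\<dots> = 2 ^ r * max x y ^ r" by (simp add: power_mult_distrib)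
    also have "\<dots> \<le> 2 ^ 4 * (x ^ r + y ^ r)"
      using that r by (intro mult_mono power_increasing) (auto simp: max_def)
    finally show ?thesis by simp
  qed
  have "expect (p j) (\<lambda>A. V j A ^ r) \<le> expect (p j) (\<lambda>A. 16 * (real (card A) ^ r + \<mu> j ^ r))"
    by (rule expect_mono_finite[OF finite_supp[OF jI]]) (simp only: V_eq[OF jI] pow \<mu>_nonneg of_nat_0_le_iff)
  also have "\<dots> = 16 * (expect (p j) (\<lambda>A. real (card A) ^ r) + \<mu> j ^ r)"
    using jI by (simp add: integrable_p)
  also have "\<dots> \<le> 16 * (C ^ 4 * ?N + C ^ 4 * ?N)"
  proof (intro mult_left_mono add_mono)
    have "expect (p j) (\<lambda>A. real (card A) ^ r) \<le> C * ?N" by (rule moment[OF j r])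
    also have "\<dots> \<le> C ^ 4 * ?N"
      using C power_increasing[of 1 4 C] by (intro mult_right_mono) auto
    finally show "expect (p j) (\<lambda>A. real (card A) ^ r) \<le> C ^ 4 * ?N" .
    have "\<mu> j ^ r \<le> (C * (real n / real j) powr \<gamma>) ^ r"
      by (intro power_mono \<mu>_le j \<mu>_nonneg)
    also have "\<dots> = C ^ r * ?N"
      using j by (simp add: power_mult_distrib powr_powr mult.commute flip: powr_realpow)
    also have "\<dots> \<le> C ^ 4 * ?N"
      using C r by (intro mult_right_mono power_increasing) auto
    finally show "\<mu> j ^ r \<le> C ^ 4 * ?N" .
  qed auto
  finally show ?thesis by simp
qed

lemma q_le:
  assumes "1 \<le> j" "j < k" "k \<le> n"
  shows "q k j \<le> C * ((real k / real j) powr \<gamma> / real k)"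
  using edge_moment[OF assms, of 0] assms by (simp add: q_def)

lemma q_eq_0:
  assumes "j \<in> {1..n}" "k < j"
  shows "q k j = 0"
proof -
  have "q k j = expect (p j) (\<lambda>_. 0)"
    unfolding q_def by (rule expect_cong) (use supp_ge[OF assms(1)] assms(2) in fastforce)
  then show ?thesis by simp
qed

text \<open>V * a is the product of |A| + \<mu> with indicator + q. In the first moment the three
  products other than indicator times |A| each have mean \<mu> q. For the square, each factor is
  split by (x + y)^2 \<le> 2 (x^2 + y^2), and q^2 \<le> q keeps a single factor \<tau>.\<close>

lemma Va_moments:
  assumes j: "1 \<le> j" "j < k" "k \<le> n"
  defines "\<tau> \<equiv> (real k / real j) powr \<gamma> / real k"
  shows "expect (p j) (\<lambda>A. V j A * a k j A) \<le> 4 * C\<^sup>2 * ((real n / real j) powr \<gamma> * \<tau>)"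
    and "expect (p j) (\<lambda>A. (V j A * a k j A)\<^sup>2) \<le> 16 * C ^ 3 * ((real n / real j) powr (2 * \<gamma>) * \<tau>)"
proof -
  let ?N = "(real n / real j) powr \<gamma>"
  let ?b = "\<lambda>A. of_bool (k \<in> A) :: real"
  let ?X = "\<lambda>A::nat set. real (card A)"
  have jI: "j \<in> {1..n}" and jn: "j \<le> n" using j by auto
  note [simp] = integrable_p[OF jI]
  have N: "0 \<le> ?N" and \<tau>: "0 \<le> \<tau>" by (auto simp: \<tau>_def)
  have N2: "(real n / real j) powr (2 * \<gamma>) = ?N\<^sup>2"
    using j by (simp add: powr_powr mult.commute flip: powr_realpow)
  have q: "0 \<le> q k j" "q k j \<le> 1" "q k j \<le> C * \<tau>"
    using q_nonneg q_le_1[OF jI] q_le[OF j] by (auto simp: \<tau>_def)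
  have \<mu>: "0 \<le> \<mu> j" "\<mu> j \<le> C * ?N" using \<mu>_nonneg \<mu>_le[OF j(1) jn] by auto
  have m1: "expect (p j) (\<lambda>A. ?b A * ?X A) \<le> C * (?N * \<tau>)"
    using edge_moment[OF j, of 1] by (simp add: \<tau>_def)
  have m2: "expect (p j) (\<lambda>A. ?b A * ?X A ^ 2) \<le> C * (?N\<^sup>2 * \<tau>)"
    using edge_moment[OF j, of 2] by (simp add: \<tau>_def N2)
  have X2: "expect (p j) (\<lambda>A. ?X A ^ 2) \<le> C * ?N\<^sup>2"
    using moment[OF j(1) jn, of 2] by (simp add: N2)
  have C2: "C \<le> C\<^sup>2" "C \<le> C ^ 3" "C\<^sup>2 \<le> C ^ 3"
    using C power_increasing[of 1 2 C] power_increasing[of 1 3 C] power_increasing[of 2 3 C] by auto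
  have qb: "expect (p j) ?b = q k j" by (simp add: q_def)
  have qN: "\<mu> j * q k j \<le> C\<^sup>2 * (?N * \<tau>)"
  proof -
    have "\<mu> j * q k j \<le> (C * ?N) * (C * \<tau>)" using \<mu> q C N \<tau> by (intro mult_mono) auto
    then show ?thesis by (simp add: power2_eq_square mult_ac)
  qed
  have "expect (p j) (\<lambda>A. V j A * a k j A) = expect (p j) (\<lambda>A. ?b A * ?X A + \<mu> j * ?b A + q k j * ?X A + \<mu> j * q k j)"
    by (rule expect_cong) (simp only: V_eq[OF jI] a_def, simp add: algebra_simps)
  also have "\<dots> = expect (p j) (\<lambda>A. ?b A * ?X A) + 3 * (\<mu> j * q k j)"
    by (simp add: qb \<mu>_def[symmetric])
  also have "\<dots> \<le> C\<^sup>2 * (?N * \<tau>) + 3 * (C\<^sup>2 * (?N * \<tau>))"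
  proof (intro add_mono mult_left_mono qN)
    have "C * (?N * \<tau>) \<le> C\<^sup>2 * (?N * \<tau>)" using C2 N \<tau> by (intro mult_right_mono) auto
    then show "expect (p j) (\<lambda>A. ?b A * ?X A) \<le> C\<^sup>2 * (?N * \<tau>)" using m1 by linarith
  qed auto
  finally show "expect (p j) (\<lambda>A. V j A * a k j A) \<le> 4 * C\<^sup>2 * (?N * \<tau>)" by (simp add: mult_ac)
  have "expect (p j) (\<lambda>A. (V j A * a k j A)\<^sup>2)
      \<le> expect (p j) (\<lambda>A. 4 * (?b A * ?X A ^ 2 + (\<mu> j)\<^sup>2 * ?b A + q k j * ?X A ^ 2 + (\<mu> j)\<^sup>2 * q k j))"
  proof (rule expect_mono_finite[OF finite_supp[OF jI]])
    fix A assume A: "A \<in> set_pmf (p j)"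
    have sq: "(x + y)\<^sup>2 \<le> 2 * (x\<^sup>2 + y\<^sup>2)" for x y :: real
      using zero_le_power2[of "x - y"] by (simp add: power2_eq_square algebra_simps)
    have "(a k j A)\<^sup>2 \<le> 2 * ((?b A)\<^sup>2 + (q k j)\<^sup>2)" unfolding a_def by (rule sq)
    also have "\<dots> \<le> 2 * (?b A + q k j)"
      using q mult_left_le[of "q k j" "q k j"] by (cases "k \<in> A") (auto simp: power2_eq_square)
    finally have "(V j A)\<^sup>2 * (a k j A)\<^sup>2 \<le> 2 * (?X A ^ 2 + (\<mu> j)\<^sup>2) * (2 * (?b A + q k j))"
      using q unfolding V_eq[OF jI A] by (intro mult_mono sq) auto
    then show "(V j A * a k j A)\<^sup>2 \<le> 4 * (?b A * ?X A ^ 2 + (\<mu> j)\<^sup>2 * ?b A + q k j * ?X A ^ 2 + (\<mu> j)\<^sup>2 * q k j)"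
      by (simp add: power_mult_distrib algebra_simps)
  qed
  also have "\<dots> = 4 * (expect (p j) (\<lambda>A. ?b A * ?X A ^ 2) + q k j * expect (p j) (\<lambda>A. ?X A ^ 2) + 2 * ((\<mu> j)\<^sup>2 * q k j))"
    by (simp add: qb)
  also have "\<dots> \<le> 4 * (C ^ 3 * (?N\<^sup>2 * \<tau>) + C ^ 3 * (?N\<^sup>2 * \<tau>) + 2 * (C ^ 3 * (?N\<^sup>2 * \<tau>)))"
  proof (intro mult_left_mono add_mono)
    have "C * (?N\<^sup>2 * \<tau>) \<le> C ^ 3 * (?N\<^sup>2 * \<tau>)" using C2 N \<tau> by (intro mult_right_mono) auto
    then show "expect (p j) (\<lambda>A. ?b A * ?X A ^ 2) \<le> C ^ 3 * (?N\<^sup>2 * \<tau>)" using m2 by linarith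
    have "q k j * expect (p j) (\<lambda>A. ?X A ^ 2) \<le> (C * \<tau>) * (C * ?N\<^sup>2)"
      using q X2 C \<tau> by (intro mult_mono Bochner_Integration.integral_nonneg) auto
    also have "\<dots> = C\<^sup>2 * (?N\<^sup>2 * \<tau>)" by (simp add: power2_eq_square mult_ac)
    also have "\<dots> \<le> C ^ 3 * (?N\<^sup>2 * \<tau>)" using C2 N \<tau> by (intro mult_right_mono) auto
    finally show "q k j * expect (p j) (\<lambda>A. ?X A ^ 2) \<le> C ^ 3 * (?N\<^sup>2 * \<tau>)" .
    have "(\<mu> j)\<^sup>2 * q k j \<le> (C * ?N)\<^sup>2 * (C * \<tau>)"
      using \<mu> q C N \<tau> by (intro mult_mono power_mono) auto
    then show "(\<mu> j)\<^sup>2 * q k j \<le> C ^ 3 * (?N\<^sup>2 * \<tau>)"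
      by (simp add: power2_eq_square power3_eq_cube mult_ac)
  qed auto
  finally show "expect (p j) (\<lambda>A. (V j A * a k j A)\<^sup>2) \<le> 16 * C ^ 3 * ((real n / real j) powr (2 * \<gamma>) * \<tau>)"
    unfolding N2 by (simp add: mult_ac)
qed

text \<open>The point k lies in every nonempty Y k, so no small factor can be gained and
  \<open>a\<close> is simply bounded by 2.\<close>

lemma Va_moments_self:
  assumes k: "1 \<le> k" "k \<le> n"
  shows "expect (p k) (\<lambda>A. V k A * a k k A) \<le> 64 * C ^ 4 * (real n / real k) powr \<gamma>"
    and "expect (p k) (\<lambda>A. (V k A * a k k A)\<^sup>2) \<le> 128 * C ^ 4 * (real n / real k) powr (2 * \<gamma>)"
proof -
  have kI: "k \<in> {1..n}" using k by auto
  note [simp] = integrable_p[OF kI]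
  have a2: "a k k A \<le> 2" for A using q_le_1[OF kI, of k] by (cases "k \<in> A") (auto simp: a_def)
  have "expect (p k) (\<lambda>A. V k A * a k k A) \<le> expect (p k) (\<lambda>A. 2 * V k A ^ 1)"
  proof (rule expect_mono_finite[OF finite_supp[OF kI]])
    fix A show "V k A * a k k A \<le> 2 * V k A ^ 1"
      using mult_left_mono[OF a2 V_nonneg, of k A A] by (simp add: mult.commute)
  qed
  also have "\<dots> = 2 * expect (p k) (\<lambda>A. V k A ^ 1)" by simp
  also have "\<dots> \<le> 2 * (32 * C ^ 4 * (real n / real k) powr (real 1 * \<gamma>))"
    by (intro mult_left_mono V_moment k) auto
  finally show "expect (p k) (\<lambda>A. V k A * a k k A) \<le> 64 * C ^ 4 * (real n / real k) powr \<gamma>" by simp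
  have "expect (p k) (\<lambda>A. (V k A * a k k A)\<^sup>2) \<le> expect (p k) (\<lambda>A. 4 * V k A ^ 2)"
  proof (rule expect_mono_finite[OF finite_supp[OF kI]])
    fix A
    have "(V k A)\<^sup>2 * (a k k A)\<^sup>2 \<le> (V k A)\<^sup>2 * 2\<^sup>2"
      by (intro mult_left_mono power_mono a2 a_nonneg) auto
    then show "(V k A * a k k A)\<^sup>2 \<le> 4 * V k A ^ 2" by (simp add: power_mult_distrib)
  qed
  also have "\<dots> = 4 * expect (p k) (\<lambda>A. V k A ^ 2)" by simp
  also have "\<dots> \<le> 4 * (32 * C ^ 4 * (real n / real k) powr (real 2 * \<gamma>))"
    by (intro mult_left_mono V_moment k) auto
  finally show "expect (p k) (\<lambda>A. (V k A * a k k A)\<^sup>2) \<le> 128 * C ^ 4 * (real n / real k) powr (2 * \<gamma>)" by simp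
qed

text \<open>Sets of index above k never contain k. The function \<open>\<phi>\<close> will be the
  identity and the square, matching the two sums in \<open>\<rho>\<close>.\<close>

lemma sum_Va_split:
  assumes k: "1 \<le> k" "k \<le> n" and \<phi>: "\<phi> 0 = 0"
  shows "(\<Sum>j\<in>{1..n}. expect (p j) (\<lambda>A. \<phi> (V j A * a k j A)))
    = (\<Sum>j\<in>{1..<k}. expect (p j) (\<lambda>A. \<phi> (V j A * a k j A))) + expect (p k) (\<lambda>A. \<phi> (V k A * a k k A))"
proof -
  have zero: "expect (p j) (\<lambda>A. \<phi> (V j A * a k j A)) = 0" if "j \<in> {k<..n}" for j
  proof -
    have j: "j \<in> {1..n}" "k < j" using that by auto
    have "expect (p j) (\<lambda>A. \<phi> (V j A * a k j A)) = expect (p j) (\<lambda>_. 0)"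
    proof (rule expect_cong)
      fix A assume "A \<in> set_pmf (p j)"
      then have "k \<notin> A" using supp_ge[OF j(1)] j(2) by fastforce
      then show "\<phi> (V j A * a k j A) = 0" using q_eq_0[OF j] by (simp add: a_def \<phi>)
    qed
    then show ?thesis by simp
  qed
  have "sum F {1..n} = sum F {1..<k} + (F k + sum F {k<..n})" for F :: "nat \<Rightarrow> real"
  proof -
    have "{1..n} = {1..<k} \<union> insert k {k<..n}" using k by auto
    then have "sum F {1..n} = sum F {1..<k} + sum F (insert k {k<..n})"
      by (simp only:) (rule sum.union_disjoint, auto)
    then show ?thesis by simp
  qed
  from this[of "\<lambda>j. expect (p j) (\<lambda>A. \<phi> (V j A * a k j A))"] show ?thesis
    using sum.neutral[of "{k<..n}" "\<lambda>j. expect (p j) (\<lambda>A. \<phi> (V j A * a k j A))"] zero by simp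
qed

text \<open>The natural exponent of 1 / j is (r + 1) \<gamma>, which can reach 1 when r = 2. The
  free exponent \<open>s\<close> keeps the sum polynomial: it is taken as \<gamma>, 2 \<gamma> and
  \<alpha> for r = 0, 1, 2.\<close>

lemma sum_edge_weights_le:
  assumes k: "1 \<le> k" "k \<le> n" and s: "0 \<le> s" "s < 1" "s \<le> (r + 1) * \<gamma>" and r: "0 \<le> r"
  shows "(\<Sum>j\<in>{1..<k}. (real n / real j) powr (r * \<gamma>) * ((real k / real j) powr \<gamma> / real k))
    \<le> real n powr (r * \<gamma>) * real k powr (\<gamma> - s) / (1 - s)"
proof -
  have "(\<Sum>j\<in>{1..<k}. (real n / real j) powr (r * \<gamma>) * ((real k / real j) powr \<gamma> / real k))
      \<le> (\<Sum>j\<in>{1..<k}. real n powr (r * \<gamma>) * real k powr (\<gamma> - 1) * real j powr - s)"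
  proof (intro sum_mono)
    fix j assume "j \<in> {1..<k}"
    then have j: "1 \<le> real j" by auto
    have "(real n / real j) powr (r * \<gamma>) * ((real k / real j) powr \<gamma> / real k)
        = real n powr (r * \<gamma>) * real k powr (\<gamma> - 1) * real j powr - ((r + 1) * \<gamma>)"
      using j k by (simp add: powr_divide powr_diff powr_minus powr_add algebra_simps divide_simps)
    also have "\<dots> \<le> real n powr (r * \<gamma>) * real k powr (\<gamma> - 1) * real j powr - s"
      using j s by (intro mult_left_mono powr_mono) auto
    finally show "(real n / real j) powr (r * \<gamma>) * ((real k / real j) powr \<gamma> / real k)
        \<le> real n powr (r * \<gamma>) * real k powr (\<gamma> - 1) * real j powr - s" .
  qed
  also have "\<dots> = real n powr (r * \<gamma>) * real k powr (\<gamma> - 1) * (\<Sum>j\<in>{1..<k}. real j powr - s)"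
    by (simp add: sum_distrib_left)
  also have "\<dots> \<le> real n powr (r * \<gamma>) * real k powr (\<gamma> - 1) * (real k powr (1 - s) / (1 - s))"
  proof (intro mult_left_mono)
    have "(\<Sum>j\<in>{1..<k}. real j powr - s) \<le> (\<Sum>j=1..k. real j powr - s)"
      by (intro sum_mono2) auto
    then show "(\<Sum>j\<in>{1..<k}. real j powr - s) \<le> real k powr (1 - s) / (1 - s)"
      using sum_powr_less_1[OF s(1,2), of k] by linarith
  qed auto
  also have "\<dots> = real n powr (r * \<gamma>) * (real k powr (\<gamma> - 1) * real k powr (1 - s)) / (1 - s)" by simp
  also have "real k powr (\<gamma> - 1) * real k powr (1 - s) = real k powr (\<gamma> - s)"
    by (simp flip: powr_add)
  finally show ?thesis .
qed

text \<open>
  The bound \<open>\<alpha> \<le> 3 * \<gamma>\<close> is forced by the second moments in \<open>\<rho>\<close>, and \<open>\<alpha> < 1\<close> keeps the sums of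
  \<open>j powr - \<alpha>\<close> polynomial. The cut-off at \<open>3 / 4\<close> makes \<open>\<gamma> + \<alpha> > 1\<close> exactly if \<open>\<gamma> > 1 / 4\<close>, so that
  \<open>scale\<close> has the order of the sum of the fourth moments in all three regimes.
\<close>

definition \<alpha> :: real where
  "\<alpha> = min (3 * \<gamma>) (3 / 4)"

lemma \<alpha>: "0 < \<alpha>" "\<gamma> < \<alpha>" "\<alpha> < 1" "\<alpha> \<le> 3 * \<gamma>"
  using \<gamma> by (auto simp: \<alpha>_def)

lemma \<rho>_le:
  assumes k: "1 \<le> k" "k \<le> n"
  shows "\<rho> k \<le> ((4 * C\<^sup>2 / (1 - 2 * \<gamma>) + 64 * C ^ 4)\<^sup>2 + (64 * C ^ 3 + 128 * C ^ 4))
    * (real n powr (2 * \<gamma>) * real k powr (\<gamma> - \<alpha>))"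
proof -
  have kn: "1 \<le> real k" "real k \<le> real n" using k by auto
  have "(\<Sum>j\<in>{1..n}. expect (p j) (\<lambda>A. V j A * a k j A))
      = (\<Sum>j\<in>{1..<k}. expect (p j) (\<lambda>A. V j A * a k j A)) + expect (p k) (\<lambda>A. V k A * a k k A)"
    using sum_Va_split[OF k, of "\<lambda>x. x"] by simp
  also have "\<dots> \<le> (\<Sum>j\<in>{1..<k}. 4 * C\<^sup>2 * ((real n / real j) powr (1 * \<gamma>) * ((real k / real j) powr \<gamma> / real k)))
      + 64 * C ^ 4 * (real n / real k) powr \<gamma>"
    using k by (intro add_mono sum_mono Va_moments_self) (use Va_moments(1) in auto)
  also have "\<dots> = 4 * C\<^sup>2 * (\<Sum>j\<in>{1..<k}. (real n / real j) powr (1 * \<gamma>) * ((real k / real j) powr \<gamma> / real k))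
      + 64 * C ^ 4 * (real n / real k) powr \<gamma>"
    by (simp only: sum_distrib_left)
  also have "\<dots> \<le> 4 * C\<^sup>2 * (real n powr (1 * \<gamma>) * real k powr (\<gamma> - 2 * \<gamma>) / (1 - 2 * \<gamma>))
      + 64 * C ^ 4 * (real n / real k) powr \<gamma>"
    using \<gamma> by (intro add_mono mult_left_mono sum_edge_weights_le k) auto
  also have "\<dots> = (4 * C\<^sup>2 / (1 - 2 * \<gamma>) + 64 * C ^ 4) * (real n powr \<gamma> * real k powr - \<gamma>)"
  proof -
    have "(real n / real k) powr \<gamma> = real n powr \<gamma> * real k powr - \<gamma>"
      using kn by (simp add: powr_divide powr_minus_divide)
    then show ?thesis by (simp add: distrib_right)
  qed
  finally have sum1: "(\<Sum>j\<in>{1..n}. expect (p j) (\<lambda>A. V j A * a k j A))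
      \<le> (4 * C\<^sup>2 / (1 - 2 * \<gamma>) + 64 * C ^ 4) * (real n powr \<gamma> * real k powr - \<gamma>)" .
  have nonneg: "0 \<le> (\<Sum>j\<in>{1..n}. expect (p j) (\<lambda>A. V j A * a k j A))"
    by (intro sum_nonneg Bochner_Integration.integral_nonneg mult_nonneg_nonneg V_nonneg a_nonneg)
  have "(\<Sum>j\<in>{1..n}. expect (p j) (\<lambda>A. V j A * a k j A))\<^sup>2
      \<le> ((4 * C\<^sup>2 / (1 - 2 * \<gamma>) + 64 * C ^ 4) * (real n powr \<gamma> * real k powr - \<gamma>))\<^sup>2"
    by (intro power_mono sum1 nonneg)
  also have "\<dots> = (4 * C\<^sup>2 / (1 - 2 * \<gamma>) + 64 * C ^ 4)\<^sup>2 * (real n powr (2 * \<gamma>) * real k powr (- (2 * \<gamma>)))"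
    using kn by (simp add: power_mult_distrib powr_powr mult.commute flip: powr_realpow)
  \<comment> \<open>The squared first moments give the exponent -2 \<gamma> of k; this is at most
    \<gamma> - \<alpha> because \<alpha> \<le> 3 \<gamma>.\<close>
  also have "\<dots> \<le> (4 * C\<^sup>2 / (1 - 2 * \<gamma>) + 64 * C ^ 4)\<^sup>2 * (real n powr (2 * \<gamma>) * real k powr (\<gamma> - \<alpha>))"
    using kn \<alpha> by (intro mult_left_mono powr_mono) auto
  finally have part1: "(\<Sum>j\<in>{1..n}. expect (p j) (\<lambda>A. V j A * a k j A))\<^sup>2
      \<le> (4 * C\<^sup>2 / (1 - 2 * \<gamma>) + 64 * C ^ 4)\<^sup>2 * (real n powr (2 * \<gamma>) * real k powr (\<gamma> - \<alpha>))" .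
  have "(\<Sum>j\<in>{1..n}. expect (p j) (\<lambda>A. (V j A * a k j A)\<^sup>2))
      = (\<Sum>j\<in>{1..<k}. expect (p j) (\<lambda>A. (V j A * a k j A)\<^sup>2)) + expect (p k) (\<lambda>A. (V k A * a k k A)\<^sup>2)"
    using sum_Va_split[OF k, of "\<lambda>x. x\<^sup>2"] by simp
  also have "\<dots> \<le> (\<Sum>j\<in>{1..<k}. 16 * C ^ 3 * ((real n / real j) powr (2 * \<gamma>) * ((real k / real j) powr \<gamma> / real k)))
      + 128 * C ^ 4 * (real n / real k) powr (2 * \<gamma>)"
    using k by (intro add_mono sum_mono Va_moments_self) (use Va_moments(2) in auto)
  also have "\<dots> = 16 * C ^ 3 * (\<Sum>j\<in>{1..<k}. (real n / real j) powr (2 * \<gamma>) * ((real k / real j) powr \<gamma> / real k))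
      + 128 * C ^ 4 * (real n / real k) powr (2 * \<gamma>)"
    by (simp only: sum_distrib_left)
  also have "\<dots> \<le> 16 * C ^ 3 * (real n powr (2 * \<gamma>) * real k powr (\<gamma> - \<alpha>) / (1 - \<alpha>))
      + 128 * C ^ 4 * (real n powr (2 * \<gamma>) * real k powr (\<gamma> - \<alpha>))"
  proof (intro add_mono mult_left_mono)
    show "(\<Sum>j\<in>{1..<k}. (real n / real j) powr (2 * \<gamma>) * ((real k / real j) powr \<gamma> / real k))
        \<le> real n powr (2 * \<gamma>) * real k powr (\<gamma> - \<alpha>) / (1 - \<alpha>)"
      using \<alpha> by (intro sum_edge_weights_le k) auto
    have "(real n / real k) powr (2 * \<gamma>) = real n powr (2 * \<gamma>) * real k powr (- (2 * \<gamma>))"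
      using kn by (simp add: powr_divide powr_minus field_simps)
    also have "\<dots> \<le> real n powr (2 * \<gamma>) * real k powr (\<gamma> - \<alpha>)"
      using kn \<alpha> by (intro mult_left_mono powr_mono) auto
    finally show "(real n / real k) powr (2 * \<gamma>) \<le> real n powr (2 * \<gamma>) * real k powr (\<gamma> - \<alpha>)" .
  qed (use C in auto)
  \<comment> \<open>The cut-off in \<open>\<alpha>\<close> gives 1 - \<alpha> \<ge> 1/4.\<close>
  also have "\<dots> \<le> 16 * C ^ 3 * (real n powr (2 * \<gamma>) * real k powr (\<gamma> - \<alpha>) / (1 / 4))
      + 128 * C ^ 4 * (real n powr (2 * \<gamma>) * real k powr (\<gamma> - \<alpha>))"
    using C by (intro add_mono mult_left_mono divide_left_mono) (auto simp: \<alpha>_def)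
  also have "\<dots> = (64 * C ^ 3 + 128 * C ^ 4) * (real n powr (2 * \<gamma>) * real k powr (\<gamma> - \<alpha>))"
    by (simp add: algebra_simps)
  finally have part2: "(\<Sum>j\<in>{1..n}. expect (p j) (\<lambda>A. (V j A * a k j A)\<^sup>2))
      \<le> (64 * C ^ 3 + 128 * C ^ 4) * (real n powr (2 * \<gamma>) * real k powr (\<gamma> - \<alpha>))" .
  show ?thesis
    unfolding \<rho>_def using add_mono[OF part1 part2] by (simp only: distrib_right)
qed

text \<open>Each summand is (n / i) powr (2 \<gamma>), the order of the second moment of the i-th
  set, times n powr (2 \<gamma>) * i powr (\<gamma> - \<alpha>), the bound for \<rho> at i.\<close>

definition scale :: real where
  "scale = real n powr (4 * \<gamma>) * (\<Sum>i=1..n. real i powr - (\<gamma> + \<alpha>))"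

lemma sum_powr4_le_scale: "(\<Sum>i\<in>{1..n}. (real n / real i) powr (4 * \<gamma>)) \<le> scale"
  unfolding scale_def sum_distrib_left
proof (intro sum_mono)
  fix i assume "i \<in> {1..n}"
  then have i: "1 \<le> real i" by auto
  have "(real n / real i) powr (4 * \<gamma>) = real n powr (4 * \<gamma>) * real i powr - (4 * \<gamma>)"
    using i by (simp add: powr_divide powr_minus field_simps)
  also have "\<dots> \<le> real n powr (4 * \<gamma>) * real i powr - (\<gamma> + \<alpha>)"
    using i \<alpha> by (intro mult_left_mono powr_mono) auto
  finally show "(real n / real i) powr (4 * \<gamma>) \<le> real n powr (4 * \<gamma>) * real i powr - (\<gamma> + \<alpha>)" .
qed

lemma variance_T_bound_le:
  "variance_T_bound \<le> (64 * C ^ 4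
    + 8 * (((4 * C\<^sup>2 / (1 - 2 * \<gamma>) + 64 * C ^ 4)\<^sup>2 + (64 * C ^ 3 + 128 * C ^ 4)) * C)) * scale"
proof -
  define K where "K = (4 * C\<^sup>2 / (1 - 2 * \<gamma>) + 64 * C ^ 4)\<^sup>2 + (64 * C ^ 3 + 128 * C ^ 4)"
  have K: "0 \<le> K" using C by (auto simp: K_def)
  have cover: "(\<Sum>k\<in>{1..n}. expect (p i) (\<lambda>y. (\<Sum>l\<in>{1..n}. of_bool (l \<in> y)) * of_bool (k \<in> y)) * \<rho> k)
      \<le> K * C * (real n powr (4 * \<gamma>) * real i powr - (\<gamma> + \<alpha>))" if i: "i \<in> {1..n}" for i
  proof -
    note [simp] = integrable_p[OF i]
    define B where "B = K * (real n powr (2 * \<gamma>) * real i powr (\<gamma> - \<alpha>))"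
    have B: "0 \<le> B" using K by (simp add: B_def)
    have i1: "1 \<le> i" "i \<le> n" "1 \<le> real i" using i by auto
    have "(\<Sum>k\<in>{1..n}. expect (p i) (\<lambda>y. (\<Sum>l\<in>{1..n}. of_bool (l \<in> y)) * of_bool (k \<in> y)) * \<rho> k)
        = expect (p i) (\<lambda>y. \<Sum>k\<in>{1..n}. (\<Sum>l\<in>{1..n}. of_bool (l \<in> y)) * of_bool (k \<in> y) * \<rho> k)"
      by simp
    also have "\<dots> \<le> expect (p i) (\<lambda>y. B * real (card y) ^ 2)"
    proof (rule expect_mono_finite[OF finite_supp[OF i]])
      fix y assume y: "y \<in> set_pmf (p i)"
      have "(\<Sum>k\<in>{1..n}. (\<Sum>l\<in>{1..n}. of_bool (l \<in> y)) * of_bool (k \<in> y) * \<rho> k)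
          \<le> (\<Sum>k\<in>{1..n}. real (card y) * of_bool (k \<in> y) * B)"
        unfolding sum_of_bool_card[OF i y]
      proof (intro sum_mono)
        fix k assume k: "k \<in> {1..n}"
        show "real (card y) * of_bool (k \<in> y) * \<rho> k \<le> real (card y) * of_bool (k \<in> y) * B"
        proof (cases "k \<in> y")
          case True
          \<comment> \<open>The bound for \<rho> decreases in k, and all points of the i-th set are
            at least i, so its value at i serves for all of them. The sum over k then collapses to
            the squared size of the set.\<close>
          then have "i \<le> k" using supp_ge[OF i y] by auto
          have "\<rho> k \<le> K * (real n powr (2 * \<gamma>) * real k powr (\<gamma> - \<alpha>))"
            unfolding K_def using k by (intro \<rho>_le) auto
          also have "\<dots> \<le> B"
            unfolding B_def using \<open>i \<le> k\<close> i1 \<alpha> K by (intro mult_left_mono powr_mono2') auto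
          finally show ?thesis by (intro mult_left_mono) auto
        qed simp
      qed
      also have "\<dots> = B * (real (card y) * (\<Sum>k\<in>{1..n}. of_bool (k \<in> y)))"
        unfolding sum_distrib_left by (intro sum.cong refl) simp
      also have "\<dots> = B * real (card y) ^ 2"
        unfolding sum_of_bool_card[OF i y] by (simp add: power2_eq_square)
      finally show "(\<Sum>k\<in>{1..n}. (\<Sum>l\<in>{1..n}. of_bool (l \<in> y)) * of_bool (k \<in> y) * \<rho> k)
          \<le> B * real (card y) ^ 2" .
    qed
    also have "\<dots> = B * expect (p i) (\<lambda>y. real (card y) ^ 2)" by simp
    also have "\<dots> \<le> B * (C * (real n / real i) powr (real 2 * \<gamma>))"
      by (intro mult_left_mono moment i1 B) simp
    also have "\<dots> = K * C * (real n powr (4 * \<gamma>) * real i powr - (\<gamma> + \<alpha>))"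
    proof -
      have "real n powr (4 * \<gamma>) = real n powr (2 * \<gamma>) * real n powr (2 * \<gamma>)"
        by (simp flip: powr_add)
      moreover have "real i powr - (\<gamma> + \<alpha>) = real i powr (\<gamma> - \<alpha>) / real i powr (2 * \<gamma>)"
        by (simp flip: powr_diff)
      ultimately show ?thesis using i1 by (simp add: B_def powr_divide)
    qed
    finally show ?thesis .
  qed
  have "variance_T_bound \<le> (\<Sum>i\<in>{1..n}. 2 * (32 * C ^ 4 * (real n / real i) powr (4 * \<gamma>))
      + 8 * (K * C * (real n powr (4 * \<gamma>) * real i powr - (\<gamma> + \<alpha>))))"
    unfolding variance_T_bound_def
    using V_moment[of _ 4] by (intro sum_mono add_mono mult_left_mono cover) auto
  also have "\<dots> = 64 * C ^ 4 * (\<Sum>i\<in>{1..n}. (real n / real i) powr (4 * \<gamma>)) + 8 * (K * C) * scale"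
    unfolding scale_def by (simp add: sum.distrib sum_distrib_left mult_ac)
  also have "\<dots> \<le> 64 * C ^ 4 * scale + 8 * (K * C) * scale"
    using C K by (intro add_mono mult_left_mono sum_powr4_le_scale order_refl) auto
  finally show ?thesis unfolding K_def by (simp add: algebra_simps)
qed

text \<open>Splitting 3 \<gamma> as \<gamma> + 2 \<gamma> in Cauchy--Schwarz avoids separate cases
  for 3 \<gamma> around 1. Divided by a variance of order n to the power 3/2, the bound becomes sqrt
  scale / n, the same order as the main term.\<close>

lemma sum_V3_le:
  "(\<Sum>j\<in>{1..n}. expect (p j) (\<lambda>A. V j A ^ 3)) \<le> 32 * C ^ 4 * sqrt (real n / (1 - 2 * \<gamma>) * scale)"
proof -
  have s2: "(\<Sum>j\<in>{1..n}. (real n / real j) powr (2 * \<gamma>)) \<le> real n / (1 - 2 * \<gamma>)"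
  proof -
    have "(\<Sum>j\<in>{1..n}. (real n / real j) powr (2 * \<gamma>)) = real n powr (2 * \<gamma>) * (\<Sum>j=1..n. real j powr - (2 * \<gamma>))"
      unfolding sum_distrib_left by (intro sum.cong refl) (simp add: powr_divide powr_minus field_simps)
    also have "\<dots> \<le> real n powr (2 * \<gamma>) * (real n powr (1 - 2 * \<gamma>) / (1 - 2 * \<gamma>))"
      using \<gamma> by (intro mult_left_mono sum_powr_less_1) auto
    also have "\<dots> = real n / (1 - 2 * \<gamma>)"
      using n by (simp flip: powr_add)
    finally show ?thesis .
  qed
  have "(\<Sum>j\<in>{1..n}. expect (p j) (\<lambda>A. V j A ^ 3)) \<le> (\<Sum>j\<in>{1..n}. 32 * C ^ 4 * (real n / real j) powr (3 * \<gamma>))"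
    using V_moment[of _ 3] by (intro sum_mono) auto
  also have "\<dots> = 32 * C ^ 4 * (\<Sum>j\<in>{1..n}. (real n / real j) powr \<gamma> * (real n / real j) powr (2 * \<gamma>))"
    by (simp add: sum_distrib_left flip: powr_add)
  also have "\<dots> \<le> 32 * C ^ 4 * sqrt (real n / (1 - 2 * \<gamma>) * scale)"
  proof (intro mult_left_mono real_le_rsqrt)
    have sq: "(x powr y)\<^sup>2 = x powr (2 * y)" if "0 \<le> x" for x y :: real
      using that by (cases "x = 0") (auto simp: powr_powr mult.commute simp flip: powr_realpow)
    have "(\<Sum>j\<in>{1..n}. (real n / real j) powr \<gamma> * (real n / real j) powr (2 * \<gamma>))\<^sup>2
        \<le> (\<Sum>j\<in>{1..n}. ((real n / real j) powr \<gamma>)\<^sup>2) * (\<Sum>j\<in>{1..n}. ((real n / real j) powr (2 * \<gamma>))\<^sup>2)"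
      by (rule Cauchy_Schwarz_ineq_sum)
    also have "\<dots> = (\<Sum>j\<in>{1..n}. (real n / real j) powr (2 * \<gamma>)) * (\<Sum>j\<in>{1..n}. (real n / real j) powr (4 * \<gamma>))"
      by (simp add: sq)
    also have "\<dots> \<le> real n / (1 - 2 * \<gamma>) * scale"
      using \<gamma> by (intro mult_mono s2 sum_powr4_le_scale sum_nonneg) auto
    finally show "(\<Sum>j\<in>{1..n}. (real n / real j) powr \<gamma> * (real n / real j) powr (2 * \<gamma>))\<^sup>2
        \<le> real n / (1 - 2 * \<gamma>) * scale" .
  qed (use C in auto)
  finally show ?thesis .
qed

text \<open>The expected number of earlier vertices whose set contains j is at most C / (1 -
  \<gamma>), uniformly in j and n. Moreover 1 - x \<ge> exp (- x / (1 - \<beta>)) for x in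
  [0, \<beta>].\<close>

lemma prod_not_covered_ge:
  assumes \<beta>: "\<beta> < 1" and q\<beta>: "\<And>i. 1 \<le> i \<Longrightarrow> i < j \<Longrightarrow> q j i \<le> \<beta>" and j: "1 \<le> j" "j \<le> n"
  shows "exp (- (C / (1 - \<gamma>) / (1 - \<beta>))) \<le> (\<Prod>i\<in>{1..n} - {j}. 1 - q j i)"
proof -
  have "(\<Sum>i\<in>{1..<j}. q j i) \<le> (\<Sum>i\<in>{1..<j}. C * ((real n / real i) powr (0 * \<gamma>) * ((real j / real i) powr \<gamma> / real j)))"
    using q_le j by (intro sum_mono) auto
  also have "\<dots> = C * (\<Sum>i\<in>{1..<j}. (real n / real i) powr (0 * \<gamma>) * ((real j / real i) powr \<gamma> / real j))"
    by (simp only: sum_distrib_left)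
  also have "\<dots> \<le> C * (real n powr (0 * \<gamma>) * real j powr (\<gamma> - \<gamma>) / (1 - \<gamma>))"
    using \<gamma> C by (intro mult_left_mono sum_edge_weights_le j) auto
  also have "\<dots> = C / (1 - \<gamma>)" using j by simp
  finally have sum_q: "(\<Sum>i\<in>{1..<j}. q j i) \<le> C / (1 - \<gamma>)" .
  have exp_le: "exp (- (x / (1 - \<beta>))) \<le> 1 - x" if x: "0 \<le> x" "x \<le> \<beta>" for x
  proof -
    have "1 / (1 - x) = 1 + x / (1 - x)" using x \<beta> by (simp add: field_simps)
    also have "\<dots> \<le> exp (x / (1 - x))" by (rule exp_ge_add_one_self)
    also have "\<dots> \<le> exp (x / (1 - \<beta>))" using x \<beta> by (auto intro!: divide_left_mono mult_pos_pos)
    finally have "1 \<le> (1 - x) * exp (x / (1 - \<beta>))" using x \<beta> by (simp add: field_simps)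
    then show ?thesis by (simp add: exp_minus field_simps)
  qed
  have "exp (- (C / (1 - \<gamma>) / (1 - \<beta>))) \<le> exp (- ((\<Sum>i\<in>{1..<j}. q j i) / (1 - \<beta>)))"
    using divide_right_mono[OF sum_q, of "1 - \<beta>"] \<beta> by simp
  also have "\<dots> = (\<Prod>i\<in>{1..<j}. exp (- (q j i / (1 - \<beta>))))"
    by (simp add: exp_sum sum_divide_distrib sum_negf flip: sum_negf)
  also have "\<dots> \<le> (\<Prod>i\<in>{1..<j}. 1 - q j i)"
    using q\<beta> q_nonneg by (intro prod_mono conjI exp_le) auto
  also have "\<dots> = (\<Prod>i\<in>{1..n} - {j}. 1 - q j i)"
  proof (intro prod.mono_neutral_left ballI)
    fix i assume "i \<in> {1..n} - {j} - {1..<j}"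
    then have "q j i = 0" by (intro q_eq_0) auto
    then show "1 - q j i = 1" by simp
  qed (use j in auto)
  finally show ?thesis .
qed

end

section \<open>Normal approximation of the number of isolated vertices\<close>

text \<open>The exponent \<gamma> + min (3 \<gamma>) (3/4) is 4 \<gamma> up to \<gamma> = 1/4, and
  \<gamma> + 3/4 > 1 beyond, so the sum falls under the three power-sum bounds in turn.\<close>

lemma sqrt_scale_le_rate:
  fixes \<gamma> :: real
  assumes \<gamma>: "0 < \<gamma>" "\<gamma> < 1 / 2"
  obtains D where "D > 0"
    "\<And>n. 2 \<le> n \<Longrightarrow>
      sqrt (real n powr (4 * \<gamma>) * (\<Sum>i=1..n. real i powr - (\<gamma> + min (3 * \<gamma>) (3 / 4)))) / real n
      \<le> D * (if \<gamma> < 1 / 4 then 1 / sqrt (real n)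
              else if \<gamma> = 1 / 4 then sqrt (ln (real n) / real n)
              else real n powr (2 * \<gamma> - 1))"
proof (cases \<gamma> "1 / 4 :: real" rule: linorder_cases)
  case less
  show ?thesis
  proof (rule that)
    show "0 < sqrt (1 / (1 - 4 * \<gamma>))" using less by simp
    fix n :: nat assume n: "2 \<le> n"
    have "real n powr (4 * \<gamma>) * (\<Sum>i=1..n. real i powr - (\<gamma> + min (3 * \<gamma>) (3 / 4)))
        = real n powr (4 * \<gamma>) * (\<Sum>i=1..n. real i powr - (4 * \<gamma>))"
      using less by (simp add: min_def)
    also have "\<dots> \<le> real n powr (4 * \<gamma>) * (real n powr (1 - 4 * \<gamma>) / (1 - 4 * \<gamma>))"
      using less \<gamma> by (intro mult_left_mono sum_powr_less_1) auto
    also have "\<dots> = (real n powr (4 * \<gamma>) * real n powr (1 - 4 * \<gamma>)) / (1 - 4 * \<gamma>)" by simp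
    also have "real n powr (4 * \<gamma>) * real n powr (1 - 4 * \<gamma>) = real n"
      using n by (simp flip: powr_add)
    finally have "sqrt (real n powr (4 * \<gamma>) * (\<Sum>i=1..n. real i powr - (\<gamma> + min (3 * \<gamma>) (3 / 4)))) / real n
        \<le> sqrt (1 / (1 - 4 * \<gamma>) * real n) / real n"
      by (intro divide_right_mono real_sqrt_le_mono) auto
    also have "\<dots> = sqrt (1 / (1 - 4 * \<gamma>)) * (sqrt (real n) / real n)"
      by (simp only: real_sqrt_mult times_divide_eq_right)
    also have "sqrt (real n) / real n = 1 / sqrt (real n)"
      using n by (simp add: real_div_sqrt field_simps)
    finally show "sqrt (real n powr (4 * \<gamma>) * (\<Sum>i=1..n. real i powr - (\<gamma> + min (3 * \<gamma>) (3 / 4)))) / real n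
      \<le> sqrt (1 / (1 - 4 * \<gamma>)) * (if \<gamma> < 1 / 4 then 1 / sqrt (real n)
              else if \<gamma> = 1 / 4 then sqrt (ln (real n) / real n)
              else real n powr (2 * \<gamma> - 1))"
      using less by simp
  qed
next
  case equal
  show ?thesis
  proof (rule that)
    \<comment> \<open>For n \<ge> 2 the summand 1 in 1 + ln n is at most ln n / ln 2.\<close>
    show "0 < sqrt (1 / ln 2 + 1 :: real)" by (simp add: add_pos_pos)
    fix n :: nat assume n: "2 \<le> n"
    have "ln 2 \<le> ln (real n)" using n by simp
    then have ln: "1 \<le> ln (real n) / ln 2" by simp
    have "real n powr (4 * \<gamma>) * (\<Sum>i=1..n. real i powr - (\<gamma> + min (3 * \<gamma>) (3 / 4)))
        = real n * (\<Sum>i=1..n. real i powr - 1)"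
    proof -
      have "4 * \<gamma> = 1" "\<gamma> + min (3 * \<gamma>) (3 / 4) = 1" using equal by auto
      then show ?thesis using n by (simp only: powr_one of_nat_0_le_iff)
    qed
    also have "\<dots> \<le> real n * (1 + ln (real n))"
      using n by (intro mult_left_mono sum_powr_eq_1) auto
    also have "\<dots> \<le> real n * ((1 / ln 2 + 1) * ln (real n))"
      using ln by (intro mult_left_mono) (auto simp: algebra_simps)
    finally have "sqrt (real n powr (4 * \<gamma>) * (\<Sum>i=1..n. real i powr - (\<gamma> + min (3 * \<gamma>) (3 / 4)))) / real n
        \<le> sqrt (real n * ((1 / ln 2 + 1) * ln (real n))) / sqrt ((real n)\<^sup>2)"
      by (simp add: divide_right_mono)
    also have "\<dots> = sqrt ((1 / ln 2 + 1) * (ln (real n) / real n))"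
      unfolding real_sqrt_divide[symmetric] using n
      by (intro arg_cong[of _ _ sqrt]) (simp add: power2_eq_square)
    also have "\<dots> = sqrt (1 / ln 2 + 1) * sqrt (ln (real n) / real n)" by (rule real_sqrt_mult)
    finally show "sqrt (real n powr (4 * \<gamma>) * (\<Sum>i=1..n. real i powr - (\<gamma> + min (3 * \<gamma>) (3 / 4)))) / real n
      \<le> sqrt (1 / ln 2 + 1) * (if \<gamma> < 1 / 4 then 1 / sqrt (real n)
              else if \<gamma> = 1 / 4 then sqrt (ln (real n) / real n)
              else real n powr (2 * \<gamma> - 1))"
      using equal by (simp only: if_True if_False less_irrefl simp_thms)
  qed
next
  case greater
  define Z where "Z = (\<Sum>i. real i powr - (\<gamma> + 3 / 4))"
  have Z: "0 \<le> Z" unfolding Z_def using greater summable_real_powr_iff[of "- (\<gamma> + 3 / 4)"]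
    by (intro suminf_nonneg) auto
  show ?thesis
  proof (rule that)
    \<comment> \<open>Adding 1 makes the constant positive from \<open>0 \<le> Z\<close>
      alone.\<close>
    show "0 < sqrt Z + 1" using Z by (simp add: add_nonneg_pos)
    fix n :: nat assume n: "2 \<le> n"
    have "real n powr (4 * \<gamma>) * (\<Sum>i=1..n. real i powr - (\<gamma> + min (3 * \<gamma>) (3 / 4)))
        = real n powr (4 * \<gamma>) * (\<Sum>i=1..n. real i powr - (\<gamma> + 3 / 4))"
      using greater by (simp add: min_def)
    also have "\<dots> \<le> real n powr (4 * \<gamma>) * Z"
      unfolding Z_def using greater by (intro mult_left_mono sum_powr_greater_1) auto
    finally have le: "real n powr (4 * \<gamma>) * (\<Sum>i=1..n. real i powr - (\<gamma> + min (3 * \<gamma>) (3 / 4)))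
        \<le> real n powr (4 * \<gamma>) * Z" .
    have sq: "(real n powr (2 * \<gamma>))\<^sup>2 = real n powr (4 * \<gamma>)"
      using n by (simp add: powr_powr flip: powr_realpow)
    have "sqrt (real n powr (4 * \<gamma>) * (\<Sum>i=1..n. real i powr - (\<gamma> + min (3 * \<gamma>) (3 / 4)))) / real n
        \<le> sqrt ((real n powr (2 * \<gamma>))\<^sup>2 * Z) / real n"
      unfolding sq by (intro divide_right_mono real_sqrt_le_mono le) simp
    also have "\<dots> = sqrt Z * real n powr (2 * \<gamma> - 1)"
      using n by (simp add: real_sqrt_mult powr_diff)
    also have "\<dots> \<le> (sqrt Z + 1) * real n powr (2 * \<gamma> - 1)"
      by (intro mult_right_mono) auto
    finally show "sqrt (real n powr (4 * \<gamma>) * (\<Sum>i=1..n. real i powr - (\<gamma> + min (3 * \<gamma>) (3 / 4)))) / real n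
      \<le> (sqrt Z + 1) * (if \<gamma> < 1 / 4 then 1 / sqrt (real n)
              else if \<gamma> = 1 / 4 then sqrt (ln (real n) / real n)
              else real n powr (2 * \<gamma> - 1))"
      using greater by simp
  qed
qed

lemma sum_mult_diff: "(\<Sum>j=1..n. real j * (real n - real j)) = real n * ((real n)\<^sup>2 - 1) / 6"
proof -
  have 1: "(\<Sum>j=1..n. real j) = real n * (real n + 1) / 2"
    by (induction n) (auto simp: field_simps)
  have 2: "(\<Sum>j=1..n. (real j)\<^sup>2) = real n * (real n + 1) * (2 * real n + 1) / 6"
    by (induction n) (auto simp: field_simps power2_eq_square)
  have 3: "(\<Sum>j=1..n. real j * (real n - real j)) = real n * (\<Sum>j=1..n. real j) - (\<Sum>j=1..n. (real j)\<^sup>2)"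
    by (simp add: algebra_simps sum_subtractf sum_distrib_left power2_eq_square)
  show ?thesis unfolding 3 1 2 by (simp add: power2_eq_square field_simps)
qed

theorem theorem3p1:
  fixes f :: "nat \<Rightarrow> real" and \<gamma> :: real
  assumes "attachment_function f"
    and "f 0 < 1"
    and "\<gamma> \<in> {0<..<1/2}"
    and "\<forall>k. f k \<le> \<gamma> * real k + 1"
  shows "\<exists>C::real. C > 0 \<and> (\<forall>n::nat. n \<ge> 2 \<longrightarrow>
    wasserstein_dist
      (distr (measure_pmf (pref_attach f n)) borel (std_isolated f n))
      std_normal_distribution
    \<le> ereal (C * (if \<gamma> < 1/4 then 1 / sqrt (real n)
                  else if \<gamma> = 1/4 then sqrt (ln (real n) / real n)
                  else real n powr (2 * \<gamma> - 1))))"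
proof -
  note att = assms(1) and f0 = assms(2)
  have \<gamma>: "0 < \<gamma>" "\<gamma> < 1 / 2" and f_le: "\<And>k. f k \<le> \<gamma> * real k + 1" using assms by auto
  have f0': "0 < f 0" using att by (auto simp: attachment_function_def)
  obtain C where C: "C \<ge> 1"
    and moment: "\<And>j n r. 1 \<le> j \<Longrightarrow> j \<le> n \<Longrightarrow> r \<le> 4 \<Longrightarrow>
      expect (hits f j n) (\<lambda>A. real (card A) ^ r) \<le> C * (real n / real j) powr (real r * \<gamma>)"
    and edge_moment: "\<And>j k n r. 1 \<le> j \<Longrightarrow> j < k \<Longrightarrow> k \<le> n \<Longrightarrow> r \<le> 4 \<Longrightarrow>
      expect (hits f j n) (\<lambda>A. of_bool (k \<in> A) * real (card A) ^ r)
        \<le> C * ((real n / real j) powr (real r * \<gamma>) * ((real k / real j) powr \<gamma> / real k))"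
    by (rule hits_moments[OF att \<gamma> f_le]) blast
  obtain D where D: "D > 0" and rate: "\<And>n. 2 \<le> n \<Longrightarrow>
      sqrt (real n powr (4 * \<gamma>) * (\<Sum>i=1..n. real i powr - (\<gamma> + min (3 * \<gamma>) (3 / 4)))) / real n
      \<le> D * (if \<gamma> < 1/4 then 1 / sqrt (real n)
              else if \<gamma> = 1/4 then sqrt (ln (real n) / real n)
              else real n powr (2 * \<gamma> - 1))"
    by (rule sqrt_scale_le_rate[OF \<gamma>]) blast
  define \<beta> where "\<beta> = max (3 / 4) (f 0)"
  have \<beta>: "\<beta> < 1" using f0 by (simp add: \<beta>_def)
  define r where "r = exp (- (C / (1 - \<gamma>) / (1 - \<beta>)))"
  \<comment> \<open>A factor 1/4 comes from the bounds for the probabilities that H j is empty and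
    nonempty, each with a 1/2. The other 1/8 comes from (n^2 - 1) / 6 \<ge> n^2 / 8, which is sharp
    at n = 2.\<close>
  define c where "c = r * (1 - f 0) * f 0 / 32"
  have c: "0 < c" using f0 f0' by (simp add: c_def r_def)
  define KT where "KT = 64 * C ^ 4
    + 8 * (((4 * C\<^sup>2 / (1 - 2 * \<gamma>) + 64 * C ^ 4)\<^sup>2 + (64 * C ^ 3 + 128 * C ^ 4)) * C)"
  define K3 where "K3 = 32 * C ^ 4"
  define B where "B = 8 * sqrt KT / c\<^sup>2 + 12 * K3 * sqrt (1 / (1 - 2 * \<gamma>)) / c ^ 3"
  have KT: "0 < KT" using C by (simp add: KT_def add_pos_nonneg)
  have B: "0 < B" using KT C \<gamma> c by (simp add: B_def K3_def add_pos_pos)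
  show ?thesis
  proof (intro exI[of _ "B * D"] conjI allI impI)
    show "0 < B * D" using B D by simp
    fix n :: nat assume n2: "2 \<le> n"
    interpret cover: scaled_cover n "\<lambda>j. hits f j n" \<gamma> C
    proof
      show "set_pmf (hits f i n) \<subseteq> Pow {1..n}" if "i \<in> {1..n}" for i
        using set_hits[of _ f i n] that by fastforce
      show "A \<subseteq> {j..n}" if "A \<in> set_pmf (hits f j n)" for A j
        using set_hits[OF that] by simp
    qed (use n2 \<gamma> C moment edge_moment in auto)
    let ?v = "expect cover.P (\<lambda>Y. (cover.uncovered Y - cover.mean_uncovered)\<^sup>2)"
    have pref: "pref_attach f n = map_pmf edges cover.P"
      unfolding cover.P_def by (rule pref_attach_eq_hits)
    have unc: "real (num_isolated n (edges Y)) = cover.uncovered Y" if "Y \<in> set_pmf cover.P" for Y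
      using num_isolated_edges[of Y n f] that unfolding cover.P_def cover.uncovered_def by simp
    have mean: "mean_isolated f n = cover.mean_uncovered"
      unfolding mean_isolated_def pref cover.expect_uncovered[symmetric] integral_map_pmf
      by (rule expect_cong) (rule unc)
    have var: "sd_isolated f n = sqrt ?v"
      unfolding sd_isolated_def mean[unfolded mean_isolated_def] unfolding pref integral_map_pmf
      by (intro arg_cong[of _ _ sqrt] expect_cong) (simp only: unc)
    have var_ge: "c\<^sup>2 * real n \<le> ?v"
    proof -
      let ?\<zeta> = "\<lambda>j. pmf (hits f j n) {}"
      have \<zeta>: "?\<zeta> j * (1 - ?\<zeta> j) \<le> 1" for j
        using pmf_le_1[of "hits f j n" "{}"] by (intro mult_le_one) auto
      have "c * real n = r * ((1 - f 0) * f 0 / (4 * (real n)\<^sup>2)) * (real n * (real n)\<^sup>2 / 8)"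
        using n2 by (simp add: c_def field_simps power2_eq_square)
      also have "\<dots> \<le> r * ((1 - f 0) * f 0 / (4 * (real n)\<^sup>2)) * (real n * ((real n)\<^sup>2 - 1) / 6)"
      proof (intro mult_left_mono)
        have "2\<^sup>2 \<le> (real n)\<^sup>2" using n2 by (intro power_mono) auto
        then have "(real n)\<^sup>2 / 8 \<le> ((real n)\<^sup>2 - 1) / 6" by simp
        then have "real n * ((real n)\<^sup>2 / 8) \<le> real n * (((real n)\<^sup>2 - 1) / 6)" by (intro mult_left_mono) auto
        then show "real n * (real n)\<^sup>2 / 8 \<le> real n * ((real n)\<^sup>2 - 1) / 6" by simp
      qed (use f0 f0' in \<open>auto simp: r_def\<close>)
      also have "\<dots> = (\<Sum>j\<in>{1..n}. (1 - f 0) * real j / (2 * real n) * (f 0 * (real n - real j) / (2 * real n)) * r)"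
        unfolding sum_mult_diff[symmetric] sum_distrib_left
        by (intro sum.cong refl) (simp add: power2_eq_square)
      also have "\<dots> \<le> (\<Sum>j\<in>{1..n}. ?\<zeta> j * (1 - ?\<zeta> j) * (\<Prod>i\<in>{1..n} - {j}. 1 - cover.q j i))"
      proof (intro sum_mono mult_mono)
        fix j assume "j \<in> {1..n}"
        then have j: "1 \<le> j" "j \<le> n" by auto
        show "(1 - f 0) * real j / (2 * real n) \<le> ?\<zeta> j"
          by (rule pmf_hits_empty_lower[OF att f0 j n2])
        show "f 0 * (real n - real j) / (2 * real n) \<le> 1 - ?\<zeta> j"
          using pmf_hits_empty_upper[OF att f0 j] by simp
        show "r \<le> (\<Prod>i\<in>{1..n} - {j}. 1 - cover.q j i)"
          unfolding r_def
        proof (rule cover.prod_not_covered_ge[OF \<beta> _ j])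
          show "cover.q j i \<le> \<beta>" if "1 \<le> i" "i < j" for i
            unfolding cover.q_def \<beta>_def using that j by (intro expect_edge_le[OF att \<gamma> f_le f0]) auto
        qed
        show "0 \<le> f 0 * (real n - real j) / (2 * real n)" using f0' j by simp
      qed (use pmf_le_1 in \<open>auto simp: r_def intro!: mult_nonneg_nonneg\<close>)
      finally have "(c * real n)\<^sup>2 \<le> (\<Sum>j\<in>{1..n}. ?\<zeta> j * (1 - ?\<zeta> j) * (\<Prod>i\<in>{1..n} - {j}. 1 - cover.q j i))\<^sup>2"
        using c by (intro power_mono) auto
      \<comment> \<open>The marked point of H j is j itself, since by \<open>set_hits\<close> every
        nonempty H j contains it.\<close>
      also have "\<dots> \<le> ?v * (\<Sum>j\<in>{1..n}. ?\<zeta> j * (1 - ?\<zeta> j))"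
        by (rule cover.variance_lower_bound[where \<kappa> = "\<lambda>j. j"]) (use set_hits in auto)
      \<comment> \<open>The variance of the number of empty sets is at most n, so one of the two
        factors n on the left remains after division.\<close>
      also have "\<dots> \<le> ?v * (\<Sum>j\<in>{1..n}. 1)"
        by (intro mult_left_mono sum_mono \<zeta> Bochner_Integration.integral_nonneg) auto
      finally have "c\<^sup>2 * real n * real n \<le> ?v * real n"
        by (simp add: power2_eq_square mult_ac)
      then show ?thesis using n2 by simp
    qed
    define \<sigma> where "\<sigma> = sqrt ?v"
    have \<sigma>2: "\<sigma>\<^sup>2 = ?v" unfolding \<sigma>_def by (intro real_sqrt_pow2 Bochner_Integration.integral_nonneg) auto
    have \<sigma>_ge: "c * sqrt (real n) \<le> \<sigma>"
      unfolding \<sigma>_def using real_sqrt_le_mono[OF var_ge] c by (simp add: real_sqrt_mult)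
    have cn: "0 < c * sqrt (real n)" using c n2 by simp
    have \<sigma>: "0 < \<sigma>" using \<sigma>_ge cn by linarith
    have std: "std_isolated f n (edges Y) = (cover.uncovered Y - cover.mean_uncovered) / \<sigma>"
      if "Y \<in> set_pmf cover.P" for Y
      unfolding std_isolated_def unc[OF that] mean var \<sigma>_def ..
    have S: "0 \<le> cover.scale" unfolding cover.scale_def by (intro mult_nonneg_nonneg sum_nonneg) auto
    have "wasserstein_dist (distr (measure_pmf (pref_attach f n)) borel (std_isolated f n)) std_normal_distribution
        \<le> ereal (8 * sqrt cover.variance_T_bound / \<sigma>\<^sup>2 + 12 * (\<Sum>j\<in>{1..n}. expect (hits f j n) (\<lambda>A. cover.V j A ^ 3)) / \<sigma> ^ 3)"
    proof (rule wasserstein_dist_std_normal_le)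
      show "finite (set_pmf (pref_attach f n))" unfolding pref using cover.finite_P by simp
      fix g g' assume g: "stein_class g g'"
      have "expect (pref_attach f n) (\<lambda>\<omega>. g' (std_isolated f n \<omega>) - std_isolated f n \<omega> * g (std_isolated f n \<omega>))
          = expect cover.P (\<lambda>Y. g' ((cover.uncovered Y - cover.mean_uncovered) / \<sigma>)
            - (cover.uncovered Y - cover.mean_uncovered) / \<sigma> * g ((cover.uncovered Y - cover.mean_uncovered) / \<sigma>))"
        unfolding pref integral_map_pmf by (rule expect_cong) (simp add: std)
      then show "\<bar>expect (pref_attach f n) (\<lambda>\<omega>. g' (std_isolated f n \<omega>) - std_isolated f n \<omega> * g (std_isolated f n \<omega>))\<bar>
          \<le> 8 * sqrt cover.variance_T_bound / \<sigma>\<^sup>2 + 12 * (\<Sum>j\<in>{1..n}. expect (hits f j n) (\<lambda>A. cover.V j A ^ 3)) / \<sigma> ^ 3"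
        using cover.stein_bound[OF g \<sigma> \<sigma>2] by simp
    qed
    also have "\<dots> \<le> ereal (B * (sqrt cover.scale / real n))"
    proof -
      have "8 * sqrt cover.variance_T_bound / \<sigma>\<^sup>2 \<le> 8 * sqrt (KT * cover.scale) / (c * sqrt (real n))\<^sup>2"
        using cover.variance_T_bound_le \<sigma>_ge cn KT S n2 unfolding KT_def
        by (intro frac_le mult_left_mono real_sqrt_le_mono power_mono) auto
      also have "\<dots> = 8 * sqrt KT / c\<^sup>2 * (sqrt cover.scale / real n)"
        by (simp add: real_sqrt_mult power_mult_distrib)
      finally have 1: "8 * sqrt cover.variance_T_bound / \<sigma>\<^sup>2 \<le> 8 * sqrt KT / c\<^sup>2 * (sqrt cover.scale / real n)" .
      have "12 * (\<Sum>j\<in>{1..n}. expect (hits f j n) (\<lambda>A. cover.V j A ^ 3)) / \<sigma> ^ 3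
          \<le> 12 * (K3 * sqrt (real n / (1 - 2 * \<gamma>) * cover.scale)) / (c * sqrt (real n)) ^ 3"
        unfolding K3_def using \<sigma>_ge cn C \<gamma> S n2
        by (intro frac_le mult_left_mono cover.sum_V3_le power_mono) auto
      also have "\<dots> = 12 * K3 * sqrt (1 / (1 - 2 * \<gamma>)) / c ^ 3 * (sqrt cover.scale / real n)"
      proof -
        have "sqrt (real n / (1 - 2 * \<gamma>) * cover.scale) = sqrt (real n) * sqrt (1 / (1 - 2 * \<gamma>)) * sqrt cover.scale"
          by (simp flip: real_sqrt_mult)
        moreover have "(c * sqrt (real n)) ^ 3 = c ^ 3 * (sqrt (real n) * real n)"
          by (simp add: power3_eq_cube)
        ultimately show ?thesis using n2 by simp
      qed
      finally have 2: "12 * (\<Sum>j\<in>{1..n}. expect (hits f j n) (\<lambda>A. cover.V j A ^ 3)) / \<sigma> ^ 3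
          \<le> 12 * K3 * sqrt (1 / (1 - 2 * \<gamma>)) / c ^ 3 * (sqrt cover.scale / real n)" .
      show ?thesis
        unfolding B_def distrib_right ereal_less_eq by (rule add_mono[OF 1 2])
    qed
    also have "\<dots> \<le> ereal (B * D * (if \<gamma> < 1/4 then 1 / sqrt (real n)
                  else if \<gamma> = 1/4 then sqrt (ln (real n) / real n)
                  else real n powr (2 * \<gamma> - 1)))"
      using mult_left_mono[OF rate[OF n2], of B] B
      unfolding cover.scale_def cover.\<alpha>_def by (simp only: mult.assoc less_imp_le ereal_less_eq)
    finally show "wasserstein_dist
      (distr (measure_pmf (pref_attach f n)) borel (std_isolated f n)) std_normal_distribution
      \<le> ereal (B * D * (if \<gamma> < 1/4 then 1 / sqrt (real n)
                  else if \<gamma> = 1/4 then sqrt (ln (real n) / real n)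
                  else real n powr (2 * \<gamma> - 1)))" .
  qed
qed

end
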